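(* Fix $\gamma\in(0,2]$ and $Q=\frac\gamma2+\frac2\gamma$. Let $\mathbb Q$ be a Borel probability measure on $\mathbb C^{\mathbb N^*}$ (endowed with the cylinder topology), whose elements are denoted $(\phi_m)_{m\ge1}$. Let $\alpha\in\mathbb C\setminus(kac^+\cup kac^-)$ and suppose that, for this $\alpha$, the adjoint relations $$\mathcal D_{n,\bar\alpha}^*=\mathcal D_{-n,2Q-\alpha}-(\mathbf T_{\mathbb D}\phi,\mathrm v_{-n}),\qquad n\ge1,$$ hold on $L^2(\mathbb Q)$. Then, for $\mathbb Q$-a.e. $(\phi_m)_{m\ge1}$, the series $z\mapsto2\,\mathrm{Re}\big(\sum_{m=1}^\infty\phi_mz^m\big)$ converges in $\dot H^s(\mathbb S^1)$ for all $s<0$, and $\mathbb Q=\dot{\mathbb P}$ as Borel probability measures on $\dot H^s(\mathbb S^1)$.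
   Context: $\mathbb N^*=\{1,2,\dots\}$. $kac^\pm=\{(1\pm r)\frac\gamma2+(1\pm s)\frac2\gamma:\ r,s\in\mathbb N^*\}$. $\dot H^s(\mathbb S^1)=\{\phi\in H^s(\mathbb S^1):\int_0^{2\pi}\phi(e^{i\theta})\mathrm d\theta=0\}$ (real-valued distributions). $\dot{\mathbb P}$ is the law of the centred Gaussian field on $\mathbb S^1$ with covariance $-2\log|z-\zeta|$ and zero mean on the circle: $\phi(z)=2\,\mathrm{Re}(\sum_{m\ge1}\phi_mz^m)$ with $(\phi_m)_{m\ge1}$ independent complex Gaussians $\mathcal N_{\mathbb C}(0,\frac1m)$ (i.e. $\mathbb E|\phi_m|^2=\frac1m$). Operators: with the convention $\phi_{-k}=\bar\phi_k$ for $k\ge1$ (terms with index $0$ have zero coefficient), for $n\ge1$ and $\beta\in\mathbb C$ the following act on $\mathbb C[(\phi_m,\bar\phi_m)_{m\ge1}]$: $$\mathcal D_{n,\beta}=nQ\,\partial_{\phi_n}-\tfrac\beta2n\bar\phi_n+\sum_{m=1}^\infty\big[(m-n)\phi_{m-n}\partial_{\phi_m}-(m+n)\bar\phi_{m+n}\partial_{\bar\phi_m}\big],$$ $$\mathcal D_{-n,\beta}=-nQ\,\partial_{\bar\phi_n}+\tfrac\beta2n\phi_n+\sum_{m=1}^\infty\big[(m+n)\phi_{m+n}\partial_{\phi_m}-(m-n)\bar\phi_{m-n}\partial_{\bar\phi_m}\big].$$ $\mathbf T_{\mathbb D}\phi(z)=-(\partial_z\mathbf P_{\mathbb D}\phi)^2+Q\partial_{zz}^2\mathbf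 P_{\mathbb D}\phi$, where $\mathbf P_{\mathbb D}\phi(z)=2\,\mathrm{Re}\sum_{m\ge1}\phi_mz^m$, $|z|<1$; $\mathrm v_n=-z^{n+1}\partial_z$; $(q,v\partial_z)=\frac1{2\pi i}\oint q(z)v(z)\mathrm dz$. Explicitly, $-(\mathbf T_{\mathbb D}\phi,\mathrm v_{-n})=Qn(n-1)\phi_n-\sum_{k=1}^{n-1}k(n-k)\phi_k\phi_{n-k}$, acting by multiplication. "The adjoint relations hold on $L^2(\mathbb Q)$" means: all polynomials in $(\phi_m,\bar\phi_m)$ belong to $L^2(\mathbb Q)$ and for all $n\ge1$ and all $F,G\in\mathbb C[(\phi_m,\bar\phi_m)_{m\ge1}]$, $$\int(\mathcal D_{n,\bar\alpha}F)\,\overline G\,\mathrm d\mathbb Q=\int F\,\overline{\big(\mathcal D_{-n,2Q-\alpha}-(\mathbf T_{\mathbb D}\phi,\mathrm v_{-n})\big)G}\,\mathrm d\mathbb Q.$$ *)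

theory Defs
  imports
    "HOL-Probability.Probability"
    "HOL-Library.Poly_Mapping"
    "HOL-Computational_Algebra.Formal_Laurent_Series"
begin

section \<open>The polynomial algebra in the modes of the field\<close>

text \<open>
  Following the convention \<open>\<phi>\<^sub>-\<^sub>k = cnj \<phi>\<^sub>k\<close>, the variable with index \<open>k > 0\<close> stands for
  \<open>\<phi>\<^sub>k\<close> and the one with index \<open>-k\<close> for its conjugate. The underlying type also has a
  variable with index \<open>0\<close>; it is excluded from the algebra \<open>mode_polys\<close>. Polynomials are formal
  objects, so that the operators below are defined independently of any measure.
\<close>

type_synonym mode_poly = "(int \<Rightarrow>\<^sub>0 nat) \<Rightarrow>\<^sub>0 complex"

definition mode_polys :: "mode_poly set" where
  "mode_polys = {F. \<forall>mon \<in> Poly_Mapping.keys F. 0 \<notin> Poly_Mapping.keys mon}"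

definition const_poly :: "complex \<Rightarrow> mode_poly" where
  "const_poly c = Poly_Mapping.single 0 c"

definition mode_var :: "int \<Rightarrow> mode_poly" where
  "mode_var k = Poly_Mapping.single (Poly_Mapping.single k 1) 1"

text \<open>Monomials not containing the variable \<open>k\<close> contribute a zero coefficient here.\<close>

definition mode_pderiv :: "int \<Rightarrow> mode_poly \<Rightarrow> mode_poly" where
  "mode_pderiv k F = (\<Sum>mon\<in>Poly_Mapping.keys F.
     Poly_Mapping.single (mon - Poly_Mapping.single k 1)
       (of_nat (Poly_Mapping.lookup mon k) * Poly_Mapping.lookup F mon))"

definition mode_val :: "(nat \<Rightarrow> complex) \<Rightarrow> int \<Rightarrow> complex" where
  "mode_val \<phi> k = (if k > 0 then \<phi> (nat k) else cnj (\<phi> (nat (- k))))"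

definition poly_eval :: "mode_poly \<Rightarrow> (nat \<Rightarrow> complex) \<Rightarrow> complex" where
  "poly_eval F \<phi> = (\<Sum>mon\<in>Poly_Mapping.keys F. Poly_Mapping.lookup F mon *
     (\<Prod>k\<in>Poly_Mapping.keys mon. mode_val \<phi> k ^ Poly_Mapping.lookup mon k))"


section \<open>The operators\<close>

text \<open>
  \<open>D_plus Q n \<beta>\<close> and \<open>D_minus Q n \<beta>\<close> are \<open>\<D>\<^sub>n\<^sub>,\<^sub>\<beta>\<close> and \<open>\<D>\<^sub>-\<^sub>n\<^sub>,\<^sub>\<beta>\<close> for \<open>n \<ge> 1\<close>. The
  sums over \<open>m \<ge> 1\<close> have finitely many nonzero terms when applied to a given polynomial
  (lemma \<open>finite_mode_pderiv\<close>).
\<close>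

definition D_plus :: "real \<Rightarrow> nat \<Rightarrow> complex \<Rightarrow> mode_poly \<Rightarrow> mode_poly" where
  "D_plus Q n \<beta> F =
     const_poly (of_nat n * of_real Q) * mode_pderiv (int n) F
   - const_poly (\<beta> / 2 * of_nat n) * mode_var (- int n) * F
   + Sum_any (\<lambda>m::nat.
       (of_int (int m - int n) * mode_var (int m - int n) * mode_pderiv (int m) F
      - of_int (int m + int n) * mode_var (- (int m + int n)) * mode_pderiv (- int m) F)
       when m \<ge> 1)"

definition D_minus :: "real \<Rightarrow> nat \<Rightarrow> complex \<Rightarrow> mode_poly \<Rightarrow> mode_poly" where
  "D_minus Q n \<beta> F =
   - const_poly (of_nat n * of_real Q) * mode_pderiv (- int n) F
   + const_poly (\<beta> / 2 * of_nat n) * mode_var (int n) * F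
   + Sum_any (\<lambda>m::nat.
       (of_int (int m + int n) * mode_var (int m + int n) * mode_pderiv (int m) F
      - of_int (int m - int n) * mode_var (- (int m - int n)) * mode_pderiv (- int m) F)
       when m \<ge> 1)"

lemma finite_mode_pderiv: "finite {k. mode_pderiv k F \<noteq> 0}"
proof -
  have "mode_pderiv k F = 0"
    if "k \<notin> (\<Union>mon\<in>Poly_Mapping.keys F. Poly_Mapping.keys mon)" for k
    using that unfolding mode_pderiv_def
    by (intro sum.neutral) (auto simp: in_keys_iff)
  hence "{k. mode_pderiv k F \<noteq> 0} \<subseteq> (\<Union>mon\<in>Poly_Mapping.keys F. Poly_Mapping.keys mon)"
    by blast
  thus ?thesis by (rule finite_subset) auto
qed

text \<open>
  Stress-energy tensor. Since \<open>\<partial>\<^sub>z\<close> annihilates the antiholomorphic part of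
  \<open>P\<^sub>D \<phi>(z) = 2 Re (\<Sum>m\<ge>1. \<phi>\<^sub>m z\<^sup>m)\<close>, the tensor depends on \<open>\<Sum>m\<ge>1. \<phi>\<^sub>m z\<^sup>m\<close> only. It is a
  formal power series with coefficients in the polynomial algebra, and the contour
  integral \<open>1/(2\<pi>i) \<oint>\<close> is the formal residue.
\<close>

definition hol_part :: "mode_poly fps" where
  "hol_part = Abs_fps (\<lambda>m. if m = 0 then 0 else mode_var (int m))"

definition stress_tensor :: "real \<Rightarrow> mode_poly fps" where
  "stress_tensor Q = - (fps_deriv hol_part)\<^sup>2
     + fps_const (const_poly (of_real Q)) * fps_deriv (fps_deriv hol_part)"

text \<open>The coefficient of \<open>\<partial>\<^sub>z\<close> in the vector field \<open>v\<^sub>n = - z\<^sup>n\<^sup>+\<^sup>1 \<partial>\<^sub>z\<close>:\<close>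

definition vect_field :: "int \<Rightarrow> mode_poly fls" where
  "vect_field n = - fls_X_intpow (n + 1)"

definition residue_pairing :: "mode_poly fls \<Rightarrow> mode_poly fls \<Rightarrow> mode_poly" where
  "residue_pairing q v = fls_residue (q * v)"

definition stress_coeff :: "real \<Rightarrow> int \<Rightarrow> mode_poly" where
  "stress_coeff Q k = residue_pairing (fps_to_fls (stress_tensor Q)) (vect_field k)"

lemma stress_coeff_explicit:
  assumes "n \<ge> 1"
  shows "- stress_coeff Q (- int n) =
           const_poly (of_real Q * of_nat n * (of_nat n - 1)) * mode_var (int n)
         - (\<Sum>k=1..n-1. of_nat (k * (n - k)) * mode_var (int k) * mode_var (int (n - k)))"
proof -
  have "- stress_coeff Q (- int n) = fls_nth (fps_to_fls (stress_tensor Q)) (int n - 2)"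
    by (simp add: stress_coeff_def residue_pairing_def vect_field_def fls_shifted_times_simps del: fps_to_fls_nth)
  also have "\<dots> = const_poly (of_real Q * of_nat n * (of_nat n - 1)) * mode_var (int n)
         - (\<Sum>k=1..n-1. of_nat (k * (n - k)) * mode_var (int k) * mode_var (int (n - k)))"
  proof (cases "n = 1")
    case True
    thus ?thesis by (simp add: const_poly_def)
  next
    case False
    define j where "j = n - 2"
    have n: "n = j + 2" using False assms by (simp add: j_def)
    have c: "const_poly (of_real Q * of_nat n * (of_nat n - 1)) =
             const_poly (of_real Q) * (of_nat (j + 1) * of_nat (j + 2))"
    proof -
      have "const_poly (of_real Q) * (of_nat (j + 1) * of_nat (j + 2)) =
            const_poly (of_real Q) * of_nat ((j + 1) * (j + 2))"
        by (simp only: of_nat_mult)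
      also have "\<dots> = const_poly (of_real Q * of_nat ((j + 1) * (j + 2)))"
        by (simp only: const_poly_def mult_single add_0 flip: single_of_nat)
      also have "of_real Q * of_nat ((j + 1) * (j + 2)) =
                 (of_real Q * of_nat n * (of_nat n - 1) :: complex)"
        by (simp add: n algebra_simps)
      finally show ?thesis by simp
    qed
    have s: "fps_nth (fps_deriv hol_part * fps_deriv hol_part) j =
        (\<Sum>k=1..n-1. of_nat (k * (n - k)) * mode_var (int k) * mode_var (int (n - k)))"
    proof -
      have "fps_nth (fps_deriv hol_part * fps_deriv hol_part) j =
         (\<Sum>i=0..j. of_nat (Suc i) * mode_var (int (Suc i)) * (of_nat (Suc (j-i)) * mode_var (int (Suc (j-i)))))"
        by (simp add: fps_mult_nth hol_part_def del: of_nat_Suc)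
      also have "\<dots> = (\<Sum>i=0..j. of_nat (Suc i * Suc (j-i)) * mode_var (int (Suc i)) * mode_var (int (Suc (j-i))))"
        unfolding of_nat_mult by (intro sum.cong refl) (simp only: ac_simps)
      also have "\<dots> = (\<Sum>k=1..n-1. of_nat (k * (n - k)) * mode_var (int k) * mode_var (int (n - k)))"
        by (rule sum.reindex_bij_witness[of _ "\<lambda>k. k - 1" Suc])
           (auto simp: n Suc_diff_le simp del: of_nat_Suc of_nat_mult mult_Suc mult_Suc_right)
      finally show ?thesis .
    qed
    have "nat (int n - 2) = j" "\<not> int n - 2 < 0" by (simp_all add: n)
    hence "fls_nth (fps_to_fls (stress_tensor Q)) (int n - 2) = fps_nth (stress_tensor Q) j"
      by simp
    also have "\<dots> = const_poly (of_real Q) * (of_nat (j + 1) * of_nat (j + 2)) * mode_var (int n)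
                   - fps_nth (fps_deriv hol_part * fps_deriv hol_part) j"
      by (simp add: stress_tensor_def power2_eq_square hol_part_def n mult.assoc del: of_nat_Suc)
    finally show ?thesis by (simp only: c s)
  qed
  finally show ?thesis .
qed


section \<open>Adjoint relations\<close>

definition adjoint_relations :: "real \<Rightarrow> complex \<Rightarrow> (nat \<Rightarrow> complex) measure \<Rightarrow> bool" where
  "adjoint_relations Q \<alpha> \<nu> \<longleftrightarrow>
     (\<forall>F\<in>mode_polys. poly_eval F \<in> borel_measurable \<nu> \<and>
        integrable \<nu> (\<lambda>\<phi>. (cmod (poly_eval F \<phi>))\<^sup>2)) \<and>
     (\<forall>n\<ge>1. \<forall>F\<in>mode_polys. \<forall>G\<in>mode_polys.
        (\<integral>\<phi>. poly_eval (D_plus Q n (cnj \<alpha>) F) \<phi> * cnj (poly_eval G \<phi>) \<partial>\<nu>) =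
        (\<integral>\<phi>. poly_eval F \<phi> *
              cnj (poly_eval (D_minus Q n (2 * of_real Q - \<alpha>) G
                               - stress_coeff Q (- int n) * G) \<phi>) \<partial>\<nu>))"

definition kac_plus :: "real \<Rightarrow> complex set" where
  "kac_plus \<gamma> = {complex_of_real ((1 + real r) * (\<gamma> / 2) + (1 + real s) * (2 / \<gamma>)) | r s :: nat.
                   r \<ge> 1 \<and> s \<ge> 1}"

definition kac_minus :: "real \<Rightarrow> complex set" where
  "kac_minus \<gamma> = {complex_of_real ((1 - real r) * (\<gamma> / 2) + (1 - real s) * (2 / \<gamma>)) | r s :: nat.
                   r \<ge> 1 \<and> s \<ge> 1}"


section \<open>Borel sets of a topology\<close>

definition borel_on :: "'a topology \<Rightarrow> 'a measure" where
  "borel_on X = sigma (topspace X) {U. openin X U}"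

text \<open>The space \<open>\<complex>\<^sup>\<nat>\<^sup>*\<close>: families indexed by \<open>m \<ge> 1\<close>, with the product (cylinder) topology.\<close>

definition mode_space :: "(nat \<Rightarrow> complex) topology" where
  "mode_space = product_topology (\<lambda>_. euclidean) {1..}"

lemma space_borel_on [simp]: "space (borel_on X) = topspace X"
  unfolding borel_on_def by (intro space_measure_of) (auto dest: openin_subset)

lemma sets_borel_on: "sets (borel_on X) = sigma_sets (topspace X) {U. openin X U}"
  unfolding borel_on_def by (intro sets_measure_of) (auto dest: openin_subset)

lemma sets_borel_mode_space: "sets (borel_on mode_space) = sets (PiM {1..} (\<lambda>_. borel))"
proof (rule antisym)
  have ts: "topspace mode_space = space (PiM {1..} (\<lambda>_. borel :: complex measure))"
    by (simp add: mode_space_def space_PiM)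
  show "sets (borel_on mode_space) \<subseteq> sets (PiM {1..} (\<lambda>_. borel))"
    unfolding sets_borel_on ts
  proof (rule sets.sigma_sets_subset, safe)
    fix U assume U: "openin mode_space U"
    define r where "r = (\<lambda>x :: nat \<Rightarrow> complex. restrict x {1..})"
    define e where "e = (\<lambda>(x :: nat \<Rightarrow> complex) i. if i \<in> {1..} then x i else 0)"
    have "continuous_map euclidean mode_space r"
      unfolding mode_space_def r_def
      by (auto simp: continuous_map_componentwise intro: continuous_on_product_coordinates)
    hence "open (r -` U)"
      using U by (auto simp: continuous_map_def vimage_def)
    hence "r -` U \<in> sets borel" by simp
    moreover have "e \<in> measurable (PiM {1..} (\<lambda>_. borel)) borel"
    proof -
      have "(\<lambda>x. if i \<in> {1..} then x i else 0) \<in> measurable (PiM {1..} (\<lambda>_. borel)) (borel :: complex measure)"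
        for i :: nat by (cases "i \<in> {1..}") (simp_all add: measurable_component_singleton)
      hence "e \<in> measurable (PiM {1..} (\<lambda>_. borel)) (PiM UNIV (\<lambda>_. borel))"
        unfolding e_def by (rule measurable_PiM_single') (auto simp: space_PiM)
      thus ?thesis
        by (simp cong: measurable_cong_sets add: sets_PiM_equal_borel)
    qed
    ultimately have "e -` (r -` U) \<inter> space (PiM {1..} (\<lambda>_. borel)) \<in> sets (PiM {1..} (\<lambda>_. borel))"
      by (rule measurable_sets[rotated])
    also have "e -` (r -` U) \<inter> space (PiM {1..} (\<lambda>_. borel)) = U"
    proof -
      have "r (e x) = x" if "x \<in> space (PiM {1..} (\<lambda>_. borel))" for x
        using that by (auto simp: r_def e_def space_PiM PiE_def extensional_def fun_eq_iff)
      moreover have "U \<subseteq> space (PiM {1..} (\<lambda>_. borel))"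
        using openin_subset[OF U] ts by simp
      ultimately show ?thesis by auto
    qed
    finally show "U \<in> sets (PiM {1..} (\<lambda>_. borel))" .
  qed
  have m: "(\<lambda>x. x i) \<in> measurable (borel_on mode_space) (borel :: complex measure)" if "i \<ge> 1" for i
  proof (rule borel_measurableI)
    fix S :: "complex set" assume "open S"
    moreover have "continuous_map mode_space euclidean (\<lambda>x. x i)"
      unfolding mode_space_def using that by (intro continuous_map_product_projection) auto
    ultimately have "openin mode_space {x \<in> topspace mode_space. x i \<in> S}"
      by (auto simp: continuous_map_def)
    thus "(\<lambda>x. x i) -` S \<inter> space (borel_on mode_space) \<in> sets (borel_on mode_space)"
      unfolding sets_borel_on by (auto intro!: sigma_sets.Basic simp: vimage_def Int_def conj_commute)
  qed
  have id: "(\<lambda>x. x) \<in> measurable (borel_on mode_space) (PiM {1..} (\<lambda>_. borel))"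
    by (rule measurable_PiM_single') (use m in \<open>auto simp: mode_space_def\<close>)
  show "sets (PiM {1..} (\<lambda>_. borel)) \<subseteq> sets (borel_on mode_space)"
  proof (intro subsetI)
    fix A :: "(nat \<Rightarrow> complex) set" assume A: "A \<in> sets (PiM {1..} (\<lambda>_. borel))"
    from measurable_sets[OF id A] have "A \<inter> topspace mode_space \<in> sets (borel_on mode_space)"
      by (simp add: vimage_def)
    moreover have "A \<subseteq> topspace mode_space"
      using sets.sets_into_space[OF A] ts by simp
    ultimately show "A \<in> sets (borel_on mode_space)" by (simp add: Int_absorb2)
  qed
qed


section \<open>Sobolev spaces of distributions on the circle\<close>

text \<open>
  Functions on the circle are written as \<open>2\<pi>\<close>-periodic functions of the angle \<open>\<theta>\<close>. A
  real-valued distribution is a continuous real-linear functional on the real smooth functions,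
  where the pairing with a function \<open>g\<close> is \<open>f \<mapsto> \<integral>\<^sub>0\<^sup>2\<^sup>\<pi> g(\<theta>) f(\<theta>) d\<theta>\<close>.
  Distributions are \<open>undefined\<close> outside the space of test functions.
\<close>

definition test_functions :: "(real \<Rightarrow> real) set" where
  "test_functions = {f. (\<forall>\<theta>. f (\<theta> + 2 * pi) = f \<theta>) \<and>
                        (\<forall>j \<theta>. (deriv ^^ j) f differentiable at \<theta>)}"

type_synonym functional = "(real \<Rightarrow> real) \<Rightarrow> real"

definition distributions :: "functional set" where
  "distributions = {u \<in> extensional test_functions.
     (\<forall>f\<in>test_functions. \<forall>g\<in>test_functions. u (\<lambda>\<theta>. f \<theta> + g \<theta>) = u f + u g) \<and>
     (\<forall>c. \<forall>f\<in>test_functions. u (\<lambda>\<theta>. c * f \<theta>) = c * u f) \<and>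
     (\<exists>C N. \<forall>f\<in>test_functions. \<bar>u f\<bar> \<le> C * (\<Sum>j\<le>N. SUP \<theta>. \<bar>(deriv ^^ j) f \<theta>\<bar>))}"

text \<open>\<open>1/(2\<pi>) u(e\<^sup>-\<^sup>i\<^sup>k\<^sup>\<theta>)\<close>:\<close>

definition fourier_coeff :: "functional \<Rightarrow> int \<Rightarrow> complex" where
  "fourier_coeff u k = Complex (u (\<lambda>\<theta>. cos (of_int k * \<theta>))) (- u (\<lambda>\<theta>. sin (of_int k * \<theta>))) / (2 * pi)"

definition sobolev_space :: "real \<Rightarrow> functional set" where
  "sobolev_space s = {u \<in> distributions.
     (\<lambda>k::int. (1 + (of_int k)\<^sup>2) powr s * (cmod (fourier_coeff u k))\<^sup>2) summable_on UNIV}"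

definition sobolev_space0 :: "real \<Rightarrow> functional set" where
  "sobolev_space0 s = {u \<in> sobolev_space s. u (\<lambda>_. 1) = 0}"

definition sobolev_norm :: "real \<Rightarrow> functional \<Rightarrow> real" where
  "sobolev_norm s u =
     sqrt (\<Sum>\<^sub>\<infinity>k::int. (1 + (of_int k)\<^sup>2) powr s * (cmod (fourier_coeff u k))\<^sup>2)"

definition sobolev_dist :: "real \<Rightarrow> functional \<Rightarrow> functional \<Rightarrow> real" where
  "sobolev_dist s u v = sobolev_norm s (\<lambda>f\<in>test_functions. u f - v f)"

definition sobolev_topology0 :: "real \<Rightarrow> functional topology" where
  "sobolev_topology0 s = Metric_space.mtopology (sobolev_space0 s) (sobolev_dist s)"


section \<open>The field as a random distribution\<close>

definition function_distribution :: "(real \<Rightarrow> real) \<Rightarrow> functional" where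
  "function_distribution g = (\<lambda>f\<in>test_functions. integral {0..2 * pi} (\<lambda>\<theta>. g \<theta> * f \<theta>))"

definition field_partial_sum :: "(nat \<Rightarrow> complex) \<Rightarrow> nat \<Rightarrow> functional" where
  "field_partial_sum \<phi> N =
     function_distribution (\<lambda>\<theta>. 2 * Re (\<Sum>m=1..N. \<phi> m * cis \<theta> ^ m))"

definition field_converges_to :: "real \<Rightarrow> (nat \<Rightarrow> complex) \<Rightarrow> functional \<Rightarrow> bool" where
  "field_converges_to s \<phi> u \<longleftrightarrow> limitin (sobolev_topology0 s) (field_partial_sum \<phi>) u sequentially"

text \<open>
  The sum of the series as an element of the Sobolev space, set to \<open>0\<close> where the series
  diverges.
\<close>

definition field_sum :: "real \<Rightarrow> (nat \<Rightarrow> complex) \<Rightarrow> functional" where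
  "field_sum s \<phi> = (if \<exists>u. field_converges_to s \<phi> u then SOME u. field_converges_to s \<phi> u
                    else function_distribution (\<lambda>_. 0))"

text \<open>
  \<open>complex_gaussian v\<close> is \<open>\<N>\<^sub>\<complex>(0, v)\<close>: independent real and imaginary parts, each of variance
  \<open>v / 2\<close> (the library's \<open>normal_density\<close> takes the standard deviation).
\<close>

definition complex_gaussian :: "real \<Rightarrow> complex measure" where
  "complex_gaussian v =
     distr (density lborel (\<lambda>x. ennreal (normal_density 0 (sqrt (v / 2)) x)) \<Otimes>\<^sub>M
            density lborel (\<lambda>x. ennreal (normal_density 0 (sqrt (v / 2)) x)))
       borel (\<lambda>(x, y). Complex x y)"

definition gaussian_modes :: "(nat \<Rightarrow> complex) measure" where
  "gaussian_modes = PiM {1..} (\<lambda>m. complex_gaussian (1 / real m))"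

definition field_law :: "real \<Rightarrow> (nat \<Rightarrow> complex) measure \<Rightarrow> functional measure" where
  "field_law s \<nu> = distr \<nu> (borel_on (sobolev_topology0 s)) (field_sum s)"

definition log_correlated_law :: "real \<Rightarrow> functional measure" where
  "log_correlated_law s = field_law s gaussian_modes"

end

theory Submission
  imports Defs
begin

text \<open>
  Write \<open>v\<^sub>k\<close> for the variable of index \<open>k\<close>, so that \<open>v\<^sub>-\<^sub>k\<close> is the conjugate of \<open>v\<^sub>k\<close>, and \<open>E\<close> for the
  expectation under \<open>\<nu>\<close>. Take \<open>G = 1\<close> in the adjoint relations. The multiples of \<open>v\<^sub>-\<^sub>n\<close> that contain
  \<open>\<alpha>\<close> are the same on both sides, and what is left is an integration by parts formula
  \<open>E (X\<^sub>n F) = E (\<rho>\<^sub>n F)\<close> for the vector fields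
  \<open>X\<^sub>n = n Q \<partial>\<^sub>n + \<Sum>\<^sub>j (j - n) v\<^sub>j\<^sub>-\<^sub>n \<partial>\<^sub>j\<close>, with the divergence
  \<open>\<rho>\<^sub>n = Q n\<^sup>2 v\<^sub>-\<^sub>n - \<Sum>\<^sub>0\<^sub><\<^sub>k\<^sub><\<^sub>n k (n - k) v\<^sub>-\<^sub>k v\<^sub>k\<^sub>-\<^sub>n\<close>. These are the Ward identities
  (\<open>ward_identities_of_adjoint\<close>). The Gaussian modes satisfy them too, because the Gaussian law turns
  \<open>\<partial>\<^sub>j\<close> into multiplication by \<open>\<bar>j\<bar> v\<^sub>-\<^sub>j\<close> and the quadratic terms then match by the symmetry
  \<open>j \<mapsto> n - j\<close> (\<open>ward_identities_of_ibp\<close>).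

  The heart of the matter is that the Ward identities have only one normalised solution that is
  compatible with complex conjugation (\<open>ward_identities_unique\<close>). Let \<open>D\<close> be the difference of two solutions, and give \<open>v\<^sub>k\<close> the level
  \<open>\<bar>k\<bar>\<close>. If \<open>D\<close> vanishes on all monomials of level less than \<open>N\<close>, then only the terms that raise the level by
  \<open>n\<close> survive in the \<open>n\<close>-th identity on monomials of level \<open>N - n\<close>: \<open>D\<close> vanishes on the range of
  \<open>U\<^sub>n = Q n\<^sup>2 v\<^sub>-\<^sub>n - \<Sum> k (n - k) v\<^sub>-\<^sub>k v\<^sub>k\<^sub>-\<^sub>n + \<Sum>\<^sub>m\<^sub>>\<^sub>0 (m + n) v\<^sub>-\<^sub>m\<^sub>-\<^sub>n \<partial>\<^sub>-\<^sub>m\<close>. For the inner product in which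
  the adjoint of \<open>\<partial>\<^sub>j\<close> is \<open>\<bar>j\<bar> v\<^sub>j\<close>, let \<open>d\<close> be the polynomial that represents \<open>D\<close> at level \<open>N\<close>. In the
  sum over \<open>n\<close> of the pairings of \<open>D\<close> with \<open>U\<^sub>n \<partial>\<^sub>-\<^sub>n d\<close> the two cubic terms are an operator and
  minus its adjoint, so their contribution is imaginary, while the remaining term is
  \<open>Q \<Sum>\<^sub>n n \<bar>\<bar>\<partial>\<^sub>-\<^sub>n d\<bar>\<bar>\<^sup>2\<close>. As \<open>Q > 0\<close>, every \<open>\<partial>\<^sub>-\<^sub>n d\<close> is zero
  (\<open>energy_vanishes\<close>): \<open>D\<close> vanishes on each monomial of level \<open>N\<close> with a conjugated variable, and by complex
  conjugation on the others. In the language of representations, the \<open>U\<^sub>n\<close> are, up to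
  normalisation, the operators \<open>L\<^sub>-\<^sub>n\<close> on the Fock module of the Virasoro algebra with central charge
  \<open>1 + 6 Q\<^sup>2\<close> and the self-dual weight \<open>Q\<^sup>2 / 4\<close>, and the argument shows that this module has no
  singular vector of positive level.

  So \<open>\<nu>\<close> has the moments of the Gaussian modes. The Gaussian law has exponential moments; therefore
  the characteristic functions of all finite linear forms agree (\<open>iexp_expectation_of_moments\<close>), and
  so do the two measures, by the one-dimensional theorem of Levy applied to one coordinate after the other
  (\<open>PiM_char_uniqueness\<close>, \<open>adjoint_relations_imp_gaussian\<close>).

  It remains to study the field under the Gaussian law. The series converges in the Sobolev space of order
  \<open>s\<close> if and only if \<open>\<Sum> (1 + m\<^sup>2)\<^sup>s \<bar>\<phi>\<^sub>m\<bar>\<^sup>2\<close> is finite (\<open>field_converges_ex_iff\<close>), and for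
  \<open>s < 0\<close> this sum has the finite expectation \<open>\<Sum> (1 + m\<^sup>2)\<^sup>s / m\<close>. The Sobolev distance separates points because
  a distribution is determined by its Fourier coefficients, that is, because trigonometric polynomials are
  dense in the smooth functions (\<open>trig_approx_smooth\<close>).
\<close>

section \<open>Monomials and their level\<close>

abbreviation mono_single :: "int \<Rightarrow> int \<Rightarrow>\<^sub>0 nat" ("\<epsilon>") where
  "\<epsilon> j \<equiv> Poly_Mapping.single j (Suc 0)"

abbreviation "keys \<equiv> Poly_Mapping.keys"
abbreviation "lookup \<equiv> Poly_Mapping.lookup"

definition mono_level :: "(int \<Rightarrow>\<^sub>0 nat) \<Rightarrow> nat" where
  "mono_level mon = (\<Sum>k\<in>keys mon. nat \<bar>k\<bar> * lookup mon k)"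

text \<open>
  The squared norm of a monomial for the inner product in which distinct monomials are orthogonal and
  multiplication by the variable \<open>j\<close> is adjoint to \<open>1 / \<bar>j\<bar>\<close> times the derivative.
\<close>

definition mode_weight :: "(int \<Rightarrow>\<^sub>0 nat) \<Rightarrow> real" where
  "mode_weight mon =
     (\<Prod>k\<in>keys mon. fact (lookup mon k) / of_int \<bar>k\<bar> ^ lookup mon k)"

definition level_set :: "nat \<Rightarrow> (int \<Rightarrow>\<^sub>0 nat) set" where
  "level_set N = {mon. 0 \<notin> keys mon \<and> mono_level mon = N}"

lemma mono_level_superset:
  assumes "finite A" "keys mon \<subseteq> A"
  shows "mono_level mon = (\<Sum>k\<in>A. nat \<bar>k\<bar> * lookup mon k)"
  unfolding mono_level_def
  by (rule sum.mono_neutral_left) (use assms in \<open>auto simp: in_keys_iff\<close>)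

lemma mono_level_add: "mono_level (a + b) = mono_level a + mono_level b"
proof -
  let ?A = "keys a \<union> keys b"
  have "keys (a + b) \<subseteq> ?A" by (rule Poly_Mapping.keys_add)
  thus ?thesis
    by (simp add: mono_level_superset[of ?A a] mono_level_superset[of ?A b]
          mono_level_superset[of ?A "a+b"] lookup_add algebra_simps sum.distrib)
qed

lemma mono_level_single [simp]: "mono_level (\<epsilon> j) = nat \<bar>j\<bar>"
  by (simp add: mono_level_def)

lemma mono_split:
  assumes "lookup mon j > 0"
  shows "mon = (mon - \<epsilon> j) + \<epsilon> j"
  using assms by (intro poly_mapping_eqI) (auto simp: lookup_add lookup_minus lookup_single when_def)

lemma keys_add_single: "keys (mon + \<epsilon> j) = insert j (keys mon)"
  by (auto simp: in_keys_iff lookup_add lookup_single when_def split: if_splits)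

lemma mode_weight_superset:
  assumes "finite A" "keys mon \<subseteq> A"
  shows "mode_weight mon = (\<Prod>k\<in>A. fact (lookup mon k) / of_int \<bar>k\<bar> ^ lookup mon k)"
  unfolding mode_weight_def
  by (rule prod.mono_neutral_left) (use assms in \<open>auto simp: in_keys_iff\<close>)

lemma mode_weight_add_single:
  assumes "j \<noteq> 0"
  shows "mode_weight (mon + \<epsilon> j) = mode_weight mon * (lookup mon j + 1) / of_int \<bar>j\<bar>"
proof -
  let ?A = "insert j (keys mon)"
  have A: "finite ?A" by simp
  have "mode_weight (mon + \<epsilon> j) = (\<Prod>k\<in>?A. fact (lookup (mon + \<epsilon> j) k) / of_int \<bar>k\<bar> ^ lookup (mon + \<epsilon> j) k)"
    by (rule mode_weight_superset[OF A]) (simp add: keys_add_single)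
  also have "\<dots> = (\<Prod>k\<in>?A. (fact (lookup mon k) / of_int \<bar>k\<bar> ^ lookup mon k) *
       (if k = j then (lookup mon j + 1) / of_int \<bar>j\<bar> else 1))"
    by (intro prod.cong) (auto simp: lookup_add lookup_single when_def assms)
  also have "\<dots> = mode_weight mon * (\<Prod>k\<in>?A. if k = j then (lookup mon j + 1) / of_int \<bar>j\<bar> else 1)"
    unfolding mode_weight_superset[OF A subset_insertI] by (rule prod.distrib)
  also have "\<dots> = mode_weight mon * ((lookup mon j + 1) / of_int \<bar>j\<bar>)"
    by (subst prod.delta) auto
  finally show ?thesis by simp
qed

lemma mode_weight_pos: "0 \<notin> keys mon \<Longrightarrow> mode_weight mon > 0"
  unfolding mode_weight_def by (intro prod_pos) (auto intro!: divide_pos_pos zero_less_power)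

lemma level_set_add:
  assumes "mon \<in> level_set M" "j \<noteq> 0"
  shows "mon + \<epsilon> j \<in> level_set (M + nat \<bar>j\<bar>)"
  using assms by (simp add: level_set_def keys_add_single mono_level_add)

lemma finite_level_set: "finite (level_set N)"
proof -
  define K where "K = {- int N..int N}"
  have finK: "finite K" by (simp add: K_def)
  have "lookup ` level_set N \<subseteq> {f. f ` K \<subseteq> {..N} \<and> (\<forall>x. x \<notin> K \<longrightarrow> f x = 0)}"
  proof safe
    fix mon k assume mon: "mon \<in> level_set N"
    have le: "nat \<bar>k\<bar> * lookup mon k \<le> N" if "k \<in> keys mon" for k
    proof -
      have "nat \<bar>k\<bar> * lookup mon k \<le> mono_level mon"
        unfolding mono_level_def
        by (rule member_le_sum[where f = "\<lambda>k. nat \<bar>k\<bar> * lookup mon k"]) (use that in auto)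
      thus ?thesis using mon by (simp add: level_set_def)
    qed
    show "lookup mon k \<le> N"
    proof (cases "k \<in> keys mon")
      case True
      hence "k \<noteq> 0" using mon by (auto simp: level_set_def)
      hence "1 \<le> nat \<bar>k\<bar>" by simp
      hence "1 * lookup mon k \<le> nat \<bar>k\<bar> * lookup mon k"
        by (rule mult_right_mono) simp
      with le[OF True] show ?thesis by (metis mult_1 order_trans)
    qed (simp add: in_keys_iff)
    show "lookup mon k = 0" if "k \<notin> K"
    proof (rule ccontr)
      assume a: "lookup mon k \<noteq> 0"
      hence "nat \<bar>k\<bar> * 1 \<le> nat \<bar>k\<bar> * lookup mon k"
        by (intro mult_left_mono) auto
      also have "\<dots> \<le> N" by (rule le) (simp add: in_keys_iff a)
      finally show False using that by (auto simp: K_def)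
    qed
  qed
  moreover have "finite {f :: int \<Rightarrow> nat. f ` K \<subseteq> {..N} \<and> (\<forall>x. x \<notin> K \<longrightarrow> f x = 0)}"
    using finite_set_of_finite_funs[OF finK, of "{..N}" 0]
    by (rule rev_finite_subset) (auto simp: image_subset_iff)
  ultimately have "finite (lookup ` level_set N)" by (rule finite_subset)
  thus ?thesis by (rule finite_imageD) (auto intro!: inj_onI poly_mapping_eqI)
qed

section \<open>Positivity of the top-level Ward identities\<close>

text \<open>
  The parts of the \<open>n\<close>-th Ward identity for a functional \<open>M\<close> that do not involve \<open>Q\<close>: one summand of the derivation
  that moves the index \<open>j\<close> to \<open>j - n\<close>, and the quadratic part of the divergence.
\<close>

abbreviation transport_term :: "nat \<Rightarrow> ((int \<Rightarrow>\<^sub>0 nat) \<Rightarrow> complex) \<Rightarrow> (int \<Rightarrow>\<^sub>0 nat) \<Rightarrow> int \<Rightarrow> complex" where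
  "transport_term n M mon j \<equiv> of_int (j - int n) * of_nat (lookup mon j) * M (mon - \<epsilon> j + \<epsilon> (j - int n))"

abbreviation quadratic_term :: "nat \<Rightarrow> ((int \<Rightarrow>\<^sub>0 nat) \<Rightarrow> complex) \<Rightarrow> (int \<Rightarrow>\<^sub>0 nat) \<Rightarrow> complex" where
  "quadratic_term n M mon \<equiv> (\<Sum>k=1..n-1. of_nat (k * (n - k)) * M (mon + \<epsilon> (- int k) + \<epsilon> (- int (n - k))))"

text \<open>
  Multiply the hypothesis for \<open>(n, mon)\<close> by \<open>n / mode_weight mon\<close> times the conjugate of
  \<open>D (mon + \<epsilon> (- n))\<close> and sum over all pairs. The quadratic terms add up to a sum \<open>P\<close> over splittings
  \<open>n = k + l\<close>; the transport terms merge \<open>m\<close> and \<open>n\<close> into \<open>m + n\<close> and add up to \<open>- cnj P\<close>, since the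
  weights make splitting and merging adjoint to each other. Hence a sum of nonnegative
  multiples of the \<open>\<bar>D (mon + \<epsilon> (- n))\<bar>\<^sup>2\<close> equals \<open>P - cnj P\<close>, which is imaginary.
\<close>

lemma energy_vanishes:
  fixes D :: "(int \<Rightarrow>\<^sub>0 nat) \<Rightarrow> complex" and Q :: real
  assumes Q: "Q > 0"
    and top: "\<And>n mon. 1 \<le> n \<Longrightarrow> n \<le> N \<Longrightarrow> mon \<in> level_set (N - n) \<Longrightarrow>
      (\<Sum>j\<in>{j\<in>keys mon. j < 0}. transport_term n D mon j)
      = of_real Q * of_nat n ^ 2 * D (mon + \<epsilon> (- int n))
        - quadratic_term n D mon"
    and n: "1 \<le> n" "n \<le> N" and mon: "mon \<in> level_set (N - n)"
  shows "D (mon + \<epsilon> (- int n)) = 0"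
proof -
  define t where "t = (\<lambda>(k, l, mon). complex_of_real (real (k * l * (k + l)) / mode_weight mon) *
     (cnj (D (mon + \<epsilon> (- int (k + l)))) * D (mon + \<epsilon> (- int k) + \<epsilon> (- int l))))"
  define T where "T = (SIGMA k:{1..N}. SIGMA l:{1..N-k}. level_set (N - (k + l)))"
  have finT: "finite T" unfolding T_def by (intro finite_SigmaI finite_level_set) auto
  define P where "P = sum t T"
  define I where "I = (SIGMA n:{1..N}. level_set (N - n))"
  have finI: "finite I" unfolding I_def by (intro finite_SigmaI finite_level_set) auto
  define f where "f = (\<lambda>(n, mon). complex_of_real (real n / mode_weight mon) * cnj (D (mon + \<epsilon> (- int n))))"
  define A where "A = (\<lambda>(n :: nat, mon). \<Sum>k=1..n-1. of_nat (k * (n - k)) * D (mon + \<epsilon> (- int k) + \<epsilon> (- int (n - k))))"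
  define B where "B = (\<lambda>(n, mon). \<Sum>j\<in>{j\<in>keys mon. j < 0}.
     transport_term n D mon j)"
  have 1: "(\<Sum>x\<in>I. f x * A x) = P"
  proof -
    have "(\<Sum>x\<in>I. f x * A x) = (\<Sum>x\<in>I. \<Sum>k\<in>{1..fst x - 1}. f x * (of_nat (k * (fst x - k)) * D (snd x + \<epsilon> (- int k) + \<epsilon> (- int (fst x - k)))))"
      unfolding A_def by (simp add: case_prod_unfold sum_distrib_left)
    also have "\<dots> = (\<Sum>(x,k)\<in>(SIGMA x:I. {1..fst x - 1}). f x * (of_nat (k * (fst x - k)) * D (snd x + \<epsilon> (- int k) + \<epsilon> (- int (fst x - k)))))"
      using finI by (intro sum.Sigma) auto
    also have "\<dots> = P" unfolding P_def
      by (rule sum.reindex_bij_witness[of _ "\<lambda>(k,l,mon). ((k+l,mon),k)" "\<lambda>((n,mon),k). (k,n-k,mon)"])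
         (auto simp: I_def T_def t_def f_def field_simps)
    finally show ?thesis .
  qed
  \<comment> \<open>Reindex by the monomial that is left after the merged index has been removed.\<close>
  have 2: "(\<Sum>x\<in>I. f x * B x) = - cnj P"
  proof -
    have "(\<Sum>x\<in>I. f x * B x) = (\<Sum>x\<in>I. \<Sum>j\<in>{j\<in>keys (snd x). j < 0}.
       f x * (of_int (j - int (fst x)) * of_nat (lookup (snd x) j) * D (snd x - \<epsilon> j + \<epsilon> (j - int (fst x)))))"
      unfolding B_def by (simp add: case_prod_unfold sum_distrib_left)
    also have "\<dots> = (\<Sum>(x,j)\<in>(SIGMA x:I. {j\<in>keys (snd x). j < 0}).
       f x * (of_int (j - int (fst x)) * of_nat (lookup (snd x) j) * D (snd x - \<epsilon> j + \<epsilon> (j - int (fst x)))))"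
      using finI by (intro sum.Sigma) auto
    also have "\<dots> = (\<Sum>x\<in>T. - cnj (t x))"
    proof (rule sum.reindex_bij_witness[of _ "\<lambda>(m,n,mon). ((n,mon + \<epsilon> (- int m)),- int m)"
          "\<lambda>((n,mon),j). (nat (- j),n,mon - \<epsilon> j)"], goal_cases)
      case (1 a)
      then obtain n mon j where a: "a = ((n,mon),j)" "1 \<le> n" "n \<le> N" "mon \<in> level_set (N - n)" "lookup mon j > 0" "j < 0"
        by (auto simp: I_def in_keys_iff)
      show ?case using mono_split[OF a(5)] a by auto
    next
      case (2 a)
      then obtain n mon j where a: "a = ((n,mon),j)" "1 \<le> n" "n \<le> N" "mon \<in> level_set (N - n)" "lookup mon j > 0" "j < 0"
        by (auto simp: I_def in_keys_iff)
      define mon' where "mon' = mon - \<epsilon> j"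
      have m: "mon = mon' + \<epsilon> j" unfolding mon'_def by (rule mono_split) fact
      have "mono_level mon' + nat (- j) = N - n" "0 \<notin> keys mon'"
        using a(4,6) unfolding m level_set_def by (auto simp: mono_level_add keys_add_single)
      thus ?case using a by (auto simp: T_def level_set_def mon'_def[symmetric])
    next
      case (3 b)
      thus ?case by (auto simp: T_def)
    next
      case (4 b)
      then obtain m n mon where b: "b = (m,n,mon)" "1 \<le> m" "1 \<le> n" "m + n \<le> N" "mon \<in> level_set (N - (m + n))"
        by (auto simp: T_def)
      have "mon + \<epsilon> (- int m) \<in> level_set (N - (m + n) + m)"
        using level_set_add[OF b(5), of "- int m"] b(2) by simp
      moreover have "N - (m + n) + m = N - n" using b by simp
      ultimately show ?case using b by (auto simp: I_def keys_add_single)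
    next
      case (5 a)
      then obtain n mon j where a: "a = ((n,mon),j)" "1 \<le> n" "n \<le> N" "mon \<in> level_set (N - n)" "lookup mon j > 0" "j < 0"
        by (auto simp: I_def in_keys_iff)
      define mon' where "mon' = mon - \<epsilon> j"
      have m: "mon = mon' + \<epsilon> j" unfolding mon'_def by (rule mono_split) fact
      define m where "m = nat (- j)"
      have j: "j = - int m" "m \<ge> 1" using a(6) by (auto simp: m_def)
      have nz: "mode_weight mon' \<noteq> 0"
        using mode_weight_pos[of mon'] a(4) unfolding m level_set_def by (auto simp: keys_add_single)
      have l: "lookup (mon' + \<epsilon> j) j = lookup mon' j + 1" by (simp add: lookup_add)
      have w: "mode_weight (mon' + \<epsilon> j) = mode_weight mon' * (lookup mon' j + 1) / m"
        using j by (subst mode_weight_add_single) auto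
      have c: "real n / mode_weight (mon' + \<epsilon> j) * (real m + real n) * (lookup mon' j + 1) = real (m * n * (m + n)) / mode_weight mon'"
        unfolding w using nz j(2) by (simp add: field_simps del: of_nat_Suc)
      have "- cnj (t (m, n, mon')) = - (complex_of_real (real (m * n * (m + n)) / mode_weight mon') *
          (D (mon' + \<epsilon> (j - int n)) * cnj (D (mon' + \<epsilon> j + \<epsilon> (- int n)))))"
        by (simp add: t_def j)
      also have "\<dots> = f (n, mon' + \<epsilon> j) * (of_int (j - int n) * of_nat (lookup (mon' + \<epsilon> j) j) * D (mon' + \<epsilon> (j - int n)))"
      proof -
        have r: "- (complex_of_real (a * b * c) * (X * Y)) = complex_of_real a * Y * (- complex_of_real b * complex_of_real c * X)"
          for a b c X Y by (simp only: of_real_mult) (simp add: mult_ac)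
        have 1: "of_int (j - int n) = - complex_of_real (real m + real n)" by (simp add: j)
        have 2: "of_nat (lookup mon' j + 1) = complex_of_real (real (lookup mon' j + 1))" by simp
        show ?thesis unfolding c[symmetric] f_def l r prod.case 1 2 ..
      qed
      finally show ?case by (simp add: a(1) mon'_def[symmetric] m_def[symmetric]) (simp add: m)
    qed
    finally show ?thesis unfolding P_def by (simp add: sum_negf)
  qed
  define s where "s = (\<lambda>(n, mon). real (n ^ 3) * Q / mode_weight mon * (cmod (D (mon + \<epsilon> (- int n))))\<^sup>2)"
  have "f x * B x = of_real (s x) - f x * A x" if "x \<in> I" for x
  proof -
    obtain n mon where xe: "x = (n, mon)" by (cases x)
    hence x: "x = (n, mon)" "1 \<le> n" "n \<le> N" "mon \<in> level_set (N - n)"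
      using that by (auto simp: I_def)
    have "B x = of_real Q * of_nat n ^ 2 * D (mon + \<epsilon> (- int n)) - A x"
      using top[OF x(2-4)] by (simp add: x(1) A_def B_def)
    moreover have "f x * (of_real Q * of_nat n ^ 2 * D (mon + \<epsilon> (- int n))) = of_real (s x)"
    proof -
      have "complex_of_real a * cnj Z * (of_real Q * of_nat n ^ 2 * Z) = of_real (a * Q * real n ^ 2 * (cmod Z)\<^sup>2)" for a Z
        by (simp only: of_real_mult complex_norm_square) (simp add: mult_ac)
      note this[of "real n / mode_weight mon" "D (mon + \<epsilon> (- int n))"]
      moreover have "s x = real n / mode_weight mon * Q * real n ^ 2 * (cmod (D (mon + \<epsilon> (- int n))))\<^sup>2"
        by (simp add: s_def x(1) power3_eq_cube power2_eq_square)
      ultimately show ?thesis by (simp only: f_def x(1) prod.case)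
    qed
    ultimately show ?thesis by (simp add: right_diff_distrib)
  qed
  hence "(\<Sum>x\<in>I. f x * B x) = (\<Sum>x\<in>I. of_real (s x) - f x * A x)" by (intro sum.cong) auto
  hence "- cnj P = of_real (sum s I) - P" by (simp add: 1 2 sum_subtractf)
  hence "Re (- cnj P) = Re (of_real (sum s I) - P)" by simp
  hence "sum s I = 0" by simp
  moreover have "s x \<ge> 0" if "x \<in> I" for x
    using that Q mode_weight_pos by (force simp: s_def I_def level_set_def intro!: mult_nonneg_nonneg divide_nonneg_nonneg)
  ultimately have "s (n, mon) = 0"
    using finI n mon by (subst (asm) sum_nonneg_eq_0_iff) (auto simp: I_def)
  thus ?thesis using mode_weight_pos[of mon] Q n mon by (auto simp: s_def level_set_def)
qed

section \<open>Uniqueness of solutions of the Ward identities\<close>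

text \<open>
  The formula \<open>E (X\<^sub>n F) = E (\<rho>\<^sub>n F)\<close> for monomials \<open>F\<close>, where \<open>M\<close> plays the role of the expectation. In the term \<open>j = n\<close> of the sum the variable of index \<open>0\<close> occurs, but with
  coefficient zero.
\<close>

definition ward_identities :: "real \<Rightarrow> ((int \<Rightarrow>\<^sub>0 nat) \<Rightarrow> complex) \<Rightarrow> bool" where
  "ward_identities Q M \<longleftrightarrow> (\<forall>n\<ge>1. \<forall>mon. 0 \<notin> keys mon \<longrightarrow>
     of_real Q * of_nat n * of_nat (lookup mon (int n)) * M (mon - \<epsilon> (int n))
     + (\<Sum>j\<in>keys mon. transport_term n M mon j)
     = of_real Q * of_nat n ^ 2 * M (mon + \<epsilon> (- int n))
       - quadratic_term n M mon)"

lemma ward_identities_diff: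
  assumes "ward_identities Q M" "ward_identities Q M'"
  shows "ward_identities Q (\<lambda>mon. M mon - M' mon)"
  unfolding ward_identities_def
proof (intro allI impI)
  fix n :: nat and mon :: "int \<Rightarrow>\<^sub>0 nat" assume n: "1 \<le> n" and mon: "0 \<notin> keys mon"
  note a = assms[unfolded ward_identities_def, rule_format, OF n mon]
  have combine: "(a - a') + (b - b') = (c - c') - (d - d')" if "a + b = c - d" "a' + b' = c' - d'"
    for a b c d a' b' c' d' :: complex
    using that by (simp add: algebra_simps)
  show "of_real Q * of_nat n * of_nat (lookup mon (int n)) * (M (mon - \<epsilon> (int n)) - M' (mon - \<epsilon> (int n)))
     + (\<Sum>j\<in>keys mon. of_int (j - int n) * of_nat (lookup mon j) *
          (M (mon - \<epsilon> j + \<epsilon> (j - int n)) - M' (mon - \<epsilon> j + \<epsilon> (j - int n))))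
     = of_real Q * of_nat n ^ 2 * (M (mon + \<epsilon> (- int n)) - M' (mon + \<epsilon> (- int n)))
       - (\<Sum>k=1..n-1. of_nat (k * (n - k)) * (M (mon + \<epsilon> (- int k) + \<epsilon> (- int (n - k)))
            - M' (mon + \<epsilon> (- int k) + \<epsilon> (- int (n - k)))))"
    unfolding right_diff_distrib sum_subtractf
    by (rule combine[OF a])
qed


lemma inj_uminus_int: "inj (uminus :: int \<Rightarrow> int)" by (simp add: inj_on_def)

lemma keys_flip: "keys (Poly_Mapping.map_key uminus mon) = uminus ` keys (mon :: int \<Rightarrow>\<^sub>0 nat)"
proof -
  have "k \<in> keys (Poly_Mapping.map_key uminus mon) \<longleftrightarrow> - k \<in> keys mon" for k
    by (simp add: in_keys_iff map_key.rep_eq inj_uminus_int)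
  moreover have "- k \<in> A \<longleftrightarrow> k \<in> uminus ` A" for k and A :: "int set"
    unfolding image_iff by (auto intro!: bexI[of _ "- k"])
  ultimately show ?thesis by blast
qed

lemma mono_level_flip: "mono_level (Poly_Mapping.map_key uminus mon) = mono_level mon"
  unfolding mono_level_def keys_flip
  by (subst sum.reindex) (auto simp: map_key.rep_eq inj_uminus_int inj_on_def)

text \<open>
  Induction on the level. In the \<open>n\<close>-th identity on a monomial of level \<open>N - n\<close>, the terms with \<open>j > 0\<close> have
  level less than \<open>N\<close>, and the remaining ones are those of \<open>energy_vanishes\<close>. That lemma covers monomials with a
  negative index; \<open>flip\<close> carries the conclusion over to monomials with positive indices only.
\<close>

lemma ward_identities_unique:
  assumes Q: "Q > 0" and ward: "ward_identities Q D" and D0: "D 0 = 0"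
    and flip: "\<And>mon. 0 \<notin> keys mon \<Longrightarrow> D (Poly_Mapping.map_key uminus mon) = cnj (D mon)"
    and mon: "0 \<notin> keys mon"
  shows "D mon = 0"
  using mon
proof (induction "mono_level mon" arbitrary: mon rule: less_induct)
  case (less mon)
  define N where "N = mono_level mon"
  have IH: "D \<kappa> = 0" if "mono_level \<kappa> < N" "0 \<notin> keys \<kappa>" for \<kappa>
    using less.hyps that by (auto simp: N_def)
  have top: "(\<Sum>j\<in>{j\<in>keys \<kappa>. j < 0}. transport_term n D \<kappa> j)
      = of_real Q * of_nat n ^ 2 * D (\<kappa> + \<epsilon> (- int n))
        - quadratic_term n D \<kappa>"
    if n: "1 \<le> n" "n \<le> N" and \<kappa>: "\<kappa> \<in> level_set (N - n)" for n \<kappa>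
  proof -
    have \<kappa>': "0 \<notin> keys \<kappa>" "mono_level \<kappa> = N - n" using \<kappa> by (auto simp: level_set_def)
    have minus: "0 \<notin> keys (\<kappa> - \<epsilon> j)" "mono_level (\<kappa> - \<epsilon> j) + nat \<bar>j\<bar> = N - n"
      if "lookup \<kappa> j > 0" for j
    proof -
      define \<kappa>1 where "\<kappa>1 = \<kappa> - \<epsilon> j"
      have e: "\<kappa> = \<kappa>1 + \<epsilon> j" unfolding \<kappa>1_def by (rule mono_split) fact
      show "0 \<notin> keys (\<kappa> - \<epsilon> j)" "mono_level (\<kappa> - \<epsilon> j) + nat \<bar>j\<bar> = N - n"
        using \<kappa>' unfolding \<kappa>1_def[symmetric] unfolding e keys_add_single mono_level_add mono_level_single by auto
    qed
    have 1: "of_nat (lookup \<kappa> (int n)) * D (\<kappa> - \<epsilon> (int n)) = 0"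
    proof (cases "lookup \<kappa> (int n) > 0")
      case True
      thus ?thesis using IH[of "\<kappa> - \<epsilon> (int n)"] minus[OF True] n by auto
    qed auto
    have 2: "transport_term n D \<kappa> j = 0"
      if "j \<in> keys \<kappa>" "\<not> j < 0" for j
    proof (cases "j = int n")
      case False
      have j: "lookup \<kappa> j > 0" using that(1) by (simp add: in_keys_iff)
      have "j \<noteq> 0" using that(1) \<kappa>'(1) by auto
      have "mono_level (\<kappa> - \<epsilon> j + \<epsilon> (j - int n)) < N"
        unfolding mono_level_add mono_level_single using minus(2)[OF j] n False \<open>j \<noteq> 0\<close> that(2) by linarith
      moreover have "0 \<notin> keys (\<kappa> - \<epsilon> j + \<epsilon> (j - int n))"
        unfolding keys_add_single using minus(1)[OF j] False by auto
      ultimately show ?thesis using IH by simp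
    qed auto
    have "(\<Sum>j\<in>{j\<in>keys \<kappa>. j < 0}. transport_term n D \<kappa> j)
       = (\<Sum>j\<in>keys \<kappa>. transport_term n D \<kappa> j)"
      by (rule sum.mono_neutral_left) (use 2 in auto)
    also have "\<dots> = of_real Q * of_nat n ^ 2 * D (\<kappa> + \<epsilon> (- int n))
        - quadratic_term n D \<kappa>"
      using ward[unfolded ward_identities_def, rule_format, OF n(1) \<kappa>'(1)] 1 by (simp add: mult.assoc)
    finally show ?thesis .
  qed
  have neg: "D \<mu> = 0" if \<mu>: "\<mu> \<in> level_set N" and j: "j \<in> keys \<mu>" "j < 0" for \<mu> j
  proof -
    define n where "n = nat (- j)"
    have jn: "j = - int n" "n \<ge> 1" using j by (auto simp: n_def)
    define \<kappa> where "\<kappa> = \<mu> - \<epsilon> j"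
    have e: "\<mu> = \<kappa> + \<epsilon> j" unfolding \<kappa>_def by (rule mono_split) (use j in \<open>simp add: in_keys_iff\<close>)
    have "0 \<notin> keys \<kappa>" "mono_level \<kappa> + n = N"
      using \<mu> j(2) unfolding e level_set_def mem_Collect_eq keys_add_single mono_level_add mono_level_single
      by (auto simp: n_def abs_if)
    hence "\<kappa> \<in> level_set (N - n)" "n \<le> N" by (auto simp: level_set_def)
    have "D (\<kappa> + \<epsilon> (- int n)) = 0"
      by (rule energy_vanishes[where N = N, OF Q _ jn(2)]) (rule top, assumption+, fact+)
    thus ?thesis by (simp only: e jn(1))
  qed
  show ?case
  proof (cases "mon = 0")
    case False
    then obtain j where j: "j \<in> keys mon" by fastforce
    have L: "mon \<in> level_set N" using less.prems by (simp add: N_def level_set_def)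
    show ?thesis
    proof (cases "j < 0")
      case True
      thus ?thesis using neg[OF L j] by simp
    next
      case False
      hence "j > 0" using j less.prems by (cases "j = 0") auto
      moreover have "Poly_Mapping.map_key uminus mon \<in> level_set N"
        using less.prems by (auto simp: level_set_def mono_level_flip keys_flip N_def)
      ultimately have "D (Poly_Mapping.map_key uminus mon) = 0"
        using j by (intro neg[of _ "- j"]) (auto simp: keys_flip)
      thus ?thesis using flip[OF less.prems] by simp
    qed
  qed (simp add: D0)
qed


text \<open>
  Integration by parts turns both sides into sums of \<open>c j = M (mon + \<epsilon> (j - n) + \<epsilon> (- j))\<close>. As \<open>c\<close> is
  invariant under \<open>j \<mapsto> n - j\<close>, one may average the coefficient \<open>(j - n) \<bar>j\<bar>\<close> over this reflection: the
  average vanishes outside \<open>0 < j < n\<close> and is \<open>- j (n - j)\<close> inside.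
\<close>

lemma ward_identities_of_ibp:
  fixes M :: "(int \<Rightarrow>\<^sub>0 nat) \<Rightarrow> complex"
  assumes ibp: "\<And>mon j. 0 \<notin> keys mon \<Longrightarrow> j \<noteq> 0 \<Longrightarrow>
      of_nat (lookup mon j) * M (mon - \<epsilon> j) = of_int \<bar>j\<bar> * M (mon + \<epsilon> (- j))"
  shows "ward_identities Q M"
  unfolding ward_identities_def
proof (intro allI impI)
  fix n :: nat and mon :: "int \<Rightarrow>\<^sub>0 nat" assume n: "1 \<le> n" and mon: "0 \<notin> keys mon"
  define c where "c j = M (mon + \<epsilon> (j - int n) + \<epsilon> (- j))" for j
  have c_sym: "c (int n - j) = c j" for j by (simp add: c_def add_ac)
  define t where "t j = of_int ((j - int n) * \<bar>j\<bar>) * c j" for j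
  have t: "transport_term n M mon j = t j" for j
  proof (cases "j = 0 \<or> j = int n")
    case True
    thus ?thesis using mon by (auto simp: t_def in_keys_iff)
  next
    case False
    let ?mon = "mon + \<epsilon> (j - int n)"
    have "0 \<notin> keys ?mon" using mon False by (simp only: keys_add_single) auto
    hence "of_nat (lookup ?mon j) * M (?mon - \<epsilon> j) = of_int \<bar>j\<bar> * c j"
      unfolding c_def using False by (intro ibp) auto
    moreover have l: "lookup ?mon j = lookup mon j"
      using n by (simp add: lookup_add lookup_single)
    moreover have "?mon - \<epsilon> j = mon - \<epsilon> j + \<epsilon> (j - int n)" if "lookup mon j > 0"
      using that n by (intro poly_mapping_eqI) (auto simp: lookup_add lookup_minus lookup_single when_def)
    ultimately have "of_nat (lookup mon j) * M (mon - \<epsilon> j + \<epsilon> (j - int n)) = of_int \<bar>j\<bar> * c j"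
      by (cases "lookup mon j > 0") simp_all
    thus ?thesis by (simp add: t_def mult.assoc)
  qed
  obtain R :: int where R: "keys mon \<subseteq> {-R..R}" "R \<ge> 0"
  proof
    let ?R = "\<Sum>k\<in>keys mon. \<bar>k\<bar>"
    have "\<bar>k\<bar> \<le> ?R" if "k \<in> keys mon" for k
      by (rule member_le_sum) (use that in auto)
    thus "keys mon \<subseteq> {- ?R..?R}" by (force simp: abs_le_iff)
  qed (simp add: sum_nonneg)
  \<comment> \<open>An interval that contains all indices in use and is stable under the reflection.\<close>
  define J where "J = {-R..int n + R}"
  have S: "(\<Sum>j\<in>keys mon. transport_term n M mon j) = sum t J"
  proof -
    have "(\<Sum>j\<in>keys mon. transport_term n M mon j)
      = (\<Sum>j\<in>J. transport_term n M mon j)"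
      by (rule sum.mono_neutral_left) (use R in \<open>auto simp: J_def in_keys_iff\<close>)
    thus ?thesis by (simp only: t)
  qed
  have "sum t J = (\<Sum>j\<in>J. t (int n - j))"
    by (rule sum.reindex_bij_witness[of _ "\<lambda>j. int n - j" "\<lambda>j. int n - j"]) (auto simp: J_def)
  hence "2 * sum t J = (\<Sum>j\<in>J. t j + t (int n - j))" by (simp add: sum.distrib)
  also have "\<dots> = (\<Sum>j\<in>J. if j \<in> int ` {1..n-1} then - 2 * of_int (j * (int n - j)) * c j else 0)"
  proof (rule sum.cong[OF refl])
    fix j
    have "t j + t (int n - j) = of_int ((j - int n) * \<bar>j\<bar> - j * \<bar>int n - j\<bar>) * c j"
      unfolding t_def c_sym by (simp add: algebra_simps)
    also have "(j - int n) * \<bar>j\<bar> - j * \<bar>int n - j\<bar> = (if 0 < j \<and> j < int n then - 2 * (j * (int n - j)) else 0)"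
      by (auto simp: abs_if algebra_simps)
    also have "0 < j \<and> j < int n \<longleftrightarrow> j \<in> int ` {1..n-1}"
    proof
      assume "0 < j \<and> j < int n"
      thus "j \<in> int ` {1..n-1}" by (intro image_eqI[of _ _ "nat j"]) auto
    qed auto
    finally show "t j + t (int n - j) = (if j \<in> int ` {1..n-1} then - 2 * of_int (j * (int n - j)) * c j else 0)"
      by (auto split: if_splits)
  qed
  also have "\<dots> = (\<Sum>j\<in>int ` {1..n-1}. - 2 * of_int (j * (int n - j)) * c j)"
    by (rule sum.mono_neutral_cong_right) (use R in \<open>auto simp: J_def\<close>)
  also have "\<dots> = (\<Sum>k=1..n-1. - 2 * of_int (int k * (int n - int k)) * c (int k))"
    by (subst sum.reindex) auto
  also have "\<dots> = - 2 * quadratic_term n M mon"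
    unfolding sum_distrib_left by (intro sum.cong) (auto simp: c_def of_nat_diff add_ac)
  finally have T: "sum t J = - quadratic_term n M mon"
    by simp
  have "of_nat (lookup mon (int n)) * M (mon - \<epsilon> (int n)) = of_nat n * M (mon + \<epsilon> (- int n))"
    using ibp[OF mon, of "int n"] n by simp
  hence "of_real Q * of_nat n * of_nat (lookup mon (int n)) * M (mon - \<epsilon> (int n)) = of_real Q * of_nat n ^ 2 * M (mon + \<epsilon> (- int n))"
    by (simp add: power2_eq_square mult.assoc)
  thus "of_real Q * of_nat n * of_nat (lookup mon (int n)) * M (mon - \<epsilon> (int n))
     + (\<Sum>j\<in>keys mon. transport_term n M mon j)
     = of_real Q * of_nat n ^ 2 * M (mon + \<epsilon> (- int n))
       - quadratic_term n M mon"
    unfolding S T by simp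
qed


section \<open>From the adjoint relations to the Ward identities\<close>

definition mono_val :: "(int \<Rightarrow>\<^sub>0 nat) \<Rightarrow> (nat \<Rightarrow> complex) \<Rightarrow> complex" where
  "mono_val mon \<phi> = (\<Prod>k\<in>keys mon. mode_val \<phi> k ^ lookup mon k)"

lemma mono_val_superset:
  assumes "finite A" "keys mon \<subseteq> A"
  shows "mono_val mon \<phi> = (\<Prod>k\<in>A. mode_val \<phi> k ^ lookup mon k)"
  unfolding mono_val_def
  by (rule prod.mono_neutral_left) (use assms in \<open>auto simp: in_keys_iff\<close>)

lemma mono_val_add: "mono_val (a + b) \<phi> = mono_val a \<phi> * mono_val b \<phi>"
proof -
  let ?A = "keys a \<union> keys b"
  have "keys (a + b) \<subseteq> ?A" by (rule Poly_Mapping.keys_add)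
  thus ?thesis
    by (simp add: mono_val_superset[of ?A a] mono_val_superset[of ?A b]
          mono_val_superset[of ?A "a+b"] lookup_add power_add prod.distrib)
qed

lemma mono_val_0 [simp]: "mono_val 0 \<phi> = 1"
  by (simp add: mono_val_def)

lemma mono_val_single [simp]: "mono_val (\<epsilon> k) \<phi> = mode_val \<phi> k"
  by (simp add: mono_val_def)

lemma poly_eval_superset:
  assumes "finite A" "keys F \<subseteq> A"
  shows "poly_eval F \<phi> = (\<Sum>mon\<in>A. lookup F mon * mono_val mon \<phi>)"
  unfolding poly_eval_def mono_val_def[symmetric]
  by (rule sum.mono_neutral_left) (use assms in \<open>auto simp: in_keys_iff\<close>)

lemma poly_eval_single [simp]: "poly_eval (Poly_Mapping.single mon c) \<phi> = c * mono_val mon \<phi>"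
  by (simp add: poly_eval_def mono_val_def)

lemma poly_eval_0 [simp]: "poly_eval 0 \<phi> = 0"
  by (simp add: poly_eval_def)

lemma poly_eval_add [simp]: "poly_eval (F + G) \<phi> = poly_eval F \<phi> + poly_eval G \<phi>"
proof -
  let ?A = "keys F \<union> keys G"
  have "keys (F + G) \<subseteq> ?A" by (rule Poly_Mapping.keys_add)
  thus ?thesis
    by (simp add: poly_eval_superset[of ?A F] poly_eval_superset[of ?A G]
          poly_eval_superset[of ?A "F+G"] lookup_add ring_distribs sum.distrib)
qed

lemma poly_eval_uminus [simp]: "poly_eval (- F) \<phi> = - poly_eval F \<phi>"
  using poly_eval_add[of F "- F" \<phi>] by (simp add: eq_neg_iff_add_eq_0 add.commute)

lemma poly_eval_diff [simp]: "poly_eval (F - G) \<phi> = poly_eval F \<phi> - poly_eval G \<phi>"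
  using poly_eval_add[of F "- G" \<phi>] by simp

lemma poly_eval_sum [simp]: "poly_eval (sum f A) \<phi> = (\<Sum>x\<in>A. poly_eval (f x) \<phi>)"
  by (induction A rule: infinite_finite_induct) auto

lemma mode_poly_expand: "F = (\<Sum>mon\<in>keys F. Poly_Mapping.single mon (lookup F mon))"
  for F :: mode_poly
  by (intro poly_mapping_eqI) (auto simp: lookup_sum lookup_single when_def in_keys_iff)

lemma poly_eval_mult [simp]: "poly_eval (F * G) \<phi> = poly_eval F \<phi> * poly_eval G \<phi>"
proof -
  have 1: "poly_eval (Poly_Mapping.single m c * G) \<phi> = c * mono_val m \<phi> * poly_eval G \<phi>" for m c
  proof -
    have "Poly_Mapping.single m c * G = (\<Sum>mon\<in>keys G. Poly_Mapping.single (m + mon) (c * lookup G mon))"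
      by (subst mode_poly_expand[of G]) (simp add: sum_distrib_left mult_single)
    thus ?thesis
      by (simp add: mono_val_add poly_eval_superset[OF _ order_refl] sum_distrib_left mult_ac)
  qed
  have "F * G = (\<Sum>mon\<in>keys F. Poly_Mapping.single mon (lookup F mon) * G)"
    by (subst mode_poly_expand[of F]) (simp add: sum_distrib_right)
  thus ?thesis
    by (simp add: 1 poly_eval_superset[of "keys F" F] sum_distrib_right)
qed

lemma poly_eval_const_poly [simp]: "poly_eval (const_poly c) \<phi> = c"
  by (simp add: const_poly_def)

lemma poly_eval_mode_var [simp]: "poly_eval (mode_var k) \<phi> = mode_val \<phi> k"
  by (simp add: mode_var_def)

lemma poly_eval_1 [simp]: "poly_eval 1 \<phi> = 1"
  using poly_eval_single[of 0 1 \<phi>] by simp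

lemma poly_eval_power [simp]: "poly_eval (F ^ r) \<phi> = poly_eval F \<phi> ^ r"
  by (induction r) auto

lemma poly_eval_of_nat [simp]: "poly_eval (of_nat n) \<phi> = of_nat n"
  by (induction n) auto

lemma poly_eval_of_int [simp]: "poly_eval (of_int k) \<phi> = of_int k"
  by (cases k rule: int_cases2) auto

lemma cnj_mode_val: "k \<noteq> 0 \<Longrightarrow> cnj (mode_val \<phi> k) = mode_val \<phi> (- k)"
  by (auto simp: mode_val_def)

lemma cnj_mono_val: "0 \<notin> keys mon \<Longrightarrow> cnj (mono_val mon \<phi>) = mono_val (Poly_Mapping.map_key uminus mon) \<phi>"
proof -
  assume "0 \<notin> keys mon"
  hence "cnj (mode_val \<phi> k) = mode_val \<phi> (- k)" if "k \<in> keys mon" for k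
    using that by (intro cnj_mode_val) auto
  thus ?thesis unfolding mono_val_def keys_flip
    by (subst prod.reindex) (auto simp: map_key.rep_eq inj_uminus_int inj_on_def intro!: prod.cong)
qed

lemma mode_polys_single: "0 \<notin> keys mon \<Longrightarrow> Poly_Mapping.single mon c \<in> mode_polys"
  by (simp add: mode_polys_def)

lemma mode_pderiv_single:
  "mode_pderiv k (Poly_Mapping.single mon 1) = Poly_Mapping.single (mon - \<epsilon> k) (of_nat (lookup mon k))"
  by (simp add: mode_pderiv_def)

text \<open>
  The sum over \<open>m \<ge> 1\<close> in the operator combines the indices \<open>m\<close> and \<open>- m\<close>; over the nonzero integers \<open>j\<close> it
  takes the uniform form \<open>\<Sum> (j - n) v\<^sub>j\<^sub>-\<^sub>n \<partial>\<^sub>j\<close>.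
\<close>

lemma poly_eval_D_plus_monomial:
  assumes "0 \<notin> keys mon"
  shows "poly_eval (D_plus Q n \<beta> (Poly_Mapping.single mon 1)) \<phi> =
    of_real Q * of_nat n * of_nat (lookup mon (int n)) * mono_val (mon - \<epsilon> (int n)) \<phi>
    - \<beta> / 2 * of_nat n * mono_val (mon + \<epsilon> (- int n)) \<phi>
    + (\<Sum>j\<in>keys mon. of_int (j - int n) * of_nat (lookup mon j) * mono_val (mon - \<epsilon> j + \<epsilon> (j - int n)) \<phi>)"
proof -
  let ?F = "Poly_Mapping.single mon 1 :: mode_poly"
  define h where "h j = of_int (j - int n) * mode_var (j - int n) * mode_pderiv j ?F" for j
  have h0: "h j = 0" if "j \<notin> keys mon" for j
    using that by (simp add: h_def mode_pderiv_single in_keys_iff)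
  define R where "R = (\<Sum>k\<in>keys mon. nat \<bar>k\<bar>)"
  have R: "nat \<bar>k\<bar> \<le> R" if "k \<in> keys mon" for k
    unfolding R_def by (rule member_le_sum) (use that in auto)
  have "Sum_any (\<lambda>m::nat.
       (of_int (int m - int n) * mode_var (int m - int n) * mode_pderiv (int m) ?F
      - of_int (int m + int n) * mode_var (- (int m + int n)) * mode_pderiv (- int m) ?F)
       when m \<ge> 1) = Sum_any (\<lambda>m::nat. (h (int m) + h (- int m)) when m \<ge> 1)"
    by (rule Sum_any.cong) (simp add: h_def algebra_simps)
  also have "\<dots> = (\<Sum>m\<in>{1..R}. (h (int m) + h (- int m)) when m \<ge> 1)"
  proof (rule Sum_any.expand_superset)
    show "{m. (h (int m) + h (- int m) when m \<ge> 1) \<noteq> 0} \<subseteq> {1..R}"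
    proof safe
      fix m :: nat assume m: "(h (int m) + h (- int m) when m \<ge> 1) \<noteq> 0"
      hence "m \<ge> 1" by (auto simp: when_def split: if_splits)
      moreover from m have "int m \<in> keys mon \<or> - int m \<in> keys mon"
        using h0[of "int m"] h0[of "- int m"] by (cases "int m \<in> keys mon") (auto simp: when_def split: if_splits)
      hence "m \<le> R" using R by fastforce
      ultimately show "m \<in> {1..R}" by simp
    qed
  qed simp
  also have "\<dots> = (\<Sum>m\<in>{1..R}. h (int m)) + (\<Sum>m\<in>{1..R}. h (- int m))"
    by (simp add: sum.distrib)
  also have "(\<Sum>m\<in>{1..R}. h (int m)) = sum h (int ` {1..R})"
    by (subst sum.reindex) auto
  also have "(\<Sum>m\<in>{1..R}. h (- int m)) = sum h ((\<lambda>m. - int m) ` {1..R})"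
    by (subst sum.reindex) (auto simp: inj_on_def)
  also have "sum h (int ` {1..R}) + sum h ((\<lambda>m. - int m) ` {1..R}) = sum h (int ` {1..R} \<union> (\<lambda>m. - int m) ` {1..R})"
    by (rule sum.union_disjoint[symmetric]) auto
  also have "\<dots> = sum h (keys mon)"
  proof (rule sum.mono_neutral_right)
    show "keys mon \<subseteq> int ` {1..R} \<union> (\<lambda>m. - int m) ` {1..R}"
    proof
      fix k assume k: "k \<in> keys mon"
      hence "k \<noteq> 0" "nat \<bar>k\<bar> \<le> R" using assms R by auto
      thus "k \<in> int ` {1..R} \<union> (\<lambda>m. - int m) ` {1..R}"
        by (cases "k > 0") (auto intro: image_eqI[of _ _ "nat \<bar>k\<bar>"])
    qed
  qed (use h0 in auto)
  finally have D: "D_plus Q n \<beta> ?F = const_poly (of_nat n * of_real Q) * mode_pderiv (int n) ?F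
   - const_poly (\<beta> / 2 * of_nat n) * mode_var (- int n) * ?F + sum h (keys mon)"
    by (simp only: D_plus_def)
  have "poly_eval (h j) \<phi> = of_int (j - int n) * of_nat (lookup mon j) * mono_val (mon - \<epsilon> j + \<epsilon> (j - int n)) \<phi>" for j
    unfolding h_def by (simp add: mode_pderiv_single mono_val_add del: of_int_diff)
  thus ?thesis unfolding D
    by (simp add: mode_pderiv_single mono_val_add)
qed

lemma mode_pderiv_1: "mode_pderiv k 1 = 0"
  using mode_pderiv_single[of k 0] by simp

lemma poly_eval_D_minus_one:
  assumes "n \<ge> 1"
  shows "cnj (poly_eval (D_minus Q n \<beta> 1 - stress_coeff Q (- int n) * 1) \<phi>) =
    (cnj \<beta> / 2 * of_nat n + of_real Q * of_nat n * (of_nat n - 1)) * mono_val (\<epsilon> (- int n)) \<phi>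
    - (\<Sum>k=1..n-1. of_nat (k * (n - k)) * mono_val (\<epsilon> (- int k) + \<epsilon> (- int (n - k))) \<phi>)"
proof -
  have "D_minus Q n \<beta> 1 = const_poly (\<beta> / 2 * of_nat n) * mode_var (int n)"
    by (simp add: D_minus_def mode_pderiv_1)
  hence d: "D_minus Q n \<beta> 1 - stress_coeff Q (- int n) * 1 = const_poly (\<beta> / 2 * of_nat n) * mode_var (int n) +
      - stress_coeff Q (- int n)" by simp
  have e: "D_minus Q n \<beta> 1 - stress_coeff Q (- int n) * 1 = const_poly (\<beta> / 2 * of_nat n) * mode_var (int n) +
     (const_poly (of_real Q * of_nat n * (of_nat n - 1)) * mode_var (int n)
         - (\<Sum>k=1..n-1. of_nat (k * (n - k)) * mode_var (int k) * mode_var (int (n - k))))"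
    unfolding d stress_coeff_explicit[OF assms] ..
  show ?thesis unfolding e using assms
    by (simp add: cnj_mode_val mono_val_add algebra_simps del: of_nat_mult of_nat_diff) (intro sum.cong refl, auto simp: cnj_mode_val mult_ac)
qed

text \<open>
  The adjoint relation for a monomial and \<open>G = 1\<close>. The operator on the left contributes
  \<open>- cnj \<alpha> / 2 * n * v\<^sub>-\<^sub>n\<close>, and so does the one on the right, whose parameter is \<open>2 * Q - \<alpha>\<close>. The rest of the latter,
  \<open>n * Q\<close>, completes the coefficient \<open>Q * n * (n - 1)\<close> of the stress tensor to \<open>Q * n\<^sup>2\<close>.
\<close>

lemma ward_identities_of_adjoint:
  assumes "prob_space \<nu>" "adjoint_relations Q \<alpha> \<nu>"
  shows "ward_identities Q (\<lambda>mon. \<integral>\<phi>. mono_val mon \<phi> \<partial>\<nu>)"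
    and "\<And>mon. 0 \<notin> keys mon \<Longrightarrow> integrable \<nu> (mono_val mon)"
proof -
  interpret prob_space \<nu> by fact
  show int: "integrable \<nu> (mono_val mon)" if "0 \<notin> keys mon" for mon
  proof -
    have "poly_eval (Poly_Mapping.single mon 1) = mono_val mon" by (intro ext) simp
    hence "mono_val mon \<in> borel_measurable \<nu>" "integrable \<nu> (\<lambda>\<phi>. (cmod (mono_val mon \<phi>))\<^sup>2)"
      using assms(2) mode_polys_single[OF that, of 1] unfolding adjoint_relations_def by metis+
    thus ?thesis
      using square_integrable_imp_integrable[of "\<lambda>\<phi>. cmod (mono_val mon \<phi>)"]
      by (simp add: integrable_norm_iff)
  qed
  show "ward_identities Q (\<lambda>mon. \<integral>\<phi>. mono_val mon \<phi> \<partial>\<nu>)"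
    unfolding ward_identities_def
  proof (intro allI impI)
    fix n :: nat and mon :: "int \<Rightarrow>\<^sub>0 nat" assume n: "1 \<le> n" and mon: "0 \<notin> keys mon"
    let ?F = "Poly_Mapping.single mon 1 :: mode_poly"
    have one: "1 \<in> mode_polys" using mode_polys_single[of 0 1] by simp
    have eq: "(\<integral>\<phi>. poly_eval (D_plus Q n (cnj \<alpha>) ?F) \<phi> * cnj (poly_eval 1 \<phi>) \<partial>\<nu>) =
        (\<integral>\<phi>. poly_eval ?F \<phi> * cnj (poly_eval (D_minus Q n (2 * of_real Q - \<alpha>) 1
                               - stress_coeff Q (- int n) * 1) \<phi>) \<partial>\<nu>)"
      using assms(2) n one mode_polys_single[OF mon] unfolding adjoint_relations_def by blast
    have plus: "integrable \<nu> (mono_val (mon + \<epsilon> (- int k)))" if "k \<ge> 1" for k :: nat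
      by (rule int) (use mon that in \<open>simp add: keys_add_single\<close>)
    have plus2: "integrable \<nu> (mono_val (mon + \<epsilon> (- int k) + \<epsilon> (- int (n - k))))" if "k \<in> {1..n-1}" for k
      by (rule int) (use mon that n in \<open>auto simp: keys_add_single\<close>)
    have minus: "0 \<notin> keys (mon - \<epsilon> j)" for j
      using mon by (simp add: in_keys_iff lookup_minus)
    have hop: "integrable \<nu> (\<lambda>\<phi>. of_int (j - int n) * of_nat (lookup mon j) * mono_val (mon - \<epsilon> j + \<epsilon> (j - int n)) \<phi>)" for j
    proof (cases "j = int n")
      case False
      have "integrable \<nu> (mono_val (mon - \<epsilon> j + \<epsilon> (j - int n)))"
        by (rule int) (use minus False in \<open>auto simp: keys_add_single\<close>)
      thus ?thesis by (intro integrable_mult_right)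
    qed simp
    have L: "(\<integral>\<phi>. poly_eval (D_plus Q n (cnj \<alpha>) ?F) \<phi> * cnj (poly_eval 1 \<phi>) \<partial>\<nu>) =
        of_real Q * of_nat n * of_nat (lookup mon (int n)) * (\<integral>\<phi>. mono_val (mon - \<epsilon> (int n)) \<phi> \<partial>\<nu>)
        - cnj \<alpha> / 2 * of_nat n * (\<integral>\<phi>. mono_val (mon + \<epsilon> (- int n)) \<phi> \<partial>\<nu>)
        + (\<Sum>j\<in>keys mon. of_int (j - int n) * of_nat (lookup mon j) * (\<integral>\<phi>. mono_val (mon - \<epsilon> j + \<epsilon> (j - int n)) \<phi> \<partial>\<nu>))"
      using hop plus[OF n] int[OF minus]
      by (simp add: poly_eval_D_plus_monomial[OF mon] Bochner_Integration.integral_add Bochner_Integration.integral_diff Bochner_Integration.integral_sum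
         integral_mult_right_zero del: of_int_diff)
    define b where "b = cnj (2 * of_real Q - \<alpha>) / 2 * of_nat n + of_real Q * of_nat n * (of_nat n - 1)"
    have b: "b = of_real Q * of_nat n ^ 2 - cnj \<alpha> / 2 * of_nat n"
      by (simp add: b_def power2_eq_square algebra_simps diff_divide_distrib)
    have "(\<integral>\<phi>. poly_eval ?F \<phi> * cnj (poly_eval (D_minus Q n (2 * of_real Q - \<alpha>) 1
                               - stress_coeff Q (- int n) * 1) \<phi>) \<partial>\<nu>) =
       (\<integral>\<phi>. b * mono_val (mon + \<epsilon> (- int n)) \<phi>
         - (\<Sum>k=1..n-1. of_nat (k * (n - k)) * mono_val (mon + \<epsilon> (- int k) + \<epsilon> (- int (n - k))) \<phi>) \<partial>\<nu>)"
      unfolding poly_eval_D_minus_one[OF n] b_def[symmetric]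
      by (intro Bochner_Integration.integral_cong refl)
         (simp add: mono_val_add right_diff_distrib sum_distrib_left mult_ac del: of_nat_mult of_nat_diff)
    also have "\<dots> = b * (\<integral>\<phi>. mono_val (mon + \<epsilon> (- int n)) \<phi> \<partial>\<nu>)
         - (\<Sum>k=1..n-1. of_nat (k * (n - k)) * (\<integral>\<phi>. mono_val (mon + \<epsilon> (- int k) + \<epsilon> (- int (n - k))) \<phi> \<partial>\<nu>))"
      using plus[OF n] plus2
      by (subst Bochner_Integration.integral_diff) (auto intro!: Bochner_Integration.integrable_sum integrable_mult_right
          simp: Bochner_Integration.integral_sum simp del: of_nat_mult of_nat_diff)
    finally show "of_real Q * of_nat n * of_nat (lookup mon (int n)) * (\<integral>\<phi>. mono_val (mon - \<epsilon> (int n)) \<phi> \<partial>\<nu>)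
     + (\<Sum>j\<in>keys mon. of_int (j - int n) * of_nat (lookup mon j) * (\<integral>\<phi>. mono_val (mon - \<epsilon> j + \<epsilon> (j - int n)) \<phi> \<partial>\<nu>))
     = of_real Q * of_nat n ^ 2 * (\<integral>\<phi>. mono_val (mon + \<epsilon> (- int n)) \<phi> \<partial>\<nu>)
       - (\<Sum>k=1..n-1. of_nat (k * (n - k)) * (\<integral>\<phi>. mono_val (mon + \<epsilon> (- int k) + \<epsilon> (- int (n - k))) \<phi> \<partial>\<nu>))"
      using eq unfolding L b left_diff_distrib by (simp only: ) (simp add: add_diff_eq diff_eq_eq eq_diff_eq add_ac)
  qed
qed


section \<open>Integration by parts for complex Gaussian variables\<close>

abbreviation centred_normal :: "real \<Rightarrow> real measure" where
  "centred_normal \<sigma> \<equiv> density lborel (\<lambda>x. ennreal (normal_density 0 \<sigma> x))"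

lemma integrable_centred_normal_iff:
  fixes f :: "real \<Rightarrow> 'a :: {banach, second_countable_topology}"
  assumes "f \<in> borel_measurable borel"
  shows "integrable (centred_normal \<sigma>) f \<longleftrightarrow> integrable lborel (\<lambda>x. normal_density 0 \<sigma> x *\<^sub>R f x)"
  by (rule integrable_density) (use assms in \<open>auto simp: normal_density_nonneg\<close>)

lemma integral_centred_normal:
  fixes f :: "real \<Rightarrow> 'a :: {banach, second_countable_topology}"
  assumes "f \<in> borel_measurable borel"
  shows "(\<integral>x. f x \<partial>centred_normal \<sigma>) = (\<integral>x. normal_density 0 \<sigma> x *\<^sub>R f x \<partial>lborel)"
  by (rule integral_density) (use assms in \<open>auto simp: normal_density_nonneg\<close>)

lemma centred_normal_power_integrable:
  assumes "\<sigma> > 0" shows "integrable (centred_normal \<sigma>) (\<lambda>x. x ^ k)"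
  using integrable_normal_moment[OF assms, of 0 k] by (subst integrable_centred_normal_iff) auto

lemma centred_normal_moment_rec:
  assumes "\<sigma> > 0"
  shows "(\<integral>x. x ^ Suc k \<partial>centred_normal \<sigma>) = \<sigma>\<^sup>2 * (real k * (\<integral>x. x ^ (k - 1) \<partial>centred_normal \<sigma>))"
proof -
  have m: "(\<integral>x. x ^ k \<partial>centred_normal \<sigma>) = (\<integral>x. normal_density 0 \<sigma> x * (x - 0) ^ k \<partial>lborel)" for k
    by (subst integral_centred_normal) auto
  note even = integral_normal_moment_even[OF assms, of 0]
  note odd = integral_normal_moment_odd[OF assms, of 0]
  show ?thesis
  proof (cases "even k")
    case True
    then obtain j where j: "k = 2 * j" by (elim evenE)
    have "k = 0 \<or> (\<exists>i. k - 1 = 2 * i + 1)"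
      by (cases j) (auto simp: j)
    moreover have "(\<integral>x. x ^ Suc k \<partial>centred_normal \<sigma>) = 0"
      unfolding m using odd[of j] by (simp add: j)
    ultimately show ?thesis unfolding m using odd by auto
  next
    case False
    then obtain j where j: "k = 2 * j + 1" by (elim oddE)
    have a: "(\<integral>x. x ^ Suc k \<partial>centred_normal \<sigma>) = fact (2 * Suc j) / ((2 / \<sigma>\<^sup>2) ^ Suc j * fact (Suc j))"
      unfolding m even[of "Suc j", symmetric] by (simp add: j)
    have b: "(\<integral>x. x ^ (k - 1) \<partial>centred_normal \<sigma>) = fact (2 * j) / ((2 / \<sigma>\<^sup>2) ^ j * fact j)"
      unfolding m even[symmetric] by (simp add: j)
    have c: "(fact (2 * Suc j) :: real) = (2 * real j + 2) * (2 * real j + 1) * fact (2 * j)"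
      by (simp add: algebra_simps)
    have d: "(fact (Suc j) :: real) = 2 * (real j + 1) / 2 * fact j" by simp
    have "(2 * real j + 2) * (2 * real j + 1) * F / (2 / s * P * (2 * (real j + 1) / 2 * f)) = s * ((2 * real j + 1) * (F / (P * f)))"
      if "s > 0" "P > 0" "f > 0" for F P f s :: real
    proof -
      have "2 * real j + 2 = 2 * (real j + 1)" "real j + 1 > 0" by auto
      thus ?thesis using that by (simp only:) (simp add: divide_simps)
    qed
    from this[of "\<sigma>\<^sup>2" "(2 / \<sigma>\<^sup>2) ^ j" "fact j" "fact (2 * j)"]
    show ?thesis unfolding a b unfolding c d power_Suc using assms by (simp add: j)
  qed
qed

text \<open>
  By linearity this reduces to the recursion for the moments. Working with \<open>poly\<close> gives access to
  \<open>pderiv\<close>, and thereby to integration by parts for products of powers of \<open>x + \<i> y\<close> and \<open>x - \<i> y\<close> in either variable.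
\<close>

lemma centred_normal_poly:
  fixes p :: "complex poly"
  assumes "\<sigma> > 0"
  shows "integrable (centred_normal \<sigma>) (\<lambda>x. poly p (complex_of_real x))"
    and "(\<integral>x. complex_of_real x * poly p (complex_of_real x) \<partial>centred_normal \<sigma>) =
          of_real (\<sigma>\<^sup>2) * (\<integral>x. poly (pderiv p) (complex_of_real x) \<partial>centred_normal \<sigma>)"
proof -
  have pw: "integrable (centred_normal \<sigma>) (\<lambda>x. complex_of_real x ^ k)" for k
    using integrable_of_real[OF centred_normal_power_integrable[OF assms, of k], where 'a = complex] by simp
  have pi: "(\<integral>x. complex_of_real x ^ k \<partial>centred_normal \<sigma>) = of_real (\<integral>x. x ^ k \<partial>centred_normal \<sigma>)" for k
    by (simp flip: of_real_power)
  have int: "integrable (centred_normal \<sigma>) (\<lambda>x. poly p (complex_of_real x))" for p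
    unfolding poly_altdef by (intro Bochner_Integration.integrable_sum integrable_mult_right pw)
  show "integrable (centred_normal \<sigma>) (\<lambda>x. poly p (complex_of_real x))" by (rule int)
  have intx: "integrable (centred_normal \<sigma>) (\<lambda>x. complex_of_real x * poly p (complex_of_real x))" for p
    using int[of "[:0,1:] * p"] by simp
  define P where "P p \<longleftrightarrow> (\<integral>x. complex_of_real x * poly p (complex_of_real x) \<partial>centred_normal \<sigma>) =
          of_real (\<sigma>\<^sup>2) * (\<integral>x. poly (pderiv p) (complex_of_real x) \<partial>centred_normal \<sigma>)" for p
  have add: "P (p + q)" if "P p" "P q" for p q
    using that unfolding P_def by (simp add: pderiv_add distrib_left int intx)
  have monom: "P (monom c k)" for c k
  proof -
    have "(\<integral>x. complex_of_real x * poly (monom c k) (complex_of_real x) \<partial>centred_normal \<sigma>) =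
        (\<integral>x. c * complex_of_real x ^ Suc k \<partial>centred_normal \<sigma>)"
      by (simp add: poly_monom mult_ac)
    also have "\<dots> = c * of_real (\<sigma>\<^sup>2 * (real k * (\<integral>x. x ^ (k - 1) \<partial>centred_normal \<sigma>)))"
      unfolding integral_mult_right_zero pi centred_normal_moment_rec[OF assms] ..
    also have "\<dots> = of_real (\<sigma>\<^sup>2) * (of_nat k * c * (\<integral>x. complex_of_real x ^ (k - 1) \<partial>centred_normal \<sigma>))"
      unfolding pi by (simp add: mult_ac)
    also have "\<dots> = of_real (\<sigma>\<^sup>2) * (\<integral>x. poly (pderiv (monom c k)) (complex_of_real x) \<partial>centred_normal \<sigma>)"
      by (simp add: pderiv_monom poly_monom)
    finally show ?thesis unfolding P_def .
  qed
  have "P (\<Sum>i\<in>A. monom (coeff p i) i)" if "finite A" for A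
    using that
  proof (induction A rule: finite_induct)
    case empty
    show ?case by (simp add: P_def)
  next
    case (insert x A)
    thus ?case using add monom by simp
  qed
  from this[of "{..degree p}"] have "P p" by (simp add: poly_as_sum_of_monoms)
  thus "(\<integral>x. complex_of_real x * poly p (complex_of_real x) \<partial>centred_normal \<sigma>) =
          of_real (\<sigma>\<^sup>2) * (\<integral>x. poly (pderiv p) (complex_of_real x) \<partial>centred_normal \<sigma>)"
    by (simp add: P_def)
qed

text \<open>
  Half of the Gaussian exponent absorbs \<open>c \<bar>x\<bar>\<close>, up to a constant; the other half is a multiple of the density with
  twice the variance.
\<close>

lemma centred_normal_exp_integrable:
  assumes "\<sigma> > 0" shows "integrable (centred_normal \<sigma>) (\<lambda>x. exp (c * \<bar>x\<bar>))"
proof -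
  have "integrable lborel (\<lambda>x. normal_density 0 \<sigma> x *\<^sub>R exp (c * \<bar>x\<bar>))"
  proof (rule Bochner_Integration.integrable_bound)
    show "integrable lborel (\<lambda>x. exp (c\<^sup>2 * \<sigma>\<^sup>2) * sqrt 2 * normal_density 0 (sqrt 2 * \<sigma>) x)"
      using assms by (intro integrable_mult_right integrable_normal_density) auto
    show "AE x in lborel. norm (normal_density 0 \<sigma> x *\<^sub>R exp (c * \<bar>x\<bar>)) \<le> norm (exp (c\<^sup>2 * \<sigma>\<^sup>2) * sqrt 2 * normal_density 0 (sqrt 2 * \<sigma>) x)"
    proof (rule AE_I2)
      fix x :: real
      \<comment> \<open>Complete the square.\<close>
      have "0 \<le> (\<bar>x\<bar> / (2 * \<sigma>) - c * \<sigma>)\<^sup>2" by simp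
      also have "\<dots> = x\<^sup>2 / (4 * \<sigma>\<^sup>2) - c * \<bar>x\<bar> + c\<^sup>2 * \<sigma>\<^sup>2"
        using assms by (simp add: power2_eq_square field_simps)
      finally have "- x\<^sup>2 / (2 * \<sigma>\<^sup>2) + c * \<bar>x\<bar> \<le> c\<^sup>2 * \<sigma>\<^sup>2 - x\<^sup>2 / (4 * \<sigma>\<^sup>2)"
        by (simp add: field_simps)
      hence "exp (- x\<^sup>2 / (2 * \<sigma>\<^sup>2)) * exp (c * \<bar>x\<bar>) \<le> exp (c\<^sup>2 * \<sigma>\<^sup>2) * exp (- x\<^sup>2 / (4 * \<sigma>\<^sup>2))"
        unfolding exp_add[symmetric] by simp
      hence "1 / sqrt (2 * pi * \<sigma>\<^sup>2) * (exp (- x\<^sup>2 / (2 * \<sigma>\<^sup>2)) * exp (c * \<bar>x\<bar>)) \<le> 1 / sqrt (2 * pi * \<sigma>\<^sup>2) * (exp (c\<^sup>2 * \<sigma>\<^sup>2) * exp (- x\<^sup>2 / (4 * \<sigma>\<^sup>2)))"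
        by (rule mult_left_mono) simp
      also have "\<dots> = exp (c\<^sup>2 * \<sigma>\<^sup>2) * sqrt 2 * normal_density 0 (sqrt 2 * \<sigma>) x"
        using assms by (simp add: normal_density_def real_sqrt_mult power_mult_distrib field_simps)
      finally show "norm (normal_density 0 \<sigma> x *\<^sub>R exp (c * \<bar>x\<bar>)) \<le> norm (exp (c\<^sup>2 * \<sigma>\<^sup>2) * sqrt 2 * normal_density 0 (sqrt 2 * \<sigma>) x)"
        by (simp add: normal_density_def)
    qed
  qed auto
  thus ?thesis by (subst integrable_centred_normal_iff) auto
qed

lemma measurable_power_cnj: "(\<lambda>z :: complex. z ^ a * cnj z ^ b) \<in> borel_measurable borel"
  by (intro borel_measurable_continuous_onI continuous_intros)

abbreviation planar_normal :: "real \<Rightarrow> (real \<times> real) measure" where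
  "planar_normal \<sigma> \<equiv> centred_normal \<sigma> \<Otimes>\<^sub>M centred_normal \<sigma>"

context
  fixes v \<sigma> :: real
  assumes v: "v > 0"
  defines "\<sigma> \<equiv> sqrt (v / 2)"
begin

lemma sigma_pos: "\<sigma> > 0" using v by (simp add: \<sigma>_def)

interpretation N: prob_space "centred_normal \<sigma>"
  by (rule prob_space_normal_density) (rule sigma_pos)

interpretation NN: pair_prob_space "centred_normal \<sigma>" "centred_normal \<sigma>" ..

lemma complex_gaussian_eq: "complex_gaussian v = distr (planar_normal \<sigma>) borel (\<lambda>(x, y). Complex x y)"
  by (simp add: complex_gaussian_def \<sigma>_def)

lemma measurable_Complex: "(\<lambda>(x, y). Complex x y) \<in> borel_measurable (planar_normal \<sigma>)"
proof -
  have "(\<lambda>(x, y). Complex x y) = (\<lambda>p. complex_of_real (fst p) + \<i> * complex_of_real (snd p))"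
    by (auto simp: complex_eq_iff fun_eq_iff)
  thus ?thesis by simp
qed

lemma prob_space_complex_gaussian: "prob_space (complex_gaussian v)"
  unfolding complex_gaussian_eq by (intro NN.prob_space_distr measurable_Complex)

lemma integrable_fst_power: "integrable (planar_normal \<sigma>) (\<lambda>p. \<bar>fst p\<bar> ^ k)"
proof -
  have "integrable (distr (planar_normal \<sigma>) (centred_normal \<sigma>) fst) (\<lambda>x. \<bar>x\<bar> ^ k)"
    unfolding N.distr_pair_fst using centred_normal_power_integrable[OF sigma_pos, of k]
    by (subst (asm) integrable_norm_iff[symmetric]) (auto simp: power_abs)
  thus ?thesis by (rule integrable_distr[rotated]) simp
qed

lemma integrable_snd_power: "integrable (planar_normal \<sigma>) (\<lambda>p. \<bar>snd p\<bar> ^ k)"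
  using NN.integrable_product_swap[OF integrable_fst_power[of k]] by (simp add: case_prod_unfold)

lemma integrable_pair_bound:
  assumes f: "f \<in> borel_measurable (planar_normal \<sigma>)"
    and le: "\<And>x y. norm (f (x, y) :: complex) \<le> (\<bar>x\<bar> + \<bar>y\<bar>) ^ k"
  shows "integrable (planar_normal \<sigma>) f"
proof (rule Bochner_Integration.integrable_bound[OF _ f])
  show "integrable (planar_normal \<sigma>) (\<lambda>p. 2 ^ k * (\<bar>fst p\<bar> ^ k + \<bar>snd p\<bar> ^ k))"
    by (intro integrable_mult_right Bochner_Integration.integrable_add integrable_fst_power integrable_snd_power)
  show "AE p in planar_normal \<sigma>. norm (f p) \<le> norm (2 ^ k * (\<bar>fst p\<bar> ^ k + \<bar>snd p\<bar> ^ k) :: real)"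
  proof (rule AE_I2)
    fix p :: "real \<times> real"
    obtain x y where p: "p = (x, y)" by (cases p)
    have "norm (f p) \<le> (\<bar>x\<bar> + \<bar>y\<bar>) ^ k" unfolding p by (rule le)
    also have "\<dots> \<le> (2 * max \<bar>x\<bar> \<bar>y\<bar>) ^ k" by (intro power_mono) auto
    also have "\<dots> = 2 ^ k * max \<bar>x\<bar> \<bar>y\<bar> ^ k" by (simp add: power_mult_distrib)
    also have "\<dots> \<le> 2 ^ k * (\<bar>x\<bar> ^ k + \<bar>y\<bar> ^ k)" by (intro mult_left_mono) (auto simp: max_def)
    finally show "norm (f p) \<le> norm (2 ^ k * (\<bar>fst p\<bar> ^ k + \<bar>snd p\<bar> ^ k) :: real)" by (simp add: p)
  qed
qed

definition zw :: "nat \<Rightarrow> nat \<Rightarrow> real \<times> real \<Rightarrow> complex" where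
  "zw a b p = (of_real (fst p) + \<i> * of_real (snd p)) ^ a * (of_real (fst p) - \<i> * of_real (snd p)) ^ b"

lemma zw_measurable: "zw a b \<in> borel_measurable (planar_normal \<sigma>)"
  unfolding zw_def by simp

lemma zw_norm: "norm (zw a b (x, y)) \<le> (\<bar>x\<bar> + \<bar>y\<bar>) ^ (a + b)"
proof -
  have "norm (of_real x + \<i> * of_real y) \<le> \<bar>x\<bar> + \<bar>y\<bar>" "norm (of_real x - \<i> * of_real y) \<le> \<bar>x\<bar> + \<bar>y\<bar>"
    using norm_triangle_ineq[of "of_real x" "\<i> * of_real y"] norm_triangle_ineq4[of "of_real x" "\<i> * of_real y"]
    by (auto simp: norm_mult)
  thus ?thesis unfolding zw_def power_add norm_mult norm_power
    by (intro mult_mono power_mono) auto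
qed

lemma zw_integrable: "integrable (planar_normal \<sigma>) (zw a b)"
  by (rule integrable_pair_bound[OF zw_measurable zw_norm])

lemma fst_zw_integrable: "integrable (planar_normal \<sigma>) (\<lambda>p. of_real (fst p) * zw a b p)"
proof (rule integrable_pair_bound)
  fix x y show "norm (of_real (fst (x, y)) * zw a b (x, y)) \<le> (\<bar>x\<bar> + \<bar>y\<bar>) ^ Suc (a + b)"
    unfolding norm_mult power_Suc by (intro mult_mono zw_norm) auto
qed (intro borel_measurable_times zw_measurable, simp)

lemma snd_zw_integrable: "integrable (planar_normal \<sigma>) (\<lambda>p. of_real (snd p) * zw a b p)"
proof (rule integrable_pair_bound)
  fix x y show "norm (of_real (snd (x, y)) * zw a b (x, y)) \<le> (\<bar>x\<bar> + \<bar>y\<bar>) ^ Suc (a + b)"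
    unfolding norm_mult power_Suc by (intro mult_mono zw_norm) auto
qed (intro borel_measurable_times zw_measurable, simp)

lemma complex_gaussian_integral:
  "(\<integral>z. z ^ a * cnj z ^ b \<partial>complex_gaussian v) = integral\<^sup>L (planar_normal \<sigma>) (zw a b)"
  unfolding complex_gaussian_eq
  by (subst integral_distr[OF measurable_Complex])
     (auto simp: zw_def case_prod_unfold Complex_eq intro!: Bochner_Integration.integral_cong measurable_power_cnj)

lemma complex_gaussian_integrable: "integrable (complex_gaussian v) (\<lambda>z. z ^ a * cnj z ^ b)"
  unfolding complex_gaussian_eq using zw_integrable[of a b]
  by (subst integrable_distr_eq[OF measurable_Complex])
     (auto simp: zw_def[abs_def] case_prod_unfold Complex_eq intro: measurable_power_cnj)

lemma zw_fst_ibp: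
  "(\<integral>p. of_real (fst p) * zw a b p \<partial>(planar_normal \<sigma>)) =
   of_real (\<sigma>\<^sup>2) * (of_nat a * integral\<^sup>L (planar_normal \<sigma>) (zw (a - 1) b)
                + of_nat b * integral\<^sup>L (planar_normal \<sigma>) (zw a (b - 1)))"
proof -
  have "(\<integral>p. of_real (fst p) * zw a b p \<partial>(planar_normal \<sigma>)) =
     (\<integral>y. (\<integral>x. of_real x * zw a b (x, y) \<partial>centred_normal \<sigma>) \<partial>centred_normal \<sigma>)"
    using NN.integral_snd[of "\<lambda>x y. of_real x * zw a b (x, y)"] fst_zw_integrable[of a b] by (simp add: case_prod_unfold)
  also have "\<dots> = (\<integral>y. of_real (\<sigma>\<^sup>2) * (\<integral>x. of_nat a * zw (a - 1) b (x, y) + of_nat b * zw a (b - 1) (x, y) \<partial>centred_normal \<sigma>) \<partial>centred_normal \<sigma>)"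
  proof (rule Bochner_Integration.integral_cong[OF refl])
    fix y :: real
    let ?p = "[:\<i> * of_real y, 1:] ^ a * [:- \<i> * of_real y, 1:] ^ b"
    have "(\<integral>x. of_real x * zw a b (x, y) \<partial>centred_normal \<sigma>) = (\<integral>x. of_real x * poly ?p (of_real x) \<partial>centred_normal \<sigma>)"
      by (simp add: zw_def add_ac)
    also have "\<dots> = of_real (\<sigma>\<^sup>2) * (\<integral>x. poly (pderiv ?p) (of_real x) \<partial>centred_normal \<sigma>)"
      by (rule centred_normal_poly(2)) (rule sigma_pos)
    also have "(\<lambda>x. poly (pderiv ?p) (complex_of_real x)) = (\<lambda>x. of_nat a * zw (a - 1) b (x, y) + of_nat b * zw a (b - 1) (x, y))"
      by (rule ext) (simp add: pderiv_mult pderiv_power pderiv_pCons zw_def mult_ac add_ac)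
    finally show "(\<integral>x. of_real x * zw a b (x, y) \<partial>centred_normal \<sigma>) = of_real (\<sigma>\<^sup>2) * (\<integral>x. of_nat a * zw (a - 1) b (x, y) + of_nat b * zw a (b - 1) (x, y) \<partial>centred_normal \<sigma>)" .
  qed
  also have "\<dots> = of_real (\<sigma>\<^sup>2) * (\<integral>y. (\<integral>x. of_nat a * zw (a - 1) b (x, y) + of_nat b * zw a (b - 1) (x, y) \<partial>centred_normal \<sigma>) \<partial>centred_normal \<sigma>)"
    by simp
  also have "(\<integral>y. (\<integral>x. of_nat a * zw (a - 1) b (x, y) + of_nat b * zw a (b - 1) (x, y) \<partial>centred_normal \<sigma>) \<partial>centred_normal \<sigma>) =
     (\<integral>p. of_nat a * zw (a - 1) b p + of_nat b * zw a (b - 1) p \<partial>(planar_normal \<sigma>))"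
    using NN.integral_snd[of "\<lambda>x y. of_nat a * zw (a - 1) b (x, y) + of_nat b * zw a (b - 1) (x, y)"]
      zw_integrable by (simp add: case_prod_unfold)
  also have "\<dots> = of_nat a * integral\<^sup>L (planar_normal \<sigma>) (zw (a - 1) b)
                + of_nat b * integral\<^sup>L (planar_normal \<sigma>) (zw a (b - 1))"
    using zw_integrable by simp
  finally show ?thesis .
qed

lemma zw_snd_ibp:
  "(\<integral>p. of_real (snd p) * zw a b p \<partial>(planar_normal \<sigma>)) =
   of_real (\<sigma>\<^sup>2) * (\<i> * of_nat a * integral\<^sup>L (planar_normal \<sigma>) (zw (a - 1) b)
                - \<i> * of_nat b * integral\<^sup>L (planar_normal \<sigma>) (zw a (b - 1)))"
proof -
  have "(\<integral>p. of_real (snd p) * zw a b p \<partial>(planar_normal \<sigma>)) =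
     (\<integral>x. (\<integral>y. of_real y * zw a b (x, y) \<partial>centred_normal \<sigma>) \<partial>centred_normal \<sigma>)"
    using NN.integral_fst'[OF snd_zw_integrable[of a b]] by simp
  also have "\<dots> = (\<integral>x. of_real (\<sigma>\<^sup>2) * (\<integral>y. \<i> * of_nat a * zw (a - 1) b (x, y) - \<i> * of_nat b * zw a (b - 1) (x, y) \<partial>centred_normal \<sigma>) \<partial>centred_normal \<sigma>)"
  proof (rule Bochner_Integration.integral_cong[OF refl])
    fix x :: real
    let ?p = "[:of_real x, \<i>:] ^ a * [:of_real x, - \<i>:] ^ b"
    have "(\<integral>y. of_real y * zw a b (x, y) \<partial>centred_normal \<sigma>) = (\<integral>y. of_real y * poly ?p (of_real y) \<partial>centred_normal \<sigma>)"
      by (simp add: zw_def mult_ac)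
    also have "\<dots> = of_real (\<sigma>\<^sup>2) * (\<integral>y. poly (pderiv ?p) (of_real y) \<partial>centred_normal \<sigma>)"
      by (rule centred_normal_poly(2)) (rule sigma_pos)
    also have "(\<lambda>y. poly (pderiv ?p) (complex_of_real y)) = (\<lambda>y. \<i> * of_nat a * zw (a - 1) b (x, y) - \<i> * of_nat b * zw a (b - 1) (x, y))"
      by (rule ext) (simp add: pderiv_mult pderiv_power pderiv_pCons zw_def mult_ac)
    finally show "(\<integral>y. of_real y * zw a b (x, y) \<partial>centred_normal \<sigma>) = of_real (\<sigma>\<^sup>2) * (\<integral>y. \<i> * of_nat a * zw (a - 1) b (x, y) - \<i> * of_nat b * zw a (b - 1) (x, y) \<partial>centred_normal \<sigma>)" .
  qed
  also have "\<dots> = of_real (\<sigma>\<^sup>2) * (\<integral>x. (\<integral>y. \<i> * of_nat a * zw (a - 1) b (x, y) - \<i> * of_nat b * zw a (b - 1) (x, y) \<partial>centred_normal \<sigma>) \<partial>centred_normal \<sigma>)"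
    by simp
  also have "(\<integral>x. (\<integral>y. \<i> * of_nat a * zw (a - 1) b (x, y) - \<i> * of_nat b * zw a (b - 1) (x, y) \<partial>centred_normal \<sigma>) \<partial>centred_normal \<sigma>) =
     (\<integral>p. \<i> * of_nat a * zw (a - 1) b p - \<i> * of_nat b * zw a (b - 1) p \<partial>(planar_normal \<sigma>))"
    using zw_integrable
    by (intro NN.integral_fst' Bochner_Integration.integrable_diff integrable_mult_right)
  also have "\<dots> = \<i> * of_nat a * integral\<^sup>L (planar_normal \<sigma>) (zw (a - 1) b)
                - \<i> * of_nat b * integral\<^sup>L (planar_normal \<sigma>) (zw a (b - 1))"
    using zw_integrable by simp
  finally show ?thesis .
qed

text \<open>
  Multiplication by \<open>x \<mp> \<i> y\<close> becomes \<open>\<sigma>\<^sup>2\<close> times \<open>\<partial>\<^sub>x \<mp> \<i> \<partial>\<^sub>y\<close>, that is, \<open>2 \<sigma>\<^sup>2 = v\<close> times a Wirtinger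
  derivative.
\<close>

lemma complex_gaussian_ibp:
  "(\<integral>z. z ^ a * cnj z ^ Suc b \<partial>complex_gaussian v) = of_real v * of_nat a * (\<integral>z. z ^ (a - 1) * cnj z ^ b \<partial>complex_gaussian v)"
  "(\<integral>z. z ^ Suc a * cnj z ^ b \<partial>complex_gaussian v) = of_real v * of_nat b * (\<integral>z. z ^ a * cnj z ^ (b - 1) \<partial>complex_gaussian v)"
proof -
  have v2: "of_real v = 2 * complex_of_real (\<sigma>\<^sup>2)" using v by (simp add: \<sigma>_def)
  have "zw a (Suc b) = (\<lambda>p. of_real (fst p) * zw a b p - \<i> * (of_real (snd p) * zw a b p))"
    by (rule ext) (simp add: zw_def algebra_simps)
  thus "(\<integral>z. z ^ a * cnj z ^ Suc b \<partial>complex_gaussian v) = of_real v * of_nat a * (\<integral>z. z ^ (a - 1) * cnj z ^ b \<partial>complex_gaussian v)"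
    unfolding complex_gaussian_integral v2
    using fst_zw_integrable[of a b] snd_zw_integrable[of a b]
    by (simp add: zw_fst_ibp zw_snd_ibp algebra_simps)
  have "zw (Suc a) b = (\<lambda>p. of_real (fst p) * zw a b p + \<i> * (of_real (snd p) * zw a b p))"
    by (rule ext) (simp add: zw_def algebra_simps)
  thus "(\<integral>z. z ^ Suc a * cnj z ^ b \<partial>complex_gaussian v) = of_real v * of_nat b * (\<integral>z. z ^ a * cnj z ^ (b - 1) \<partial>complex_gaussian v)"
    unfolding complex_gaussian_integral v2
    using fst_zw_integrable[of a b] snd_zw_integrable[of a b]
    by (simp add: zw_fst_ibp zw_snd_ibp algebra_simps)
qed

lemma complex_gaussian_exp_integrable:
  "integrable (complex_gaussian v) (\<lambda>z. exp (c * \<bar>Re z\<bar>))" "integrable (complex_gaussian v) (\<lambda>z. exp (c * \<bar>Im z\<bar>))"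
proof -
  have 1: "integrable (planar_normal \<sigma>) (\<lambda>p. exp (c * \<bar>fst p\<bar>))"
  proof -
    have "integrable (distr (planar_normal \<sigma>) (centred_normal \<sigma>) fst) (\<lambda>x. exp (c * \<bar>x\<bar>))"
      unfolding N.distr_pair_fst by (rule centred_normal_exp_integrable) (rule sigma_pos)
    thus ?thesis by (rule integrable_distr[rotated]) simp
  qed
  have 2: "integrable (planar_normal \<sigma>) (\<lambda>p. exp (c * \<bar>snd p\<bar>))"
    using NN.integrable_product_swap[OF 1] by (simp add: case_prod_unfold)
  show "integrable (complex_gaussian v) (\<lambda>z. exp (c * \<bar>Re z\<bar>))" "integrable (complex_gaussian v) (\<lambda>z. exp (c * \<bar>Im z\<bar>))"
    unfolding complex_gaussian_eq using 1 2
    by (subst integrable_distr_eq[OF measurable_Complex]; simp add: case_prod_unfold)+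
qed

end


section \<open>Moments of the Gaussian modes\<close>

lemma sets_complex_gaussian [simp]: "sets (complex_gaussian v) = sets borel"
  by (simp add: complex_gaussian_def)

lemma space_complex_gaussian [simp]: "space (complex_gaussian v) = UNIV"
  by (simp add: complex_gaussian_def)

lemma prob_space_gaussian_component: "k \<in> {1..} \<Longrightarrow> prob_space (complex_gaussian (1 / real k))"
  by (rule prob_space_complex_gaussian) auto

lemma prob_space_gaussian_modes: "prob_space gaussian_modes"
  unfolding gaussian_modes_def by (rule prob_space_PiM) (rule prob_space_gaussian_component)

lemma sets_gaussian_modes: "sets gaussian_modes = sets (PiM {1..} (\<lambda>_. borel))"
  unfolding gaussian_modes_def by (rule sets_PiM_cong) auto

lemma measurable_gaussian_component:
  "k \<in> {1..} \<Longrightarrow> (\<lambda>\<phi>. \<phi> k) \<in> measurable gaussian_modes (complex_gaussian (1 / real k))"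
  unfolding gaussian_modes_def by (rule measurable_component_singleton)

lemma distr_gaussian_component:
  "k \<in> {1..} \<Longrightarrow> distr gaussian_modes (complex_gaussian (1 / real k)) (\<lambda>\<phi>. \<phi> k) = complex_gaussian (1 / real k)"
  unfolding gaussian_modes_def by (rule distr_PiM_component) (rule prob_space_gaussian_component)

lemma integrable_gaussian_component:
  fixes f :: "complex \<Rightarrow> 'a :: {banach, second_countable_topology}"
  assumes "k \<in> {1..}" "integrable (complex_gaussian (1 / real k)) f"
  shows "integrable gaussian_modes (\<lambda>\<phi>. f (\<phi> k))"
  by (rule integrable_distr[OF measurable_gaussian_component[OF assms(1)]])
     (simp add: distr_gaussian_component[OF assms(1)] assms(2))

lemma integral_gaussian_component:
  fixes f :: "complex \<Rightarrow> 'a :: {banach, second_countable_topology}"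
  assumes "k \<in> {1..}" "f \<in> borel_measurable borel"
  shows "(\<integral>\<phi>. f (\<phi> k) \<partial>gaussian_modes) = integral\<^sup>L (complex_gaussian (1 / real k)) f"
proof -
  have "f \<in> borel_measurable (complex_gaussian (1 / real k))"
    using assms(2) by (simp cong: measurable_cong_sets)
  from integral_distr[OF measurable_gaussian_component[OF assms(1)] this] show ?thesis
    by (simp add: distr_gaussian_component[OF assms(1)])
qed

text \<open>
  Independence is read off from the fact that a product measure is the product of its own marginals.
\<close>

lemma indep_gaussian_modes:
  "prob_space.indep_vars gaussian_modes (\<lambda>k. complex_gaussian (1 / real k)) (\<lambda>k \<phi>. \<phi> k) {1..}"
proof -
  interpret prob_space gaussian_modes by (rule prob_space_gaussian_modes)
  have "distr gaussian_modes (PiM {1..} (\<lambda>k. complex_gaussian (1 / real k))) (\<lambda>\<phi>. \<lambda>k\<in>{1..}. \<phi> k)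
      = distr gaussian_modes gaussian_modes (\<lambda>\<phi>. \<phi>)"
    by (rule distr_cong) (auto simp: gaussian_modes_def space_PiM PiE_def extensional_def)
  also have "\<dots> = PiM {1..} (\<lambda>k. complex_gaussian (1 / real k))" by (simp add: distr_id) (simp add: gaussian_modes_def)
  also have "\<dots> = PiM {1..} (\<lambda>k. distr gaussian_modes (complex_gaussian (1 / real k)) (\<lambda>\<phi>. \<phi> k))"
    by (rule PiM_cong) (auto simp: distr_gaussian_component)
  finally show ?thesis
    by (subst indep_vars_iff_distr_eq_PiM') (auto intro: measurable_gaussian_component)
qed

definition gaussian_moment :: "nat \<Rightarrow> nat \<Rightarrow> nat \<Rightarrow> complex" where
  "gaussian_moment k a b = (\<integral>z. z ^ a * cnj z ^ b \<partial>complex_gaussian (1 / real k))"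

lemma mono_val_positive_modes:
  assumes "0 \<notin> keys mon" "keys mon \<subseteq> {- int R..int R}"
  shows "mono_val mon \<phi> = (\<Prod>k\<in>{1..R}. \<phi> k ^ lookup mon (int k) * cnj (\<phi> k) ^ lookup mon (- int k))"
proof -
  let ?f = "\<lambda>k. mode_val \<phi> k ^ lookup mon k"
  have "keys mon \<subseteq> int ` {1..R} \<union> (\<lambda>m. - int m) ` {1..R}"
  proof
    fix k assume k: "k \<in> keys mon"
    hence "k \<noteq> 0" "nat \<bar>k\<bar> \<le> R" using assms by (auto dest!: subsetD)
    thus "k \<in> int ` {1..R} \<union> (\<lambda>m. - int m) ` {1..R}"
      by (cases "k > 0") (auto intro: image_eqI[of _ _ "nat \<bar>k\<bar>"])
  qed
  hence "mono_val mon \<phi> = prod ?f (int ` {1..R} \<union> (\<lambda>m. - int m) ` {1..R})"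
    by (intro mono_val_superset) auto
  also have "\<dots> = prod ?f (int ` {1..R}) * prod ?f ((\<lambda>m. - int m) ` {1..R})"
    by (rule prod.union_disjoint) auto
  also have "prod ?f (int ` {1..R}) = (\<Prod>k\<in>{1..R}. \<phi> k ^ lookup mon (int k))"
    by (subst prod.reindex) (auto simp: mode_val_def intro!: prod.cong)
  also have "prod ?f ((\<lambda>m. - int m) ` {1..R}) = (\<Prod>k\<in>{1..R}. cnj (\<phi> k) ^ lookup mon (- int k))"
    by (subst prod.reindex) (auto simp: mode_val_def inj_on_def intro!: prod.cong)
  finally show ?thesis by (simp add: prod.distrib)
qed

lemma gaussian_modes_monomial:
  assumes "0 \<notin> keys mon" "keys mon \<subseteq> {- int R..int R}"
  shows "integrable gaussian_modes (mono_val mon)"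
    and "(\<integral>\<phi>. mono_val mon \<phi> \<partial>gaussian_modes) =
         (\<Prod>k\<in>{1..R}. gaussian_moment k (lookup mon (int k)) (lookup mon (- int k)))"
proof -
  interpret prob_space gaussian_modes by (rule prob_space_gaussian_modes)
  let ?g = "\<lambda>k z. z ^ lookup mon (int k) * cnj z ^ lookup mon (- int k)"
  have "indep_vars (\<lambda>k. complex_gaussian (1 / real k)) (\<lambda>k \<phi>. \<phi> k) {1..R}"
    by (rule indep_vars_subset[OF indep_gaussian_modes]) auto
  hence ind: "indep_vars (\<lambda>_. borel) (\<lambda>k \<phi>. ?g k (\<phi> k)) {1..R}"
    by (rule indep_vars_compose2) (simp cong: measurable_cong_sets add: measurable_power_cnj)
  have int: "integrable gaussian_modes (\<lambda>\<phi>. ?g k (\<phi> k))" if "k \<in> {1..R}" for k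
    using that by (intro integrable_gaussian_component[of k] complex_gaussian_integrable) auto
  have mv: "mono_val mon = (\<lambda>\<phi>. \<Prod>k\<in>{1..R}. ?g k (\<phi> k))"
    by (rule ext) (rule mono_val_positive_modes[OF assms])
  show "integrable gaussian_modes (mono_val mon)"
    unfolding mv by (rule indep_vars_integrable[OF _ ind int]) auto
  have "(\<integral>\<phi>. mono_val mon \<phi> \<partial>gaussian_modes) = (\<Prod>k\<in>{1..R}. \<integral>\<phi>. ?g k (\<phi> k) \<partial>gaussian_modes)"
    unfolding mv by (rule indep_vars_lebesgue_integral[OF _ ind int]) auto
  also have "\<dots> = (\<Prod>k\<in>{1..R}. gaussian_moment k (lookup mon (int k)) (lookup mon (- int k)))"
    unfolding gaussian_moment_def
    by (intro prod.cong refl integral_gaussian_component measurable_power_cnj) auto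
  finally show "(\<integral>\<phi>. mono_val mon \<phi> \<partial>gaussian_modes) =
         (\<Prod>k\<in>{1..R}. gaussian_moment k (lookup mon (int k)) (lookup mon (- int k)))" .
qed

lemma keys_bounded: "\<exists>R. keys mon \<subseteq> {- int R..int R}"
proof
  let ?R = "\<Sum>k\<in>keys mon. nat \<bar>k\<bar>"
  have "nat \<bar>k\<bar> \<le> ?R" if "k \<in> keys mon" for k
    by (rule member_le_sum) (use that in auto)
  moreover have "k \<in> {- int R..int R}" if "nat \<bar>k\<bar> \<le> R" for k R
    using that by auto
  ultimately show "keys mon \<subseteq> {- int ?R..int ?R}" by blast
qed

lemma gaussian_modes_monomial_integrable:
  "0 \<notin> keys mon \<Longrightarrow> integrable gaussian_modes (mono_val mon)"
  using gaussian_modes_monomial(1) keys_bounded by blast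

text \<open>
  Both monomials have the same exponents except at the two indices \<open>\<plusminus> j\<close>, so that by independence the claim is the
  recursion \<open>complex_gaussian_ibp\<close> for the single mode \<open>\<bar>j\<bar>\<close>, of variance \<open>1 / \<bar>j\<bar>\<close>.
\<close>

lemma gaussian_modes_ibp:
  assumes mon: "0 \<notin> keys mon" and j: "j \<noteq> 0"
  shows "of_nat (lookup mon j) * (\<integral>\<phi>. mono_val (mon - \<epsilon> j) \<phi> \<partial>gaussian_modes) =
         of_int \<bar>j\<bar> * (\<integral>\<phi>. mono_val (mon + \<epsilon> (- j)) \<phi> \<partial>gaussian_modes)"
proof -
  obtain R0 where R0: "keys mon \<subseteq> {- int R0..int R0}" using keys_bounded by blast
  define R where "R = R0 + nat \<bar>j\<bar>"
  define k0 where "k0 = nat \<bar>j\<bar>"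
  have k0: "k0 \<in> {1..R}" using j by (auto simp: k0_def R_def)
  have R: "keys mon \<subseteq> {- int R..int R}" using R0 by (force simp: R_def)
  have "keys (mon - \<epsilon> j) \<subseteq> keys mon"
    by (auto simp: in_keys_iff lookup_minus)
  hence m: "0 \<notin> keys (mon - \<epsilon> j)" "keys (mon - \<epsilon> j) \<subseteq> {- int R..int R}"
    using mon R by auto
  have p: "0 \<notin> keys (mon + \<epsilon> (- j))" "keys (mon + \<epsilon> (- j)) \<subseteq> {- int R..int R}"
    using mon R j by (auto simp: keys_add_single R_def)
  let ?f = "\<lambda>mon k. gaussian_moment k (lookup mon (int k)) (lookup mon (- int k))"
  have others: "?f (mon - \<epsilon> j) k = ?f (mon + \<epsilon> (- j)) k" if "k \<in> {1..R} - {k0}" for k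
  proof -
    have "int k \<noteq> j" "- int k \<noteq> j" "int k \<noteq> - j" "- int k \<noteq> - j" using that by (auto simp: k0_def)
    thus ?thesis by (simp add: lookup_add lookup_minus lookup_single when_def)
  qed
  have main: "of_nat (lookup mon j) * ?f (mon - \<epsilon> j) k0 = of_int \<bar>j\<bar> * ?f (mon + \<epsilon> (- j)) k0"
  proof (cases "j > 0")
    case True
    hence jk: "j = int k0" by (simp add: k0_def)
    show ?thesis unfolding jk gaussian_moment_def using k0 complex_gaussian_ibp(1)[of "1 / real k0"]
      by (simp add: lookup_add lookup_minus lookup_single when_def)
  next
    case False
    hence jk: "j = - int k0" by (simp add: k0_def)
    show ?thesis unfolding jk gaussian_moment_def using k0 complex_gaussian_ibp(2)[of "1 / real k0"]
      by (simp add: lookup_add lookup_minus lookup_single when_def)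
  qed
  have "of_nat (lookup mon j) * (\<integral>\<phi>. mono_val (mon - \<epsilon> j) \<phi> \<partial>gaussian_modes) =
     of_nat (lookup mon j) * ?f (mon - \<epsilon> j) k0 * (\<Prod>k\<in>{1..R}-{k0}. ?f (mon - \<epsilon> j) k)"
    unfolding gaussian_modes_monomial(2)[OF m] by (subst prod.remove[OF _ k0]) (auto simp: mult.assoc)
  also have "\<dots> = of_int \<bar>j\<bar> * ?f (mon + \<epsilon> (- j)) k0 * (\<Prod>k\<in>{1..R}-{k0}. ?f (mon + \<epsilon> (- j)) k)"
    unfolding main by (intro arg_cong2[where f = "(*)"] refl prod.cong others)
  also have "\<dots> = of_int \<bar>j\<bar> * (\<integral>\<phi>. mono_val (mon + \<epsilon> (- j)) \<phi> \<partial>gaussian_modes)"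
    unfolding gaussian_modes_monomial(2)[OF p] by (subst prod.remove[OF _ k0]) (auto simp: mult.assoc)
  finally show ?thesis .
qed

lemma integral_flip:
  assumes "0 \<notin> keys mon"
  shows "(\<integral>\<phi>. mono_val (Poly_Mapping.map_key uminus mon) \<phi> \<partial>\<nu>) = cnj (\<integral>\<phi>. mono_val mon \<phi> \<partial>\<nu>)"
  by (simp flip: cnj_mono_val[OF assms] integral_cnj)

theorem moments_of_adjoint_relations:
  assumes "prob_space \<nu>" "adjoint_relations Q \<alpha> \<nu>" "Q > 0" "F \<in> mode_polys"
  shows "integrable \<nu> (poly_eval F)" "integrable gaussian_modes (poly_eval F)"
    "(\<integral>\<phi>. poly_eval F \<phi> \<partial>\<nu>) = (\<integral>\<phi>. poly_eval F \<phi> \<partial>gaussian_modes)"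
proof -
  interpret G: prob_space gaussian_modes by (rule prob_space_gaussian_modes)
  interpret N: prob_space \<nu> by fact
  let ?M = "\<lambda>\<nu> mon. \<integral>\<phi>. mono_val mon \<phi> \<partial>\<nu>"
  have "ward_identities Q (?M gaussian_modes)"
    by (rule ward_identities_of_ibp) (rule gaussian_modes_ibp)
  hence w: "ward_identities Q (\<lambda>mon. ?M \<nu> mon - ?M gaussian_modes mon)"
    by (rule ward_identities_diff[OF ward_identities_of_adjoint(1)[OF assms(1,2)]])
  have eq: "?M \<nu> mon = ?M gaussian_modes mon" if "0 \<notin> keys mon" for mon
  proof -
    have "?M \<nu> mon - ?M gaussian_modes mon = 0"
    proof (rule ward_identities_unique[OF assms(3) w _ _ that])
      show "?M \<nu> 0 - ?M gaussian_modes 0 = 0" by (simp add: G.prob_space N.prob_space)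
    qed (simp add: integral_flip)
    thus ?thesis by simp
  qed
  have keys: "0 \<notin> keys mon" if "mon \<in> keys F" for mon
    using assms(4) that by (auto simp: mode_polys_def)
  have F: "poly_eval F = (\<lambda>\<phi>. \<Sum>mon\<in>keys F. lookup F mon * mono_val mon \<phi>)"
    by (rule ext) (rule poly_eval_superset, auto)
  have i1: "integrable \<nu> (mono_val mon)" and i2: "integrable gaussian_modes (mono_val mon)" if "mon \<in> keys F" for mon
    using ward_identities_of_adjoint(2)[OF assms(1,2)] gaussian_modes_monomial_integrable keys[OF that] by blast+
  show "integrable \<nu> (poly_eval F)" "integrable gaussian_modes (poly_eval F)"
    unfolding F by (intro Bochner_Integration.integrable_sum integrable_mult_right i1 i2; assumption)+
  show "(\<integral>\<phi>. poly_eval F \<phi> \<partial>\<nu>) = (\<integral>\<phi>. poly_eval F \<phi> \<partial>gaussian_modes)"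
    unfolding F using i1 i2 eq keys by (simp add: Bochner_Integration.integral_sum)
qed

lemma mode_polys_add: "F \<in> mode_polys \<Longrightarrow> G \<in> mode_polys \<Longrightarrow> F + G \<in> mode_polys"
  using Poly_Mapping.keys_add[of F G] by (auto simp: mode_polys_def)

lemma mode_polys_sum: "(\<And>x. x \<in> A \<Longrightarrow> f x \<in> mode_polys) \<Longrightarrow> sum f A \<in> mode_polys"
  by (induction A rule: infinite_finite_induct) (auto simp: mode_polys_add, auto simp: mode_polys_def)

lemma mode_polys_mult: "F \<in> mode_polys \<Longrightarrow> G \<in> mode_polys \<Longrightarrow> F * G \<in> mode_polys"
proof -
  assume FG: "F \<in> mode_polys" "G \<in> mode_polys"
  show "F * G \<in> mode_polys" unfolding mode_polys_def
  proof safe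
    fix mon assume "mon \<in> keys (F * G)" "0 \<in> keys mon"
    with Poly_Mapping.keys_mult[of F G] obtain a b where "a \<in> keys F" "b \<in> keys G" "mon = a + b"
      by auto
    moreover from this have "0 \<in> keys a \<union> keys b"
      using \<open>0 \<in> keys mon\<close> Poly_Mapping.keys_add[of a b] by auto
    ultimately show False using FG by (auto simp: mode_polys_def)
  qed
qed

lemma mode_polys_const: "const_poly c \<in> mode_polys"
  unfolding const_poly_def by (rule mode_polys_single) simp

lemma mode_polys_var: "k \<noteq> 0 \<Longrightarrow> mode_var k \<in> mode_polys"
  unfolding mode_var_def by (rule mode_polys_single) simp

lemma mode_polys_power: "F \<in> mode_polys \<Longrightarrow> F ^ r \<in> mode_polys"
  using mode_polys_const[of 1] by (induction r) (auto simp: mode_polys_mult const_poly_def)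

lemma gaussian_modes_exp_integrable:
  assumes "k \<ge> 1"
  shows "integrable gaussian_modes (\<lambda>\<phi>. exp (c * \<bar>Re (\<phi> k)\<bar>))" "integrable gaussian_modes (\<lambda>\<phi>. exp (c * \<bar>Im (\<phi> k)\<bar>))"
  using assms by (auto intro!: integrable_gaussian_component[of k] complex_gaussian_exp_integrable)

lemma gaussian_mode_variance:
  assumes "m \<ge> 1"
  shows "integrable gaussian_modes (\<lambda>\<phi>. (cmod (\<phi> m))\<^sup>2)" "(\<integral>\<phi>. (cmod (\<phi> m))\<^sup>2 \<partial>gaussian_modes) = 1 / real m"
proof -
  have m: "m \<in> {1..}" "1 / real m > 0" using assms by auto
  have e: "z ^ 1 * cnj z ^ 1 = complex_of_real ((cmod z)\<^sup>2)" for z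
    by (simp only: complex_norm_square power_one_right)
  have "integrable gaussian_modes (\<lambda>\<phi>. \<phi> m ^ 1 * cnj (\<phi> m) ^ 1)"
    by (rule integrable_gaussian_component[OF m(1) complex_gaussian_integrable[OF m(2)]])
  thus "integrable gaussian_modes (\<lambda>\<phi>. (cmod (\<phi> m))\<^sup>2)" unfolding e complex_of_real_integrable_eq .
  interpret prob_space "complex_gaussian (1 / real m)" by (rule prob_space_complex_gaussian) (rule m(2))
  have "(\<integral>\<phi>. \<phi> m ^ 1 * cnj (\<phi> m) ^ 1 \<partial>gaussian_modes) = (\<integral>z. z ^ 1 * cnj z ^ 1 \<partial>complex_gaussian (1 / real m))"
    by (rule integral_gaussian_component[OF m(1) measurable_power_cnj])
  also have "\<dots> = of_real (1 / real m)"
    using complex_gaussian_ibp(1)[OF m(2), of 1 0] prob_space by simp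
  finally show "(\<integral>\<phi>. (cmod (\<phi> m))\<^sup>2 \<partial>gaussian_modes) = 1 / real m"
    unfolding e integral_complex_of_real of_real_eq_iff .
qed


section \<open>Moments and characteristic functions\<close>

text \<open>
  Taylor's formula bounds the difference between \<open>iexp x\<close> and its Taylor polynomial of degree \<open>2 j - 1\<close> by
  \<open>x ^ (2 j) / fact (2 j)\<close>. The expectations of the polynomials agree, and so do those of the bounds; the latter
  tend to zero because the exponential moment of \<open>Y\<close> dominates them.
\<close>

lemma iexp_expectation_of_moments:
  fixes X :: "'a \<Rightarrow> real" and Y :: "'b \<Rightarrow> real"
  assumes "prob_space M" "prob_space N"
    and X[measurable]: "X \<in> borel_measurable M" and Y[measurable]: "Y \<in> borel_measurable N"
    and iX: "\<And>k. integrable M (\<lambda>x. X x ^ k)" and iY: "\<And>k. integrable N (\<lambda>y. Y y ^ k)"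
    and eq: "\<And>k. (\<integral>x. X x ^ k \<partial>M) = (\<integral>y. Y y ^ k \<partial>N)"
    and exp: "integrable N (\<lambda>y. exp \<bar>Y y\<bar>)"
  shows "(\<integral>x. iexp (X x) \<partial>M) = (\<integral>y. iexp (Y y) \<partial>N)"
proof -
  interpret M: prob_space M by fact
  interpret N: prob_space N by fact
  define P where "P n x = (\<Sum>k\<le>n. (\<i> * complex_of_real x) ^ k / fact k)" for n x
  have PX: "integrable M (\<lambda>x. P n (X x))" and PY: "integrable N (\<lambda>y. P n (Y y))"
    and Peq: "(\<integral>x. P n (X x) \<partial>M) = (\<integral>y. P n (Y y) \<partial>N)" for n
  proof -
    have P: "P n x = (\<Sum>k\<le>n. \<i> ^ k / fact k * of_real (x ^ k))" for x
      by (simp add: P_def power_mult_distrib)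
    have i: "integrable M (\<lambda>x. \<i> ^ k / fact k * of_real (X x ^ k))"
      "integrable N (\<lambda>y. \<i> ^ k / fact k * of_real (Y y ^ k))" for k
      using iX[of k] iY[of k] by (intro integrable_mult_right integrable_of_real; simp)+
    show "integrable M (\<lambda>x. P n (X x))" "integrable N (\<lambda>y. P n (Y y))"
      unfolding P by (intro Bochner_Integration.integrable_sum i)+
    have e: "(\<integral>x. \<i> ^ k / fact k * of_real (X x ^ k) \<partial>M) = (\<integral>y. \<i> ^ k / fact k * of_real (Y y ^ k) \<partial>N)" for k
      unfolding integral_mult_right_zero integral_complex_of_real eq ..
    show "(\<integral>x. P n (X x) \<partial>M) = (\<integral>y. P n (Y y) \<partial>N)"
      unfolding P by (simp only: Bochner_Integration.integral_sum[OF i(1)] Bochner_Integration.integral_sum[OF i(2)] e)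
  qed
  define m where "m j = (\<integral>y. Y y ^ (2 * j) \<partial>N) / fact (2 * j)" for j
  have bound: "cmod (iexp x - P (2 * j - 1) x) \<le> x ^ (2 * j) / fact (2 * j)" if "j \<ge> 1" for x j
    using iexp_approx1[of x "2 * j - 1"] that by (simp add: P_def power_even_abs)
  have *: "cmod ((\<integral>x. iexp (X x) \<partial>M) - (\<integral>y. iexp (Y y) \<partial>N)) \<le> 2 * m j" if j: "j \<ge> 1" for j
  proof -
    have iexpX: "integrable M (\<lambda>x. iexp (X x))" and iexpY: "integrable N (\<lambda>y. iexp (Y y))"
      by (auto intro!: M.integrable_const_bound[where B = 1] N.integrable_const_bound[where B = 1])
    have "cmod ((\<integral>x. iexp (X x) \<partial>M) - (\<integral>x. P (2 * j - 1) (X x) \<partial>M)) = cmod (\<integral>x. iexp (X x) - P (2 * j - 1) (X x) \<partial>M)"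
      using iexpX PX by simp
    also have "\<dots> \<le> (\<integral>x. cmod (iexp (X x) - P (2 * j - 1) (X x)) \<partial>M)"
      by (rule integral_norm_bound)
    also have "\<dots> \<le> (\<integral>x. X x ^ (2 * j) / fact (2 * j) \<partial>M)"
      using iexpX PX iX by (intro integral_mono integrable_norm Bochner_Integration.integrable_diff bound j) auto
    also have "\<dots> = m j" using eq by (simp add: m_def)
    finally have 1: "cmod ((\<integral>x. iexp (X x) \<partial>M) - (\<integral>x. P (2 * j - 1) (X x) \<partial>M)) \<le> m j" .
    have "cmod ((\<integral>y. iexp (Y y) \<partial>N) - (\<integral>y. P (2 * j - 1) (Y y) \<partial>N)) = cmod (\<integral>y. iexp (Y y) - P (2 * j - 1) (Y y) \<partial>N)"
      using iexpY PY by simp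
    also have "\<dots> \<le> (\<integral>y. cmod (iexp (Y y) - P (2 * j - 1) (Y y)) \<partial>N)"
      by (rule integral_norm_bound)
    also have "\<dots> \<le> (\<integral>y. Y y ^ (2 * j) / fact (2 * j) \<partial>N)"
      using iexpY PY iY by (intro integral_mono integrable_norm Bochner_Integration.integrable_diff bound j) auto
    also have "\<dots> = m j" by (simp add: m_def)
    finally have 2: "cmod ((\<integral>y. iexp (Y y) \<partial>N) - (\<integral>y. P (2 * j - 1) (Y y) \<partial>N)) \<le> m j" .
    have "cmod (a - b) \<le> cmod (a - p) + cmod (b - p)" for a b p :: complex
      by (metis norm_triangle_ineq4 diff_diff_eq2 add_diff_cancel diff_add_eq)
    from this[of _ _ "\<integral>y. P (2 * j - 1) (Y y) \<partial>N"] show ?thesis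
      using 1 2 unfolding Peq by (smt (verit))
  qed
  have m0: "m \<longlonglongrightarrow> 0"
  proof -
    have pt: "(\<lambda>j. Y y ^ (2 * j) / fact (2 * j)) \<longlonglongrightarrow> 0" for y
    proof -
      have "(\<lambda>n. Y y ^ n / fact n) \<longlonglongrightarrow> 0"
        using summable_LIMSEQ_zero[OF summable_exp[of "Y y"]] by (simp add: field_simps)
      from LIMSEQ_subseq_LIMSEQ[OF this, of "\<lambda>j. 2 * j"] show ?thesis by (simp add: strict_mono_def o_def)
    qed
    have dom: "norm (Y y ^ (2 * j) / fact (2 * j)) \<le> exp \<bar>Y y\<bar>" for y j
    proof -
      have "norm (Y y ^ (2 * j) / fact (2 * j)) = \<bar>Y y\<bar> ^ (2 * j) /\<^sub>R fact (2 * j)"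
        by (simp add: power_abs abs_mult divide_inverse mult.commute)
      also have "\<dots> = (\<Sum>n\<in>{2 * j}. \<bar>Y y\<bar> ^ n /\<^sub>R fact n)" by simp
      also have "\<dots> \<le> suminf (\<lambda>n. \<bar>Y y\<bar> ^ n /\<^sub>R fact n)"
        by (rule sum_le_suminf[OF summable_exp_generic]) auto
      finally show ?thesis by (simp add: exp_def)
    qed
    have "(\<lambda>j. \<integral>y. Y y ^ (2 * j) / fact (2 * j) \<partial>N) \<longlonglongrightarrow> (\<integral>y. 0 \<partial>N)"
      by (rule integral_dominated_convergence[OF _ _ exp]) (use pt dom in auto)
    thus ?thesis by (simp add: m_def[abs_def])
  qed
  have "cmod ((\<integral>x. iexp (X x) \<partial>M) - (\<integral>y. iexp (Y y) \<partial>N)) \<le> 2 * 0"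
    by (rule LIMSEQ_le_const[OF tendsto_mult_left[OF m0]]) (use * in auto)
  thus ?thesis by simp
qed

text \<open>
  The theorem of Levy for the laws of \<open>X\<close> and \<open>Y\<close> under the probability measures with densities proportional to the
  weights \<open>g\<close> and \<open>h\<close>. The frequency \<open>s = 0\<close> shows that both have the same total mass.
\<close>

lemma weighted_char_uniqueness:
  fixes X :: "'a \<Rightarrow> real" and Y :: "'b \<Rightarrow> real"
  assumes "prob_space M" "prob_space N"
    and X[measurable]: "X \<in> borel_measurable M" and Y[measurable]: "Y \<in> borel_measurable N"
    and g[measurable]: "g \<in> borel_measurable M" and h[measurable]: "h \<in> borel_measurable N"
    and g0: "\<And>x. 0 \<le> g x" "\<And>x. g x \<le> (C :: real)" and h0: "\<And>x. 0 \<le> h x" "\<And>x. h x \<le> C"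
    and eq: "\<And>s. (\<integral>x. iexp (s * X x) * of_real (g x) \<partial>M) = (\<integral>y. iexp (s * Y y) * of_real (h y) \<partial>N)"
    and A[measurable]: "A \<in> sets borel"
  shows "(\<integral>x. indicator A (X x) * g x \<partial>M) = (\<integral>y. indicator A (Y y) * h y \<partial>N)"
proof -
  interpret M: prob_space M by fact
  interpret N: prob_space N by fact
  have ig: "integrable M g" using g0 by (intro M.integrable_const_bound[where B = C]) auto
  have ih: "integrable N h" using h0 by (intro N.integrable_const_bound[where B = C]) auto
  have iAg: "integrable M (\<lambda>x. indicator A (X x) * g x)" and iAh: "integrable N (\<lambda>y. indicator A (Y y) * h y)"
    by (rule Bochner_Integration.integrable_bound[OF ig], simp, simp add: indicator_def)
       (rule Bochner_Integration.integrable_bound[OF ih], simp, simp add: indicator_def)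
  define c where "c = (\<integral>x. g x \<partial>M)"
  have c: "c = (\<integral>y. h y \<partial>N)" using eq[of 0] by (simp add: c_def)
  have c0: "c \<ge> 0" unfolding c_def using g0 by simp
  show ?thesis
  proof (cases "c = 0")
    case True
    have "(\<integral>x. indicator A (X x) * g x \<partial>M) \<le> c" unfolding c_def
      by (rule integral_mono[OF iAg ig]) (use g0 in \<open>auto simp: indicator_def\<close>)
    moreover have "(\<integral>x. indicator A (X x) * g x \<partial>M) \<ge> 0"
      by (rule Bochner_Integration.integral_nonneg) (use g0 in auto)
    moreover have "(\<integral>y. indicator A (Y y) * h y \<partial>N) \<le> c" unfolding c
      by (rule integral_mono[OF iAh ih]) (use h0 in \<open>auto simp: indicator_def\<close>)
    moreover have "(\<integral>y. indicator A (Y y) * h y \<partial>N) \<ge> 0"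
      by (rule Bochner_Integration.integral_nonneg) (use h0 in auto)
    ultimately show ?thesis using True by simp
  next
    case False
    hence cp: "c > 0" using c0 by simp
    have dist: "real_distribution (distr (density L (\<lambda>x. ennreal (k x / c))) borel Z)"
      if "prob_space L" "integrable L k" "(\<integral>x. k x \<partial>L) = c" "\<And>x. 0 \<le> k x" "Z \<in> borel_measurable L" for L :: "'c measure" and k Z
    proof -
      have "(\<integral>\<^sup>+ x. ennreal (k x / c) \<partial>L) = ennreal (\<integral>x. k x / c \<partial>L)"
        using that cp by (intro nn_integral_eq_integral) auto
      also have "\<dots> = 1" using that(3) cp by simp
      finally have "prob_space (density L (\<lambda>x. ennreal (k x / c)))"
        using that(2) by (intro prob_spaceI) (simp add: emeasure_density)
      hence "prob_space (distr (density L (\<lambda>x. ennreal (k x / c))) borel Z)"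
        by (rule prob_space.prob_space_distr) (use that in simp)
      thus ?thesis by (simp add: real_distribution_def real_distribution_axioms_def)
    qed
    have char: "char (distr (density L (\<lambda>x. ennreal (k x / c))) borel Z) s = (\<integral>x. iexp (s * Z x) * of_real (k x) \<partial>L) / of_real c"
      if "k \<in> borel_measurable L" "\<And>x. 0 \<le> k x" "Z \<in> borel_measurable L" for L :: "'c measure" and k Z s
    proof -
      have "char (distr (density L (\<lambda>x. ennreal (k x / c))) borel Z) s = (\<integral>x. iexp (s * Z x) \<partial>density L (\<lambda>x. ennreal (k x / c)))"
        unfolding char_def using that by (subst integral_distr) auto
      also have "\<dots> = (\<integral>x. (k x / c) *\<^sub>R iexp (s * Z x) \<partial>L)"
        using that cp by (subst integral_density) auto
      also have "\<dots> = (\<integral>x. (iexp (s * Z x) * of_real (k x)) / of_real c \<partial>L)"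
        by (simp add: scaleR_conv_of_real mult.commute)
      finally show ?thesis by simp
    qed
    have meas: "measure (distr (density L (\<lambda>x. ennreal (k x / c))) borel Z) A = (\<integral>x. indicator A (Z x) * k x \<partial>L) / c"
      if [measurable]: "k \<in> borel_measurable L" and "\<And>x. 0 \<le> k x" and [measurable]: "Z \<in> borel_measurable L" for L :: "'c measure" and k Z
    proof -
      have "measure (distr (density L (\<lambda>x. ennreal (k x / c))) borel Z) A = (\<integral>x. indicator A x \<partial>distr (density L (\<lambda>x. ennreal (k x / c))) borel Z)"
        by simp
      also have "\<dots> = (\<integral>x. indicator A (Z x) \<partial>density L (\<lambda>x. ennreal (k x / c)))"
        by (subst integral_distr) auto
      also have "\<dots> = (\<integral>x. (k x / c) *\<^sub>R indicator A (Z x) \<partial>L)"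
        using that cp by (subst integral_density) auto
      also have "\<dots> = (\<integral>x. (indicator A (Z x) * k x) / c \<partial>L)"
        by (simp add: mult.commute)
      finally show ?thesis by simp
    qed
    have "distr (density M (\<lambda>x. ennreal (g x / c))) borel X = distr (density N (\<lambda>x. ennreal (h x / c))) borel Y"
      using g0 h0 eq ig ih assms(1,2)
      by (intro Levy_uniqueness dist ext) (auto simp: char c_def[symmetric] c[symmetric])
    hence "(\<integral>x. indicator A (X x) * g x \<partial>M) / c = (\<integral>y. indicator A (Y y) * h y \<partial>N) / c"
      unfolding meas[OF g g0(1) X, symmetric] meas[OF h h0(1) Y, symmetric] by (rule arg_cong[where f = "\<lambda>P. measure P A"])
    thus ?thesis using cp by simp
  qed
qed

text \<open>
  Induction on \<open>K\<close>: exponentials \<open>iexp (t j * x j)\<close> are replaced by indicators one coordinate at a time. For the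
  new coordinate \<open>k\<close>, \<open>weighted_char_uniqueness\<close> is applied with the weights \<open>f\<close>, \<open>f (1 + cos S)\<close> and
  \<open>f (1 + sin S)\<close>, where \<open>f\<close> is the product of the indicators obtained so far and \<open>S\<close> the linear form of the remaining
  coordinates. The summand \<open>1\<close> makes the weights nonnegative; subtracting the case \<open>f\<close> leaves the real and the
  imaginary part of \<open>f iexp S\<close>.
\<close>

lemma PiM_char_indicators:
  fixes M N :: "('i \<Rightarrow> real) measure"
  assumes "prob_space M" "prob_space N"
    and sM: "sets M = sets (PiM I (\<lambda>_. borel))" and sN: "sets N = sets (PiM I (\<lambda>_. borel))"
    and char: "\<And>J t. finite J \<Longrightarrow> J \<subseteq> I \<Longrightarrow> (\<integral>x. iexp (\<Sum>j\<in>J. t j * x j) \<partial>M) = (\<integral>x. iexp (\<Sum>j\<in>J. t j * x j) \<partial>N)"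
    and K: "finite K" "K \<subseteq> I" and A: "\<And>j. j \<in> K \<Longrightarrow> A j \<in> sets borel"
    and J: "finite J" "J \<subseteq> I" "J \<inter> K = {}"
  shows "(\<integral>x. of_real (\<Prod>j\<in>K. indicator (A j) (x j)) * iexp (\<Sum>j\<in>J. t j * x j) \<partial>M) =
         (\<integral>x. of_real (\<Prod>j\<in>K. indicator (A j) (x j)) * iexp (\<Sum>j\<in>J. t j * x j) \<partial>N)"
  using K A J
proof (induction K arbitrary: J t rule: finite_induct)
  case empty
  thus ?case using char by simp
next
  case (insert k K J t)
  interpret M: prob_space M by fact
  interpret N: prob_space N by fact
  define f where "f x = (\<Prod>j\<in>K. indicator (A j) (x j) :: real)" for x :: "'i \<Rightarrow> real"
  define S where "S x = (\<Sum>j\<in>J. t j * x j)" for x :: "'i \<Rightarrow> real"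
  have comp: "(\<lambda>x. x j) \<in> borel_measurable M" "(\<lambda>x. x j) \<in> borel_measurable N" if "j \<in> I" for j
    using measurable_component_singleton[OF that, of "\<lambda>_. borel :: real measure"]
    by (simp_all cong: measurable_cong_sets add: sM sN)
  have f[measurable]: "f \<in> borel_measurable M" "f \<in> borel_measurable N"
  proof -
    have "(\<lambda>x. indicator (A j) (x j) :: real) \<in> borel_measurable L" if "j \<in> K" "(\<lambda>x. x j) \<in> borel_measurable L" for j L
      using measurable_compose[OF that(2), of "indicator (A j)" borel] insert.prems(2) that by auto
    thus "f \<in> borel_measurable M" "f \<in> borel_measurable N"
      unfolding f_def using comp insert.prems(1) by (auto intro!: borel_measurable_prod)
  qed
  have S[measurable]: "S \<in> borel_measurable M" "S \<in> borel_measurable N"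
    unfolding S_def using comp insert.prems(4) by (auto intro!: borel_measurable_sum borel_measurable_times)
  have k[measurable]: "(\<lambda>x. x k) \<in> borel_measurable M" "(\<lambda>x. x k) \<in> borel_measurable N"
    using comp insert.prems(1) by auto
  have f01: "0 \<le> f x" "f x \<le> 1" for x
    unfolding f_def by (auto intro!: prod_nonneg prod_le_1 simp: indicator_def)
  \<comment> \<open>Only the frequencies \<open>u = 0, 1, - 1\<close> are used below: they generate \<open>1\<close>, \<open>cos S\<close> and \<open>sin S\<close>.\<close>
  have IH: "(\<integral>x. of_real (f x) * iexp (s * x k + u * S x) \<partial>M) = (\<integral>x. of_real (f x) * iexp (s * x k + u * S x) \<partial>N)" for s u
  proof -
    have "s * x k + u * S x = (\<Sum>j\<in>insert k J. (if j = k then s else u * t j) * x j)" for x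
    proof -
      have "(\<Sum>j\<in>J. (if j = k then s else u * t j) * x j) = u * S x"
        unfolding S_def sum_distrib_left using insert.prems(5) by (intro sum.cong) auto
      thus ?thesis using insert.prems(3,5) by simp
    qed
    thus ?thesis unfolding f_def
      using insert.IH[of "insert k J" "\<lambda>j. if j = k then s else u * t j"] insert.prems insert.hyps by auto
  qed
  have int: "integrable M (\<lambda>x. of_real (f x) * iexp (s * x k + u * S x))" "integrable N (\<lambda>x. of_real (f x) * iexp (s * x k + u * S x))" for s u
    by (auto intro!: M.integrable_const_bound[where B = 1] N.integrable_const_bound[where B = 1] simp: norm_mult f01)
  have A[measurable]: "A k \<in> sets borel" using insert.prems by simp
  have w: "(\<integral>x. indicator (A k) (x k) * g x \<partial>M) = (\<integral>x. indicator (A k) (x k) * g x \<partial>N)"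
    if g: "g \<in> borel_measurable M" "g \<in> borel_measurable N" "\<And>x. 0 \<le> g x" "\<And>x. g x \<le> 2"
      and e: "\<And>x. of_real (g x) = of_real (f x) * (1 + a * iexp (S x) + b * iexp (- S x))" for g a b
  proof (rule weighted_char_uniqueness[where C = 2, OF assms(1,2) k g(1,2) g(3,4) g(3,4) _ A])
    fix s
    have ee: "iexp (s * x k) * of_real (g x) = of_real (f x) * iexp (s * x k + 0 * S x) + a * (of_real (f x) * iexp (s * x k + 1 * S x))
       + b * (of_real (f x) * iexp (s * x k + (-1) * S x))" for x
      unfolding e by (simp add: exp_add algebra_simps exp_minus exp_diff divide_inverse)
    show "(\<integral>x. iexp (s * x k) * of_real (g x) \<partial>M) = (\<integral>x. iexp (s * x k) * of_real (g x) \<partial>N)"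
      unfolding ee
      by (subst (1 2) Bochner_Integration.integral_add; (intro Bochner_Integration.integrable_add integrable_mult_right int)?)
         (subst (1 2) Bochner_Integration.integral_add; (intro Bochner_Integration.integrable_add integrable_mult_right int)?;
          simp only: IH integral_mult_right_zero)
  qed
  have iexp_cis: "iexp y = cis y" for y :: real by (simp add: cis_conv_exp)
  have w0: "(\<integral>x. indicator (A k) (x k) * f x \<partial>M) = (\<integral>x. indicator (A k) (x k) * f x \<partial>N)"
    by (rule w[of f 0 0]) (use f01 order_trans[OF f01(2)] in auto)
  have w1: "(\<integral>x. indicator (A k) (x k) * (f x * (1 + cos (S x))) \<partial>M) = (\<integral>x. indicator (A k) (x k) * (f x * (1 + cos (S x))) \<partial>N)"
  proof (rule w[of _ "1/2" "1/2"])
    fix x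
    have "0 \<le> 1 + cos (S x)" "1 + cos (S x) \<le> 2" using cos_ge_minus_one[of "S x"] cos_le_one[of "S x"] by linarith+
    with f01[of x] show "0 \<le> f x * (1 + cos (S x))" by (intro mult_nonneg_nonneg)
    have "f x * (1 + cos (S x)) \<le> 1 * 2" using f01[of x] \<open>0 \<le> 1 + cos (S x)\<close> \<open>1 + cos (S x) \<le> 2\<close> by (intro mult_mono) auto
    thus "f x * (1 + cos (S x)) \<le> 2" by simp
    show "of_real (f x * (1 + cos (S x))) = of_real (f x) * (1 + 1/2 * iexp (S x) + 1/2 * iexp (- S x))"
      unfolding iexp_cis by (simp add: complex_eq_iff)
  qed auto
  have w2: "(\<integral>x. indicator (A k) (x k) * (f x * (1 + sin (S x))) \<partial>M) = (\<integral>x. indicator (A k) (x k) * (f x * (1 + sin (S x))) \<partial>N)"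
  proof (rule w[of _ "- \<i>/2" "\<i>/2"])
    fix x
    have "0 \<le> 1 + sin (S x)" "1 + sin (S x) \<le> 2" using sin_ge_minus_one[of "S x"] sin_le_one[of "S x"] by linarith+
    with f01[of x] show "0 \<le> f x * (1 + sin (S x))" by (intro mult_nonneg_nonneg)
    have "f x * (1 + sin (S x)) \<le> 1 * 2" using f01[of x] \<open>0 \<le> 1 + sin (S x)\<close> \<open>1 + sin (S x) \<le> 2\<close> by (intro mult_mono) auto
    thus "f x * (1 + sin (S x)) \<le> 2" by simp
    show "of_real (f x * (1 + sin (S x))) = of_real (f x) * (1 + - \<i>/2 * iexp (S x) + \<i>/2 * iexp (- S x))"
      unfolding iexp_cis by (simp add: complex_eq_iff)
  qed auto
  have ind01: "\<bar>indicator (A k) y\<bar> \<le> (1::real)" for y by (simp add: indicator_def)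
  have ib: "integrable L (\<lambda>x. indicator (A k) (x k) * (f x * u x))"
    if "prob_space L" "f \<in> borel_measurable L" "(\<lambda>x. x k) \<in> borel_measurable L" "u \<in> borel_measurable L" "\<And>x. \<bar>u x\<bar> \<le> 2" for L u
  proof -
    interpret L: prob_space L by fact
    note that(2,3,4)[measurable]
    have "\<bar>indicator (A k) (x k) * (f x * u x)\<bar> \<le> 1 * (1 * 2)" for x
      unfolding abs_mult using that(5)[of x] f01[of x] ind01 by (intro mult_mono) auto
    thus ?thesis by (intro L.integrable_const_bound[where B = 2]) auto
  qed
  have cosb: "\<bar>cos (S x)\<bar> \<le> 2" "\<bar>sin (S x)\<bar> \<le> 2" for x
    using abs_cos_le_one[of "S x"] abs_sin_le_one[of "S x"] by linarith+
  have split: "(\<integral>x. indicator (A k) (x k) * (f x * (1 + u x)) \<partial>L) = (\<integral>x. indicator (A k) (x k) * f x \<partial>L) + (\<integral>x. indicator (A k) (x k) * (f x * u x) \<partial>L)"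
    if "prob_space L" "f \<in> borel_measurable L" "(\<lambda>x. x k) \<in> borel_measurable L" "u \<in> borel_measurable L" "\<And>x. \<bar>u x\<bar> \<le> 2" for L u
    using ib[OF that] ib[OF that(1-3), of "\<lambda>_. 1"] by (simp add: distrib_left)
  have c: "(\<integral>x. indicator (A k) (x k) * (f x * cos (S x)) \<partial>M) = (\<integral>x. indicator (A k) (x k) * (f x * cos (S x)) \<partial>N)"
    using w0 w1 split[OF assms(1) f(1) k(1), of "\<lambda>x. cos (S x)"] split[OF assms(2) f(2) k(2), of "\<lambda>x. cos (S x)"] cosb by simp
  have s: "(\<integral>x. indicator (A k) (x k) * (f x * sin (S x)) \<partial>M) = (\<integral>x. indicator (A k) (x k) * (f x * sin (S x)) \<partial>N)"
    using w0 w2 split[OF assms(1) f(1) k(1), of "\<lambda>x. sin (S x)"] split[OF assms(2) f(2) k(2), of "\<lambda>x. sin (S x)"] cosb by simp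
  have e: "of_real (\<Prod>j\<in>insert k K. indicator (A j) (x j)) * iexp (\<Sum>j\<in>J. t j * x j) =
     complex_of_real (indicator (A k) (x k) * (f x * cos (S x))) + \<i> * complex_of_real (indicator (A k) (x k) * (f x * sin (S x)))" for x
    unfolding iexp_cis using insert.hyps by (simp add: f_def S_def complex_eq_iff)
  have fin: "(\<integral>x. complex_of_real (indicator (A k) (x k) * (f x * cos (S x))) + \<i> * complex_of_real (indicator (A k) (x k) * (f x * sin (S x))) \<partial>L)
     = of_real (\<integral>x. indicator (A k) (x k) * (f x * cos (S x)) \<partial>L) + \<i> * of_real (\<integral>x. indicator (A k) (x k) * (f x * sin (S x)) \<partial>L)"
    if "prob_space L" "f \<in> borel_measurable L" "(\<lambda>x. x k) \<in> borel_measurable L" "S \<in> borel_measurable L" for L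
    using ib[OF that(1-3), of "\<lambda>x. cos (S x)"] ib[OF that(1-3), of "\<lambda>x. sin (S x)"] that(4) cosb
    by (subst Bochner_Integration.integral_add) (auto intro!: integrable_mult_right integrable_of_real simp del: of_real_mult)
  show ?case unfolding e fin[OF assms(1) f(1) k(1) S(1)] fin[OF assms(2) f(2) k(2) S(2)] c s ..
qed

lemma PiM_char_uniqueness:
  fixes M N :: "('i \<Rightarrow> real) measure"
  assumes "prob_space M" "prob_space N"
    and sM: "sets M = sets (PiM I (\<lambda>_. borel))" and sN: "sets N = sets (PiM I (\<lambda>_. borel))"
    and char: "\<And>J t. finite J \<Longrightarrow> J \<subseteq> I \<Longrightarrow> (\<integral>x. iexp (\<Sum>j\<in>J. t j * x j) \<partial>M) = (\<integral>x. iexp (\<Sum>j\<in>J. t j * x j) \<partial>N)"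
  shows "M = N"
proof (rule measure_eqI_PiM_infinite[OF sM sN])
  interpret M: prob_space M by fact
  interpret N: prob_space N by fact
  show "finite_measure M" by (rule M.finite_measure_axioms)
  fix A :: "'i \<Rightarrow> real set" and K assume K: "finite K" "K \<subseteq> I" and A: "\<And>i. i \<in> K \<Longrightarrow> A i \<in> sets borel"
  let ?E = "prod_emb I (\<lambda>_. borel) K (Pi\<^sub>E K A)"
  have E: "?E \<in> sets (PiM I (\<lambda>_. borel))" using K A by (intro sets_PiM_I) auto
  have meas: "of_real (measure L ?E) = (\<integral>x. of_real (\<Prod>j\<in>K. indicator (A j) (x j)) * iexp (\<Sum>j\<in>{}. 0 * x j) \<partial>L)"
    if "sets L = sets (PiM I (\<lambda>_. borel))" for L
  proof -
    have sp: "space L = space (PiM I (\<lambda>_. borel))" by (rule sets_eq_imp_space_eq[OF that])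
    have "(\<integral>x. of_real (\<Prod>j\<in>K. indicator (A j) (x j)) * iexp (\<Sum>j\<in>{}. 0 * x j) \<partial>L) = (\<integral>x. of_real (indicator ?E x) \<partial>L)"
    proof (rule Bochner_Integration.integral_cong[OF refl])
      fix x assume "x \<in> space L"
      hence x: "x \<in> space (PiM I (\<lambda>_. borel))" by (simp add: sp)
      have "(\<Prod>j\<in>K. indicator (A j) (x j)) = (if \<forall>j\<in>K. x j \<in> A j then 1 else 0 :: real)"
        using K(1) by (auto simp: indicator_def prod_zero_iff intro!: prod.neutral)
      also have "\<dots> = indicator ?E x"
        using x K(2) by (auto simp: indicator_def prod_emb_def space_PiM PiE_iff extensional_def)
      finally show "of_real (\<Prod>j\<in>K. indicator (A j) (x j)) * iexp (\<Sum>j\<in>{}. 0 * x j) = complex_of_real (indicator ?E x)"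
        by simp
    qed
    also have "\<dots> = of_real (measure L ?E)"
      using E that by (subst integral_complex_of_real) (simp add: Int_absorb2 sets.sets_into_space)
    finally show ?thesis by simp
  qed
  have "complex_of_real (measure M ?E) = of_real (measure N ?E)"
    unfolding meas[OF sM] meas[OF sN]
    by (rule PiM_char_indicators[OF assms(1,2) sM sN char K A]) auto
  thus "emeasure M ?E = emeasure N ?E"
    by (simp add: M.emeasure_eq_measure N.emeasure_eq_measure)
qed


section \<open>The law of the modes is determined by its moments\<close>

text \<open>
  A sum is at most the number of its terms times the largest one. This reduces exponential moments of a linear form
  to those of single coordinates.
\<close>

lemma exp_sum_le:
  fixes a :: "'i \<Rightarrow> real"
  assumes "finite J"
  shows "exp (\<Sum>j\<in>J. a j) \<le> 1 + (\<Sum>j\<in>J. exp (real (card J) * a j))"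
proof (cases "J = {}")
  case False
  define m where "m = Max (a ` J)"
  have "m \<in> a ` J" unfolding m_def using assms False by (intro Max_in) auto
  then obtain j0 where j0: "j0 \<in> J" "a j0 = m" by auto
  have "(\<Sum>j\<in>J. a j) \<le> real (card J) * m"
    by (rule sum_bounded_above) (use assms in \<open>auto simp: m_def\<close>)
  hence "exp (\<Sum>j\<in>J. a j) \<le> exp (real (card J) * a j0)" by (simp add: j0)
  also have "\<dots> \<le> (\<Sum>j\<in>J. exp (real (card J) * a j))"
    by (rule member_le_sum[OF j0(1), of "\<lambda>j. exp (real (card J) * a j)"]) (use assms in auto)
  finally show ?thesis by simp
qed simp

text \<open>
  The complex modes as a family of real coordinates, to which \<open>PiM_char_uniqueness\<close> applies.
\<close>

definition real_mode :: "(nat \<Rightarrow> complex) \<Rightarrow> nat \<times> bool \<Rightarrow> real" where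
  "real_mode \<phi> p = (if snd p then Re (\<phi> (fst p)) else Im (\<phi> (fst p)))"

definition real_mode_poly :: "nat \<times> bool \<Rightarrow> mode_poly" where
  "real_mode_poly p = (if snd p then const_poly (1/2) * (mode_var (int (fst p)) + mode_var (- int (fst p)))
     else const_poly (1 / (2 * \<i>)) * (mode_var (int (fst p)) + const_poly (-1) * mode_var (- int (fst p))))"

lemma poly_eval_real_mode_poly:
  "fst p \<ge> 1 \<Longrightarrow> poly_eval (real_mode_poly p) \<phi> = of_real (real_mode \<phi> p)"
  by (auto simp: real_mode_poly_def real_mode_def mode_val_def complex_eq_iff)

lemma real_mode_poly_in_mode_polys: "fst p \<ge> 1 \<Longrightarrow> real_mode_poly p \<in> mode_polys"
  unfolding real_mode_poly_def
  by (auto intro!: mode_polys_mult mode_polys_add mode_polys_const mode_polys_var)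

lemma measurable_real_mode:
  assumes "sets \<nu> = sets (PiM {1..} (\<lambda>_. borel))" "fst p \<ge> 1"
  shows "(\<lambda>\<phi>. real_mode \<phi> p) \<in> borel_measurable \<nu>"
proof -
  have "(\<lambda>\<phi>. \<phi> (fst p)) \<in> borel_measurable (PiM {1..} (\<lambda>_. borel :: complex measure))"
    using assms(2) by (intro measurable_component_singleton) auto
  hence "(\<lambda>\<phi>. \<phi> (fst p)) \<in> borel_measurable \<nu>" by (simp cong: measurable_cong_sets add: assms(1))
  thus ?thesis unfolding real_mode_def by (cases "snd p") simp_all
qed

lemma real_mode_exp_integrable:
  assumes "fst p \<ge> 1"
  shows "integrable gaussian_modes (\<lambda>\<phi>. exp (c * \<bar>real_mode \<phi> p\<bar>))"
  using gaussian_modes_exp_integrable[OF assms, of c] by (cases "snd p") (auto simp: real_mode_def)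

text \<open>
  Powers of a real linear form in the modes are mode polynomials, so that all of its moments agree.
\<close>

lemma iexp_real_modes_eq:
  assumes "prob_space \<nu>" and sets: "sets \<nu> = sets (PiM {1..} (\<lambda>_. borel))"
    and moments: "\<And>F. F \<in> mode_polys \<Longrightarrow> integrable \<nu> (poly_eval F)"
      "\<And>F. F \<in> mode_polys \<Longrightarrow> integrable gaussian_modes (poly_eval F)"
      "\<And>F. F \<in> mode_polys \<Longrightarrow> (\<integral>\<phi>. poly_eval F \<phi> \<partial>\<nu>) = (\<integral>\<phi>. poly_eval F \<phi> \<partial>gaussian_modes)"
    and J: "finite J" "J \<subseteq> {1..} \<times> UNIV"
  shows "(\<integral>\<phi>. iexp (\<Sum>j\<in>J. t j * real_mode \<phi> j) \<partial>\<nu>) = (\<integral>\<phi>. iexp (\<Sum>j\<in>J. t j * real_mode \<phi> j) \<partial>gaussian_modes)"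
proof (rule iexp_expectation_of_moments)
  define L where "L \<phi> = (\<Sum>j\<in>J. t j * real_mode \<phi> j)" for \<phi>
  have J1: "fst j \<ge> 1" if "j \<in> J" for j using J(2) that by auto
  define F where "F = (\<Sum>j\<in>J. const_poly (of_real (t j)) * real_mode_poly j)"
  have F: "F ^ k \<in> mode_polys" for k
    unfolding F_def using J1
    by (intro mode_polys_power mode_polys_sum mode_polys_mult mode_polys_const real_mode_poly_in_mode_polys)
  have "poly_eval F \<phi> = of_real (L \<phi>)" for \<phi>
    unfolding F_def L_def using J1 by (simp add: poly_eval_real_mode_poly)
  hence ev: "poly_eval (F ^ k) = (\<lambda>\<phi>. complex_of_real (L \<phi> ^ k))" for k by (intro ext) simp
  show "prob_space \<nu>" by fact
  show "prob_space gaussian_modes" by (rule prob_space_gaussian_modes)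
  show "(\<lambda>\<phi>. \<Sum>j\<in>J. t j * real_mode \<phi> j) \<in> borel_measurable \<nu>"
    using J1 measurable_real_mode[OF sets] by (intro borel_measurable_sum borel_measurable_times) auto
  show m: "(\<lambda>\<phi>. \<Sum>j\<in>J. t j * real_mode \<phi> j) \<in> borel_measurable gaussian_modes"
    using J1 measurable_real_mode[OF sets_gaussian_modes] by (intro borel_measurable_sum borel_measurable_times) auto
  fix k
  show "integrable \<nu> (\<lambda>\<phi>. (\<Sum>j\<in>J. t j * real_mode \<phi> j) ^ k)"
    using moments(1)[OF F, of k] unfolding ev complex_of_real_integrable_eq by (simp add: L_def)
  show "integrable gaussian_modes (\<lambda>\<phi>. (\<Sum>j\<in>J. t j * real_mode \<phi> j) ^ k)"
    using moments(2)[OF F, of k] unfolding ev complex_of_real_integrable_eq by (simp add: L_def)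
  show "(\<integral>\<phi>. (\<Sum>j\<in>J. t j * real_mode \<phi> j) ^ k \<partial>\<nu>) = (\<integral>\<phi>. (\<Sum>j\<in>J. t j * real_mode \<phi> j) ^ k \<partial>gaussian_modes)"
    using moments(3)[OF F, of k] unfolding ev integral_complex_of_real of_real_eq_iff by (simp add: L_def)
next
  interpret prob_space gaussian_modes by (rule prob_space_gaussian_modes)
  have J1: "fst j \<ge> 1" if "j \<in> J" for j using J(2) that by auto
  show "integrable gaussian_modes (\<lambda>\<phi>. exp \<bar>\<Sum>j\<in>J. t j * real_mode \<phi> j\<bar>)"
  proof (rule Bochner_Integration.integrable_bound)
    show "integrable gaussian_modes (\<lambda>\<phi>. 1 + (\<Sum>j\<in>J. exp (real (card J) * \<bar>t j\<bar> * \<bar>real_mode \<phi> j\<bar>)))"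
      using J1 by (intro Bochner_Integration.integrable_add Bochner_Integration.integrable_sum real_mode_exp_integrable) auto
    have "(\<lambda>\<phi>. \<Sum>j\<in>J. t j * real_mode \<phi> j) \<in> borel_measurable gaussian_modes"
      using J1 measurable_real_mode[OF sets_gaussian_modes] by (intro borel_measurable_sum borel_measurable_times) auto
    thus "(\<lambda>\<phi>. exp \<bar>\<Sum>j\<in>J. t j * real_mode \<phi> j\<bar>) \<in> borel_measurable gaussian_modes" by simp
    show "AE \<phi> in gaussian_modes. norm (exp \<bar>\<Sum>j\<in>J. t j * real_mode \<phi> j\<bar>) \<le> norm (1 + (\<Sum>j\<in>J. exp (real (card J) * \<bar>t j\<bar> * \<bar>real_mode \<phi> j\<bar>)))"
    proof (rule AE_I2)
      fix \<phi>
      have "exp \<bar>\<Sum>j\<in>J. t j * real_mode \<phi> j\<bar> \<le> exp (\<Sum>j\<in>J. \<bar>t j\<bar> * \<bar>real_mode \<phi> j\<bar>)"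
        using sum_abs[of "\<lambda>j. t j * real_mode \<phi> j" J] by (simp add: abs_mult)
      also have "\<dots> \<le> 1 + (\<Sum>j\<in>J. exp (real (card J) * \<bar>t j\<bar> * \<bar>real_mode \<phi> j\<bar>))"
        using exp_sum_le[OF J(1), of "\<lambda>j. \<bar>t j\<bar> * \<bar>real_mode \<phi> j\<bar>"] by (simp add: mult.assoc)
      also have "\<dots> \<le> \<bar>1 + (\<Sum>j\<in>J. exp (real (card J) * \<bar>t j\<bar> * \<bar>real_mode \<phi> j\<bar>))\<bar>" by (rule abs_ge_self)
      finally show "norm (exp \<bar>\<Sum>j\<in>J. t j * real_mode \<phi> j\<bar>) \<le> norm (1 + (\<Sum>j\<in>J. exp (real (card J) * \<bar>t j\<bar> * \<bar>real_mode \<phi> j\<bar>)))"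
        by simp
    qed
  qed
qed

text \<open>
  \<open>\<psi>\<close> splits the modes into real and imaginary parts, \<open>\<theta>\<close> reassembles them. The two images under
  \<open>\<psi>\<close> agree by \<open>PiM_char_uniqueness\<close>, hence so do their images under \<open>\<theta>\<close>.
\<close>

theorem gaussian_modes_moment_determinate:
  assumes "prob_space \<nu>" and sets: "sets \<nu> = sets (PiM {1..} (\<lambda>_. borel))"
    and moments: "\<And>F. F \<in> mode_polys \<Longrightarrow> integrable \<nu> (poly_eval F)"
      "\<And>F. F \<in> mode_polys \<Longrightarrow> integrable gaussian_modes (poly_eval F)"
      "\<And>F. F \<in> mode_polys \<Longrightarrow> (\<integral>\<phi>. poly_eval F \<phi> \<partial>\<nu>) = (\<integral>\<phi>. poly_eval F \<phi> \<partial>gaussian_modes)"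
  shows "\<nu> = gaussian_modes"
proof -
  define I :: "(nat \<times> bool) set" where "I = {1..} \<times> UNIV"
  define B where "B = PiM I (\<lambda>_. borel :: real measure)"
  define \<psi> where "\<psi> \<phi> = (\<lambda>p\<in>I. real_mode \<phi> p)" for \<phi>
  define \<theta> where "\<theta> x = (\<lambda>k\<in>{1..}. Complex (x (k, True)) (x (k, False)))" for x :: "nat \<times> bool \<Rightarrow> real"
  have psi: "\<psi> \<in> measurable L B" if "sets L = sets (PiM {1..} (\<lambda>_. borel :: complex measure))" for L
    unfolding B_def \<psi>_def by (rule measurable_restrict, rule measurable_real_mode[OF that]) (auto simp: I_def)
  have comp: "(\<lambda>x. x p) \<in> borel_measurable B" if "p \<in> I" for p
    unfolding B_def by (rule measurable_component_singleton[OF that])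
  have theta: "\<theta> \<in> measurable B (PiM {1..} (\<lambda>_. borel))"
    unfolding \<theta>_def
  proof (rule measurable_restrict)
    fix k :: nat assume "k \<in> {1..}"
    hence "(k, True) \<in> I" "(k, False) \<in> I" by (auto simp: I_def)
    note comp[OF this(1), measurable] comp[OF this(2), measurable]
    show "(\<lambda>x. Complex (x (k, True)) (x (k, False))) \<in> borel_measurable B"
      unfolding Complex_eq by measurable
  qed
  have inv: "distr (distr L B \<psi>) (PiM {1..} (\<lambda>_. borel)) \<theta> = L" if L: "sets L = sets (PiM {1..} (\<lambda>_. borel :: complex measure))" for L
  proof -
    have "distr (distr L B \<psi>) (PiM {1..} (\<lambda>_. borel)) \<theta> = distr L (PiM {1..} (\<lambda>_. borel)) (\<theta> \<circ> \<psi>)"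
      by (rule distr_distr[OF theta psi[OF L]])
    also have "\<dots> = distr L L (\<lambda>x. x)"
    proof (rule distr_cong[OF refl L[symmetric]])
      fix \<phi> assume "\<phi> \<in> space L"
      hence "\<phi> \<in> space (PiM {1..} (\<lambda>_. borel :: complex measure))" by (simp add: sets_eq_imp_space_eq[OF L])
      hence "\<phi> \<in> extensional {1..}" by (auto simp: space_PiM PiE_def)
      thus "(\<theta> \<circ> \<psi>) \<phi> = \<phi>"
        by (auto simp: \<theta>_def \<psi>_def I_def real_mode_def fun_eq_iff extensional_def)
    qed
    finally show ?thesis by (simp add: distr_id)
  qed
  have "distr \<nu> B \<psi> = distr gaussian_modes B \<psi>"
  proof (rule PiM_char_uniqueness[where I = I])
    show "prob_space (distr \<nu> B \<psi>)" by (rule prob_space.prob_space_distr[OF assms(1) psi[OF sets]])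
    show "prob_space (distr gaussian_modes B \<psi>)"
      by (rule prob_space.prob_space_distr[OF prob_space_gaussian_modes psi[OF sets_gaussian_modes]])
    fix J and t :: "nat \<times> bool \<Rightarrow> real" assume J: "finite J" "J \<subseteq> I"
    have m: "(\<lambda>x. iexp (\<Sum>j\<in>J. t j * x j)) \<in> borel_measurable B"
    proof -
      have "(\<lambda>x. \<Sum>j\<in>J. t j * x j) \<in> borel_measurable B"
        using J comp by (intro borel_measurable_sum borel_measurable_times) auto
      thus ?thesis by measurable
    qed
    have e: "(\<Sum>j\<in>J. t j * \<psi> \<phi> j) = (\<Sum>j\<in>J. t j * real_mode \<phi> j)" for \<phi>
      using J(2) by (intro sum.cong) (auto simp: \<psi>_def)
    show "(\<integral>x. iexp (\<Sum>j\<in>J. t j * x j) \<partial>distr \<nu> B \<psi>) = (\<integral>x. iexp (\<Sum>j\<in>J. t j * x j) \<partial>distr gaussian_modes B \<psi>)"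
      unfolding integral_distr[OF psi[OF sets] m] integral_distr[OF psi[OF sets_gaussian_modes] m] e
      using J by (intro iexp_real_modes_eq[OF assms(1) sets moments]) (auto simp: I_def)
  qed (simp_all add: B_def)
  hence "distr (distr \<nu> B \<psi>) (PiM {1..} (\<lambda>_. borel)) \<theta> = distr (distr gaussian_modes B \<psi>) (PiM {1..} (\<lambda>_. borel)) \<theta>"
    by simp
  thus ?thesis unfolding inv[OF sets] inv[OF sets_gaussian_modes] .
qed

theorem adjoint_relations_imp_gaussian:
  assumes "prob_space \<nu>" "sets \<nu> = sets (borel_on mode_space)" "adjoint_relations Q \<alpha> \<nu>" "Q > 0"
  shows "\<nu> = gaussian_modes"
  using moments_of_adjoint_relations[OF assms(1,3,4)]
  by (intro gaussian_modes_moment_determinate assms(1)) (simp_all add: assms(2) sets_borel_mode_space)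


section \<open>Smooth periodic functions and trigonometric polynomials\<close>

text \<open>
  Smoothness is a coinductive notion: a family of differentiable periodic functions that is closed under \<open>deriv\<close>
  consists of test functions.
\<close>

lemma test_functions_coinduct:
  assumes "f \<in> S"
    and "\<And>f \<theta>. f \<in> S \<Longrightarrow> f (\<theta> + 2 * pi) = f \<theta>"
    and "\<And>f \<theta>. f \<in> S \<Longrightarrow> f differentiable at \<theta>"
    and "\<And>f. f \<in> S \<Longrightarrow> deriv f \<in> S"
  shows "f \<in> test_functions"
proof -
  have "(deriv ^^ j) f \<in> S" for j by (induction j) (auto simp: assms)
  thus ?thesis using assms by (auto simp: test_functions_def)
qed

lemma test_function_periodic: "f \<in> test_functions \<Longrightarrow> f (\<theta> + 2 * pi) = f \<theta>"
  by (simp add: test_functions_def)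

lemma test_function_DERIV: "f \<in> test_functions \<Longrightarrow> (f has_real_derivative deriv f \<theta>) (at \<theta>)"
proof -
  assume "f \<in> test_functions"
  hence "(deriv ^^ 0) f differentiable at \<theta>" unfolding test_functions_def by blast
  thus ?thesis by (simp add: DERIV_deriv_iff_real_differentiable)
qed

lemma test_function_continuous: "f \<in> test_functions \<Longrightarrow> continuous_on A f"
  by (intro continuous_at_imp_continuous_on ballI DERIV_isCont) (rule test_function_DERIV)

lemma test_function_deriv: "f \<in> test_functions \<Longrightarrow> deriv f \<in> test_functions"
proof -
  assume f: "f \<in> test_functions"
  have "deriv f (\<theta> + 2 * pi) = deriv f \<theta>" for \<theta>
  proof -
    have "((\<lambda>x. f (x + 2 * pi)) has_real_derivative deriv f (\<theta> + 2 * pi)) (at \<theta>)"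
      using test_function_DERIV[OF f] by (simp flip: DERIV_shift)
    moreover have "(\<lambda>x. f (x + 2 * pi)) = f" using test_function_periodic[OF f] by auto
    ultimately show ?thesis using test_function_DERIV[OF f] by (metis DERIV_unique)
  qed
  moreover have "(deriv ^^ j) (deriv f) differentiable at \<theta>" for j \<theta>
  proof -
    have "(deriv ^^ Suc j) f differentiable at \<theta>" using f unfolding test_functions_def by blast
    thus ?thesis by (simp only: funpow_Suc_right o_apply)
  qed
  ultimately show ?thesis by (simp add: test_functions_def)
qed

lemma test_function_deriv_iter: "f \<in> test_functions \<Longrightarrow> (deriv ^^ j) f \<in> test_functions"
  by (induction j) (auto simp: test_function_deriv)

lemma deriv_lincomb:
  assumes "f \<in> test_functions" "g \<in> test_functions"
  shows "deriv (\<lambda>\<theta>. a * f \<theta> + b * g \<theta>) = (\<lambda>\<theta>. a * deriv f \<theta> + b * deriv g \<theta>)"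
  by (intro ext DERIV_imp_deriv) (auto intro!: derivative_eq_intros test_function_DERIV assms)

lemma test_function_lincomb:
  assumes "f \<in> test_functions" "g \<in> test_functions"
  shows "(\<lambda>\<theta>. a * f \<theta> + b * g \<theta>) \<in> test_functions"
proof (rule test_functions_coinduct)
  let ?S = "{\<lambda>\<theta>. a * f \<theta> + b * g \<theta> | f g. f \<in> test_functions \<and> g \<in> test_functions}"
  show "(\<lambda>\<theta>. a * f \<theta> + b * g \<theta>) \<in> ?S" using assms by blast
  fix h assume "h \<in> ?S"
  then obtain f g where h: "h = (\<lambda>\<theta>. a * f \<theta> + b * g \<theta>)" and fg: "f \<in> test_functions" "g \<in> test_functions" by blast
  show "h (\<theta> + 2 * pi) = h \<theta>" for \<theta> using fg by (simp add: h test_function_periodic)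
  have "(h has_real_derivative a * deriv f \<theta> + b * deriv g \<theta>) (at \<theta>)" for \<theta>
    unfolding h using fg by (auto intro!: derivative_eq_intros test_function_DERIV)
  thus "h differentiable at \<theta>" for \<theta> using real_differentiable_def by blast
  show "deriv h \<in> ?S" unfolding h deriv_lincomb[OF fg] using fg by (blast intro: test_function_deriv)
qed

lemma deriv_iter_lincomb:
  assumes "f \<in> test_functions" "g \<in> test_functions"
  shows "(deriv ^^ j) (\<lambda>\<theta>. a * f \<theta> + b * g \<theta>) = (\<lambda>\<theta>. a * (deriv ^^ j) f \<theta> + b * (deriv ^^ j) g \<theta>)"
  by (induction j) (simp_all add: deriv_lincomb test_function_deriv_iter assms)

lemma test_function_add: "f \<in> test_functions \<Longrightarrow> g \<in> test_functions \<Longrightarrow> (\<lambda>\<theta>. f \<theta> + g \<theta>) \<in> test_functions"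
  using test_function_lincomb[of f g 1 1] by simp

lemma test_function_scale: "f \<in> test_functions \<Longrightarrow> (\<lambda>\<theta>. c * f \<theta>) \<in> test_functions"
  using test_function_lincomb[of f f c 0] by simp

lemma trig_test_function: "(\<lambda>\<theta>. a * cos (of_int k * \<theta>) + b * sin (of_int k * \<theta>)) \<in> test_functions"
proof (rule test_functions_coinduct)
  let ?S = "{(\<lambda>\<theta>. a * cos (of_int k * \<theta>) + b * sin (of_int k * \<theta>)) | a b :: real. True}"
  show "(\<lambda>\<theta>. a * cos (of_int k * \<theta>) + b * sin (of_int k * \<theta>)) \<in> ?S" by blast
  fix h assume "h \<in> ?S"
  then obtain a b where h: "h = (\<lambda>\<theta>. a * cos (of_int k * \<theta>) + b * sin (of_int k * \<theta>))" by blast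
  have D: "(h has_real_derivative (b * of_int k) * cos (of_int k * \<theta>) + (- a * of_int k) * sin (of_int k * \<theta>)) (at \<theta>)" for \<theta>
    unfolding h by (auto intro!: derivative_eq_intros)
  thus "h differentiable at \<theta>" for \<theta> using real_differentiable_def by blast
  have "deriv h = (\<lambda>\<theta>. (b * of_int k) * cos (of_int k * \<theta>) + (- a * of_int k) * sin (of_int k * \<theta>))"
    by (rule ext) (rule DERIV_imp_deriv[OF D])
  thus "deriv h \<in> ?S" by blast
  fix \<theta>
  have "of_int k * (\<theta> + 2 * pi) = of_int k * \<theta> + 2 * pi * of_int k" by (simp add: algebra_simps)
  thus "h (\<theta> + 2 * pi) = h \<theta>" by (simp add: h sin_add cos_add)
qed

lemma cos_test_function: "(\<lambda>\<theta>. cos (of_int k * \<theta>)) \<in> test_functions"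
  using trig_test_function[of 1 k 0] by simp

lemma sin_test_function: "(\<lambda>\<theta>. sin (of_int k * \<theta>)) \<in> test_functions"
  using trig_test_function[of 0 k 1] by simp

lemma const_test_function: "(\<lambda>_. c) \<in> test_functions"
  using trig_test_function[of c 0 0] by simp

lemma periodic_reduce:
  fixes f :: "real \<Rightarrow> 'a"
  assumes "\<And>\<theta>. f (\<theta> + 2 * pi) = f \<theta>"
  obtains \<theta>' where "\<theta>' \<in> {0..2 * pi}" "f \<theta> = f \<theta>'"
proof
  interpret periodic_fun_simple f "2 * pi" by standard (rule assms)
  define \<theta>' where "\<theta>' = \<theta> - of_int \<lfloor>\<theta> / (2 * pi)\<rfloor> * (2 * pi)"
  show "f \<theta> = f \<theta>'" unfolding \<theta>'_def by (rule minus_of_int[symmetric])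
  have "\<theta>' = frac (\<theta> / (2 * pi)) * (2 * pi)" by (simp add: \<theta>'_def frac_def field_simps)
  moreover have "0 \<le> frac (\<theta> / (2 * pi))" "frac (\<theta> / (2 * pi)) \<le> 1" using frac_lt_1[of "\<theta> / (2 * pi)"] by auto
  ultimately show "\<theta>' \<in> {0..2 * pi}" by simp
qed

lemma test_function_bdd: "f \<in> test_functions \<Longrightarrow> bdd_above (range (\<lambda>\<theta>. \<bar>f \<theta>\<bar>))"
proof -
  assume f: "f \<in> test_functions"
  have "compact ((\<lambda>\<theta>. \<bar>f \<theta>\<bar>) ` {0..2 * pi})"
    by (intro compact_continuous_image continuous_intros test_function_continuous f) auto
  hence "bdd_above ((\<lambda>\<theta>. \<bar>f \<theta>\<bar>) ` {0..2 * pi})" by (intro bounded_imp_bdd_above compact_imp_bounded)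
  then obtain B where B: "\<forall>\<theta>\<in>{0..2 * pi}. \<bar>f \<theta>\<bar> \<le> B" by (auto simp: bdd_above_def)
  show ?thesis
  proof (rule bdd_aboveI2)
    fix \<theta>
    obtain \<theta>' where "\<theta>' \<in> {0..2 * pi}" "f \<theta> = f \<theta>'" using periodic_reduce[of f \<theta>] test_function_periodic[OF f] by metis
    thus "\<bar>f \<theta>\<bar> \<le> B" using B by simp
  qed
qed

text \<open>
  The seminorms in the continuity estimate that is part of the definition of a distribution.
\<close>

definition sup_deriv :: "nat \<Rightarrow> (real \<Rightarrow> real) \<Rightarrow> real" where
  "sup_deriv j f = (SUP \<theta>. \<bar>(deriv ^^ j) f \<theta>\<bar>)"

lemma sup_deriv_upper: "f \<in> test_functions \<Longrightarrow> \<bar>(deriv ^^ j) f \<theta>\<bar> \<le> sup_deriv j f"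
  unfolding sup_deriv_def by (intro cSUP_upper test_function_bdd test_function_deriv_iter) auto

lemma sup_deriv_nonneg: "f \<in> test_functions \<Longrightarrow> 0 \<le> sup_deriv j f"
  using sup_deriv_upper[of f j 0] by linarith

text \<open>
  Inductive rather than as finite sums of coefficients: closure under products, antiderivatives and
  linear functionals is then checked on the generators.
\<close>

inductive_set trig_polys :: "(real \<Rightarrow> real) set" where
  trig_cos: "(\<lambda>\<theta>. cos (of_int k * \<theta>)) \<in> trig_polys"
| trig_sin: "(\<lambda>\<theta>. sin (of_int k * \<theta>)) \<in> trig_polys"
| trig_add: "p \<in> trig_polys \<Longrightarrow> q \<in> trig_polys \<Longrightarrow> (\<lambda>\<theta>. p \<theta> + q \<theta>) \<in> trig_polys"
| trig_scale: "p \<in> trig_polys \<Longrightarrow> (\<lambda>\<theta>. c * p \<theta>) \<in> trig_polys"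

lemma trig_const: "(\<lambda>_. c) \<in> trig_polys"
  using trig_scale[OF trig_cos[of 0], of c] by simp

lemma trig_test: "p \<in> trig_polys \<Longrightarrow> p \<in> test_functions"
  by (induction rule: trig_polys.induct)
     (auto intro: cos_test_function sin_test_function test_function_add test_function_scale)

lemma trig_diff: "p \<in> trig_polys \<Longrightarrow> q \<in> trig_polys \<Longrightarrow> (\<lambda>\<theta>. p \<theta> - q \<theta>) \<in> trig_polys"
  using trig_add[OF _ trig_scale[of q "-1"], of p] by simp

lemma trig_mult:
  assumes "p \<in> trig_polys" "q \<in> trig_polys"
  shows "(\<lambda>\<theta>. p \<theta> * q \<theta>) \<in> trig_polys"
proof -
  have cc: "(\<lambda>\<theta>. cos (of_int k * \<theta>) * cos (of_int l * \<theta>)) \<in> trig_polys" for k l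
  proof -
    have "(\<lambda>\<theta>. 1/2 * (cos (of_int (k - l) * \<theta>) + cos (of_int (k + l) * \<theta>))) \<in> trig_polys"
      by (intro trig_polys.intros)
    thus ?thesis by (simp add: cos_times_cos left_diff_distrib distrib_right)
  qed
  have ss: "(\<lambda>\<theta>. sin (of_int k * \<theta>) * sin (of_int l * \<theta>)) \<in> trig_polys" for k l
  proof -
    have "(\<lambda>\<theta>. 1/2 * (cos (of_int (k - l) * \<theta>) - cos (of_int (k + l) * \<theta>))) \<in> trig_polys"
      by (intro trig_polys.intros trig_diff)
    thus ?thesis by (simp add: sin_times_sin left_diff_distrib distrib_right)
  qed
  have sc: "(\<lambda>\<theta>. sin (of_int k * \<theta>) * cos (of_int l * \<theta>)) \<in> trig_polys" for k l
  proof -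
    have "(\<lambda>\<theta>. 1/2 * (sin (of_int (k + l) * \<theta>) + sin (of_int (k - l) * \<theta>))) \<in> trig_polys"
      by (intro trig_polys.intros)
    thus ?thesis by (simp add: sin_times_cos left_diff_distrib distrib_right)
  qed
  have lin: "(\<lambda>\<theta>. p \<theta> * q \<theta>) \<in> trig_polys"
    if "q \<in> trig_polys" and "\<And>k. (\<lambda>\<theta>. p \<theta> * cos (of_int k * \<theta>)) \<in> trig_polys"
      and "\<And>k. (\<lambda>\<theta>. p \<theta> * sin (of_int k * \<theta>)) \<in> trig_polys" for p q
    using that
  proof (induction rule: trig_polys.induct)
    case (trig_add q r)
    from trig_polys.trig_add[OF trig_add.IH(1)[OF trig_add.prems] trig_add.IH(2)[OF trig_add.prems]]
    show ?case by (simp add: distrib_left)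
  next
    case (trig_scale q c)
    from trig_polys.trig_scale[OF trig_scale.IH[OF trig_scale.prems], of c]
    show ?case by (simp add: mult_ac)
  qed auto
  have comm: "(\<lambda>\<theta>. p \<theta> * q \<theta>) \<in> trig_polys \<Longrightarrow> (\<lambda>\<theta>. q \<theta> * p \<theta>) \<in> trig_polys" for p q
    by (simp add: mult.commute)
  have basis: "(\<lambda>\<theta>. q \<theta> * cos (of_int k * \<theta>)) \<in> trig_polys" "(\<lambda>\<theta>. q \<theta> * sin (of_int k * \<theta>)) \<in> trig_polys"
    if q: "q \<in> trig_polys" for q k
    by (rule comm, rule lin[OF q cc], rule comm, rule sc) (rule comm, rule lin[OF q sc ss])
  show ?thesis by (rule lin[OF assms(2) basis[OF assms(1)]])
qed

lemma periodic_cis_eq: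
  fixes f :: "real \<Rightarrow> 'a"
  assumes "\<And>\<theta>. f (\<theta> + 2 * pi) = f \<theta>" "cis a = cis b"
  shows "f a = f b"
proof -
  interpret periodic_fun_simple f "2 * pi" by standard (rule assms)
  have "sin a = sin b \<and> cos a = cos b" using assms(2) by (simp add: complex_eq_iff)
  then obtain n :: int where "a = b + 2 * pi * of_int n" unfolding sin_cos_eq_iff by blast
  hence "a = b + of_int n * (2 * pi)" by simp
  thus ?thesis using plus_of_int[of b n] by simp
qed

text \<open>
  The theorem of Stone and Weierstrass on the unit circle of the complex plane, where the periodic function becomes
  \<open>z \<mapsto> f (Arg z)\<close>.
\<close>

lemma trig_approx_uniform:
  assumes per: "\<And>\<theta>. f (\<theta> + 2 * pi) = f \<theta>" and cont: "continuous_on UNIV f" and e: "e > 0"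
  shows "\<exists>p\<in>trig_polys. \<forall>\<theta>. \<bar>f \<theta> - p \<theta>\<bar> < e"
proof -
  let ?C = "sphere (0::complex) 1"
  define F where "F z = f (Arg z)" for z
  have Fcis: "F (cis \<theta>) = f \<theta>" for \<theta>
    unfolding F_def by (rule periodic_cis_eq[where f = f, OF per]) (simp add: cis_Arg)
  have C: "cis (Arg z) = z" if "z \<in> ?C" for z
    using that cis_Arg[of z] by (cases "z = 0") (auto simp: sgn_div_norm)
  have contF: "continuous_on ?C F"
    unfolding continuous_on_eq_continuous_within
  proof
    fix z0 assume z0: "z0 \<in> ?C"
    define \<theta>0 where "\<theta>0 = Arg z0"
    have z0_nz: "z0 \<noteq> 0" using z0 by auto
    \<comment> \<open>The principal argument jumps at \<open>-1\<close>. Measuring angles from \<open>z0\<close> moves the jump away from \<open>z0\<close>.\<close>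
    have F: "F z = f (\<theta>0 + Arg (z / z0))" if z: "z \<in> ?C" for z
    proof -
      have "z / z0 \<in> ?C" using z z0 by (simp add: norm_divide)
      hence "cis (\<theta>0 + Arg (z / z0)) = z0 * (z / z0)"
        unfolding cis_mult[symmetric] \<theta>0_def by (simp only: C z0)
      also have "\<dots> = cis (Arg z)" using z0_nz C[OF z] by simp
      finally show ?thesis unfolding F_def by (intro periodic_cis_eq[where f = f, OF per]) simp
    qed
    have "continuous (at z0 within ?C) (\<lambda>z. f (\<theta>0 + Arg (z / z0)))"
    proof (rule continuous_within_compose3[where g = f])
      show "isCont f (\<theta>0 + Arg (z0 / z0))" using cont by (simp add: continuous_on_eq_continuous_at)
      have "continuous (at z0 within ?C) (\<lambda>z. Arg (z / z0))"
      proof (rule continuous_within_compose3[where g = Arg])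
        show "isCont Arg (z0 / z0)" by (rule continuous_at_Arg) (use z0_nz in auto)
        show "continuous (at z0 within ?C) (\<lambda>z. z / z0)" using z0_nz by (intro continuous_intros) auto
      qed
      thus "continuous (at z0 within ?C) (\<lambda>z. \<theta>0 + Arg (z / z0))" by (intro continuous_intros)
    qed
    thus "continuous (at z0 within ?C) F"
      by (rule continuous_transform_within[where \<delta> = 1]) (use F z0 in auto)
  qed
  define R where "R = {g. continuous_on ?C g \<and> (\<exists>p\<in>trig_polys. \<forall>\<theta>. g (cis \<theta>) = p \<theta>)}"
  interpret function_ring_on R ?C
  proof
    show "compact ?C" by simp
    show "f \<in> R \<Longrightarrow> continuous_on ?C f" for f by (simp add: R_def)
    fix g h assume "g \<in> R" "h \<in> R"
    then obtain p q where pq: "p \<in> trig_polys" "q \<in> trig_polys" "\<And>\<theta>. g (cis \<theta>) = p \<theta>" "\<And>\<theta>. h (cis \<theta>) = q \<theta>"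
      and c: "continuous_on ?C g" "continuous_on ?C h" by (auto simp: R_def)
    show "(\<lambda>x. g x + h x) \<in> R" unfolding R_def
      using trig_add[OF pq(1,2)] pq c by (auto intro!: continuous_intros bexI[of _ "\<lambda>\<theta>. p \<theta> + q \<theta>"])
    show "(\<lambda>x. g x * h x) \<in> R" unfolding R_def
      using trig_mult[OF pq(1,2)] pq c by (auto intro!: continuous_intros bexI[of _ "\<lambda>\<theta>. p \<theta> * q \<theta>"])
  next
    show "(\<lambda>_. c) \<in> R" for c by (auto simp: R_def intro!: bexI[OF _ trig_const[of c]])
  next
    fix x y :: complex assume "x \<noteq> y"
    have "Re \<in> R" using trig_cos[of 1] by (auto simp: R_def intro!: continuous_intros bexI[of _ cos])
    moreover have "Im \<in> R" using trig_sin[of 1] by (auto simp: R_def intro!: continuous_intros bexI[of _ sin])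
    ultimately show "\<exists>f\<in>R. f x \<noteq> f y" using \<open>x \<noteq> y\<close> unfolding complex_eq_iff by blast
  qed
  obtain g where g: "g \<in> R" "\<And>z. z \<in> ?C \<Longrightarrow> \<bar>F z - g z\<bar> < e"
    using Stone_Weierstrass_basic[OF contF e] by blast
  then obtain p where p: "p \<in> trig_polys" "\<And>\<theta>. g (cis \<theta>) = p \<theta>" by (auto simp: R_def)
  have "\<bar>f \<theta> - p \<theta>\<bar> < e" for \<theta> using g(2)[of "cis \<theta>"] by (simp add: Fcis p)
  thus ?thesis using p(1) by blast
qed


lemma trig_antiderivative:
  "p \<in> trig_polys \<Longrightarrow> \<exists>P\<in>trig_polys. \<exists>c. \<forall>\<theta>. (P has_real_derivative p \<theta> - c) (at \<theta>)"
proof (induction rule: trig_polys.induct)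
  case (trig_cos k)
  show ?case
  proof (cases "k = 0")
    case True
    thus ?thesis by (intro bexI[OF _ trig_const[of 0]] exI[of _ 1]) auto
  next
    case False
    have "((\<lambda>\<theta>. 1 / of_int k * sin (of_int k * \<theta>)) has_real_derivative cos (of_int k * \<theta>) - 0) (at \<theta>)" for \<theta>
      using False by (auto intro!: derivative_eq_intros)
    thus ?thesis using trig_scale[OF trig_sin] by blast
  qed
next
  case (trig_sin k)
  show ?case
  proof (cases "k = 0")
    case True
    thus ?thesis by (intro bexI[OF _ trig_const[of 0]] exI[of _ 0]) auto
  next
    case False
    have "((\<lambda>\<theta>. - 1 / of_int k * cos (of_int k * \<theta>)) has_real_derivative sin (of_int k * \<theta>) - 0) (at \<theta>)" for \<theta>
      using False by (auto intro!: derivative_eq_intros)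
    thus ?thesis using trig_scale[OF trig_cos] by blast
  qed
next
  case (trig_add p q)
  then obtain P Q c d where PQ: "P \<in> trig_polys" "Q \<in> trig_polys" "\<And>\<theta>. (P has_real_derivative p \<theta> - c) (at \<theta>)" "\<And>\<theta>. (Q has_real_derivative q \<theta> - d) (at \<theta>)"
    by blast
  have "((\<lambda>\<theta>. P \<theta> + Q \<theta>) has_real_derivative (p \<theta> + q \<theta>) - (c + d)) (at \<theta>)" for \<theta>
    by (auto intro!: derivative_eq_intros PQ)
  thus ?case using trig_polys.trig_add[OF PQ(1,2)] by blast
next
  case (trig_scale p a)
  then obtain P c where P: "P \<in> trig_polys" "\<And>\<theta>. (P has_real_derivative p \<theta> - c) (at \<theta>)" by blast
  have "((\<lambda>\<theta>. a * P \<theta>) has_real_derivative a * p \<theta> - a * c) (at \<theta>)" for \<theta>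
    by (auto intro!: derivative_eq_intros P simp: algebra_simps)
  thus ?case using trig_polys.trig_scale[OF P(1)] by blast
qed

lemma deriv_iter_const: "(deriv ^^ j) (\<lambda>_ :: real. c :: real) = (\<lambda>_. if j = 0 then c else 0)"
  by (induction j) auto

text \<open>
  Induction on \<open>N\<close>: approximate the derivative together with its first \<open>N\<close> derivatives and integrate. The mean
  \<open>c\<close> of the approximation of \<open>deriv f\<close> has to be removed before integrating; it is small since \<open>deriv f\<close> has mean
  zero.
\<close>

lemma trig_approx_smooth:
  assumes "f \<in> test_functions" "e > 0"
  shows "\<exists>p\<in>trig_polys. \<forall>j\<le>N. \<forall>\<theta>. \<bar>(deriv ^^ j) f \<theta> - (deriv ^^ j) p \<theta>\<bar> \<le> e"
  using assms
proof (induction N arbitrary: f e)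
  case 0
  from trig_approx_uniform[OF test_function_periodic[OF 0(1)] test_function_continuous[OF 0(1)] 0(2)]
  show ?case by (auto intro: less_imp_le)
next
  case (Suc N)
  \<comment> \<open>The factor \<open>16\<close> accounts for the length \<open>2 \<pi> \<le> 8\<close> of the period and for \<open>\<bar>c\<bar> \<le> e'\<close>.\<close>
  define e' where "e' = e / 16"
  have e': "e' > 0" using Suc.prems by (simp add: e'_def)
  from Suc.IH[OF test_function_deriv[OF Suc.prems(1)] e'] obtain p where p: "p \<in> trig_polys"
    "\<And>j \<theta>. j \<le> N \<Longrightarrow> \<bar>(deriv ^^ j) (deriv f) \<theta> - (deriv ^^ j) p \<theta>\<bar> \<le> e'" by blast
  from trig_antiderivative[OF p(1)] obtain P c where P: "P \<in> trig_polys" "\<And>\<theta>. (P has_real_derivative p \<theta> - c) (at \<theta>)" by blast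
  define g where "g \<theta> = f \<theta> - P \<theta>" for \<theta>
  have g': "(g has_real_derivative deriv f \<theta> - p \<theta> + c) (at \<theta>)" for \<theta>
    unfolding g_def[abs_def] by (auto intro!: derivative_eq_intros P test_function_DERIV Suc.prems)
  have per: "g (\<theta> + 2 * pi) = g \<theta>" for \<theta>
    unfolding g_def by (simp add: test_function_periodic[OF Suc.prems(1)] test_function_periodic[OF trig_test[OF P(1)]])
  have close: "\<bar>deriv f \<theta> - p \<theta>\<bar> \<le> e'" for \<theta> using p(2)[of 0] by simp
  have c: "\<bar>c\<bar> \<le> e'"
  proof -
    \<comment> \<open>By periodicity the mean value theorem yields a zero of the derivative of \<open>g\<close>.\<close>
    obtain \<xi> where "g (2 * pi) - g 0 = (2 * pi - 0) * (deriv f \<xi> - p \<xi> + c)"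
      using MVT2[of 0 "2 * pi" g "\<lambda>\<theta>. deriv f \<theta> - p \<theta> + c"] g' by auto
    hence "c = p \<xi> - deriv f \<xi>" using per[of 0] by simp
    thus ?thesis using close[of \<xi>] by simp
  qed
  define R where "R \<theta> = P \<theta> + (f 0 - P 0)" for \<theta>
  have R: "R \<in> trig_polys" unfolding R_def[abs_def] by (intro trig_add P trig_const)
  have "deriv R = (\<lambda>\<theta>. p \<theta> - c)"
    unfolding R_def[abs_def] by (intro ext DERIV_imp_deriv) (auto intro!: derivative_eq_intros P)
  hence dR: "deriv R = (\<lambda>\<theta>. 1 * p \<theta> + (- 1) * (\<lambda>_. c) \<theta>)" by simp
  have "\<bar>(deriv ^^ j) f \<theta> - (deriv ^^ j) R \<theta>\<bar> \<le> e" if "j \<le> Suc N" for j \<theta>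
  proof (cases j)
    case 0
    have "\<bar>f \<theta> - R \<theta>\<bar> \<le> e" if \<theta>: "\<theta> \<in> {0..2 * pi}" for \<theta>
    proof (cases "\<theta> = 0")
      case False
      then obtain \<xi> where "g \<theta> - g 0 = (\<theta> - 0) * (deriv f \<xi> - p \<xi> + c)"
        using MVT2[of 0 \<theta> g "\<lambda>\<theta>. deriv f \<theta> - p \<theta> + c"] g' \<theta> by auto
      moreover have "f \<theta> - R \<theta> = g \<theta> - g 0" by (simp add: g_def R_def)
      ultimately have "\<bar>f \<theta> - R \<theta>\<bar> = \<bar>\<theta>\<bar> * \<bar>deriv f \<xi> - p \<xi> + c\<bar>" by (simp add: abs_mult)
      also have "\<dots> \<le> 8 * (2 * e')"
        using \<theta> pi_less_4 close[of \<xi>] c by (intro mult_mono) auto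
      finally show ?thesis by (simp add: e'_def)
    qed (use Suc.prems in \<open>simp add: R_def\<close>)
    moreover have "(\<lambda>\<theta>. \<bar>f \<theta> - R \<theta>\<bar>) (\<theta> + 2 * pi) = (\<lambda>\<theta>. \<bar>f \<theta> - R \<theta>\<bar>) \<theta>" for \<theta>
      by (simp add: test_function_periodic[OF Suc.prems(1)] test_function_periodic[OF trig_test[OF R]])
    ultimately have "\<bar>f \<theta> - R \<theta>\<bar> \<le> e"
      using periodic_reduce[of "\<lambda>\<theta>. \<bar>f \<theta> - R \<theta>\<bar>" \<theta>] by metis
    thus ?thesis using 0 by simp
  next
    case (Suc i)
    have "(deriv ^^ j) R \<theta> = (deriv ^^ i) p \<theta> - (if i = 0 then c else 0)"
      unfolding Suc funpow_Suc_right o_apply dR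
      by (subst deriv_iter_lincomb) (simp_all add: trig_test p const_test_function deriv_iter_const)
    moreover have "(deriv ^^ j) f \<theta> = (deriv ^^ i) (deriv f) \<theta>"
      unfolding Suc funpow_Suc_right o_apply ..
    ultimately have "\<bar>(deriv ^^ j) f \<theta> - (deriv ^^ j) R \<theta>\<bar> \<le> e' + \<bar>c\<bar>"
      using p(2)[of i \<theta>] that Suc by (auto split: if_splits)
    also have "\<dots> \<le> e" using c e' by (simp add: e'_def)
    finally show ?thesis .
  qed
  thus ?case using R by blast
qed

section \<open>The Sobolev metric\<close>

lemma distribution_add: "u \<in> distributions \<Longrightarrow> f \<in> test_functions \<Longrightarrow> g \<in> test_functions \<Longrightarrow> u (\<lambda>\<theta>. f \<theta> + g \<theta>) = u f + u g"
  by (simp add: distributions_def)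

lemma distribution_scale: "u \<in> distributions \<Longrightarrow> f \<in> test_functions \<Longrightarrow> u (\<lambda>\<theta>. c * f \<theta>) = c * u f"
  by (simp add: distributions_def)

lemma distribution_diff: "u \<in> distributions \<Longrightarrow> f \<in> test_functions \<Longrightarrow> g \<in> test_functions \<Longrightarrow> u (\<lambda>\<theta>. f \<theta> - g \<theta>) = u f - u g"
  using distribution_add[of u f "\<lambda>\<theta>. -1 * g \<theta>"] distribution_scale[of u g "-1"] test_function_scale[of g "-1"] by simp

lemma distribution_bound:
  assumes "u \<in> distributions"
  obtains C N where "C \<ge> 0" "\<And>f. f \<in> test_functions \<Longrightarrow> \<bar>u f\<bar> \<le> C * (\<Sum>j\<le>N. sup_deriv j f)"
proof -
  obtain C N where C: "\<And>f. f \<in> test_functions \<Longrightarrow> \<bar>u f\<bar> \<le> C * (\<Sum>j\<le>N. sup_deriv j f)"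
    using assms unfolding distributions_def sup_deriv_def by blast
  have "\<bar>u f\<bar> \<le> \<bar>C\<bar> * (\<Sum>j\<le>N. sup_deriv j f)" if "f \<in> test_functions" for f
    by (rule order_trans[OF C[OF that] mult_right_mono]) (auto intro!: sum_nonneg sup_deriv_nonneg that)
  thus ?thesis using that[of "\<bar>C\<bar>" N] by simp
qed

text \<open>
  Both functionals agree on trigonometric polynomials, which are dense for the finitely many seminorms that
  control them.
\<close>

lemma distribution_eqI:
  assumes u: "u \<in> distributions" and v: "v \<in> distributions"
    and c: "\<And>k::int. u (\<lambda>\<theta>. cos (of_int k * \<theta>)) = v (\<lambda>\<theta>. cos (of_int k * \<theta>))"
    and s: "\<And>k::int. u (\<lambda>\<theta>. sin (of_int k * \<theta>)) = v (\<lambda>\<theta>. sin (of_int k * \<theta>))"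
  shows "u = v"
proof (rule extensionalityI[of u test_functions])
  show "u \<in> extensional test_functions" "v \<in> extensional test_functions" using u v by (auto simp: distributions_def)
  have trig: "u p = v p" if "p \<in> trig_polys" for p
    using that by (induction rule: trig_polys.induct)
      (simp_all add: c s distribution_add[OF u] distribution_add[OF v] distribution_scale[OF u] distribution_scale[OF v] trig_test)
  obtain C N where C: "C \<ge> 0" "\<And>f. f \<in> test_functions \<Longrightarrow> \<bar>u f\<bar> \<le> C * (\<Sum>j\<le>N. sup_deriv j f)"
    using distribution_bound[OF u] by blast
  obtain C' N' where C': "C' \<ge> 0" "\<And>f. f \<in> test_functions \<Longrightarrow> \<bar>v f\<bar> \<le> C' * (\<Sum>j\<le>N'. sup_deriv j f)"
    using distribution_bound[OF v] by blast
  fix f assume f: "f \<in> test_functions"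
  define K where "K = C * real (Suc N) + C' * real (Suc N')"
  have K: "K \<ge> 0" using C(1) C'(1) by (simp add: K_def)
  have "\<bar>u f - v f\<bar> \<le> 0 + e" if e: "e > 0" for e
  proof -
    define e1 where "e1 = e / (K + 1)"
    have e1: "e1 > 0" using e K by (simp add: e1_def)
    obtain p where p: "p \<in> trig_polys" "\<And>j \<theta>. j \<le> max N N' \<Longrightarrow> \<bar>(deriv ^^ j) f \<theta> - (deriv ^^ j) p \<theta>\<bar> \<le> e1"
      using trig_approx_smooth[OF f e1, of "max N N'"] by blast
    define h where "h \<theta> = f \<theta> - p \<theta>" for \<theta>
    have h': "h = (\<lambda>\<theta>. 1 * f \<theta> + (-1) * p \<theta>)" by (simp add: h_def fun_eq_iff)
    have h: "h \<in> test_functions" unfolding h' by (intro test_function_lincomb f trig_test p)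
    have sup: "sup_deriv j h \<le> e1" if "j \<le> max N N'" for j
      unfolding sup_deriv_def h' deriv_iter_lincomb[OF f trig_test[OF p(1)]]
      by (rule cSUP_least) (use p(2)[OF that] in auto)
    have "(\<Sum>j\<le>N. sup_deriv j h) \<le> real (Suc N) * e1" "(\<Sum>j\<le>N'. sup_deriv j h) \<le> real (Suc N') * e1"
      using sum_bounded_above[of "{..N}" "\<lambda>j. sup_deriv j h" e1] sum_bounded_above[of "{..N'}" "\<lambda>j. sup_deriv j h" e1] sup
      by auto
    hence "\<bar>u h\<bar> \<le> C * (real (Suc N) * e1)" "\<bar>v h\<bar> \<le> C' * (real (Suc N') * e1)"
      using order_trans[OF C(2)[OF h] mult_left_mono[OF _ C(1)]] order_trans[OF C'(2)[OF h] mult_left_mono[OF _ C'(1)]] by blast+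
    moreover have "u f - v f = u h - v h"
      unfolding h_def[abs_def] by (simp add: distribution_diff[OF u f trig_test[OF p(1)]] distribution_diff[OF v f trig_test[OF p(1)]] trig[OF p(1)])
    ultimately have "\<bar>u f - v f\<bar> \<le> K * e1" by (simp add: K_def algebra_simps)
    also have "\<dots> \<le> (K + 1) * e1" using e1 by (intro mult_right_mono) auto
    also have "\<dots> = e" using K by (simp add: e1_def)
    finally show ?thesis by simp
  qed
  hence "\<bar>u f - v f\<bar> \<le> 0" by (rule field_le_epsilon)
  thus "u f = v f" by simp
qed

lemma fourier_coeff_diff:
  "fourier_coeff (\<lambda>f\<in>test_functions. u f - v f) k = fourier_coeff u k - fourier_coeff v k"
  by (simp add: fourier_coeff_def cos_test_function sin_test_function complex_eq_iff diff_divide_distrib)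

definition sobolev_weight :: "real \<Rightarrow> int \<Rightarrow> real" where
  "sobolev_weight s k = (1 + (of_int k)\<^sup>2) powr s"

lemma sobolev_weight_pos: "sobolev_weight s k > 0"
proof -
  have "(1 :: real) + (of_int k)\<^sup>2 > 0" by (intro add_pos_nonneg) auto
  thus ?thesis by (simp add: sobolev_weight_def)
qed

definition weighted_summable :: "real \<Rightarrow> (int \<Rightarrow> complex) \<Rightarrow> bool" where
  "weighted_summable s a \<longleftrightarrow> (\<lambda>k. sobolev_weight s k * (cmod (a k))\<^sup>2) summable_on UNIV"

text \<open>
  The Sobolev norm as a norm on families of Fourier coefficients, where it is a weighted \<open>\<ell>\<^sup>2\<close> norm; the triangle
  inequality comes from finite sums.
\<close>

definition weighted_norm :: "real \<Rightarrow> (int \<Rightarrow> complex) \<Rightarrow> real" where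
  "weighted_norm s a = sqrt (\<Sum>\<^sub>\<infinity>k. sobolev_weight s k * (cmod (a k))\<^sup>2)"

lemma weighted_norm_nonneg: "weighted_norm s a \<ge> 0"
  unfolding weighted_norm_def by (intro real_sqrt_ge_zero infsum_nonneg mult_nonneg_nonneg) (auto simp: less_imp_le[OF sobolev_weight_pos])

lemma weighted_norm_finite_sum:
  assumes "weighted_summable s a" "finite A"
  shows "L2_set (\<lambda>k. sqrt (sobolev_weight s k) * cmod (a k)) A \<le> weighted_norm s a"
proof -
  have "(\<Sum>k\<in>A. sobolev_weight s k * (cmod (a k))\<^sup>2) \<le> (\<Sum>\<^sub>\<infinity>k. sobolev_weight s k * (cmod (a k))\<^sup>2)"
    using assms by (intro finite_sum_le_infsum) (auto simp: weighted_summable_def less_imp_le[OF sobolev_weight_pos])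
  thus ?thesis unfolding L2_set_def weighted_norm_def
    by (simp add: power_mult_distrib less_imp_le[OF sobolev_weight_pos])
qed

lemma weighted_norm_leI:
  assumes "\<And>A. finite A \<Longrightarrow> L2_set (\<lambda>k. sqrt (sobolev_weight s k) * cmod (a k)) A \<le> B"
  shows "weighted_summable s a" "weighted_norm s a \<le> B"
proof -
  have B: "B \<ge> 0" using assms[of "{}"] by simp
  have *: "(\<Sum>k\<in>A. sobolev_weight s k * (cmod (a k))\<^sup>2) \<le> B\<^sup>2" if "finite A" for A
  proof -
    have "L2_set (\<lambda>k. sqrt (sobolev_weight s k) * cmod (a k)) A = sqrt (\<Sum>k\<in>A. sobolev_weight s k * (cmod (a k))\<^sup>2)"
      unfolding L2_set_def by (simp add: power_mult_distrib less_imp_le[OF sobolev_weight_pos])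
    thus ?thesis using assms[OF that] sqrt_le_D by simp
  qed
  show ws: "weighted_summable s a" unfolding weighted_summable_def
    by (intro nonneg_bdd_above_summable_on bdd_aboveI2[of _ _ "B\<^sup>2"]) (use * in \<open>auto simp: less_imp_le[OF sobolev_weight_pos]\<close>)
  hence "(\<Sum>\<^sub>\<infinity>k. sobolev_weight s k * (cmod (a k))\<^sup>2) \<le> B\<^sup>2"
    unfolding weighted_summable_def by (rule infsum_le_finite_sums) (use * in auto)
  thus "weighted_norm s a \<le> B" unfolding weighted_norm_def using B by (intro real_le_lsqrt) auto
qed

lemma weighted_norm_add:
  assumes "weighted_summable s a" "weighted_summable s b"
  shows "weighted_summable s (\<lambda>k. a k + b k)" "weighted_norm s (\<lambda>k. a k + b k) \<le> weighted_norm s a + weighted_norm s b"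
proof -
  have "L2_set (\<lambda>k. sqrt (sobolev_weight s k) * cmod (a k + b k)) A \<le> weighted_norm s a + weighted_norm s b" if A: "finite A" for A
  proof -
    have "L2_set (\<lambda>k. sqrt (sobolev_weight s k) * cmod (a k + b k)) A
        \<le> L2_set (\<lambda>k. sqrt (sobolev_weight s k) * cmod (a k) + sqrt (sobolev_weight s k) * cmod (b k)) A"
      unfolding distrib_left[symmetric]
      by (intro L2_set_mono mult_left_mono norm_triangle_ineq mult_nonneg_nonneg) (auto simp: less_imp_le[OF sobolev_weight_pos])
    also have "\<dots> \<le> L2_set (\<lambda>k. sqrt (sobolev_weight s k) * cmod (a k)) A + L2_set (\<lambda>k. sqrt (sobolev_weight s k) * cmod (b k)) A"
      by (rule L2_set_triangle_ineq)
    finally show ?thesis using weighted_norm_finite_sum[OF assms(1) A] weighted_norm_finite_sum[OF assms(2) A] by linarith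
  qed
  from weighted_norm_leI[OF this]
  show "weighted_summable s (\<lambda>k. a k + b k)" "weighted_norm s (\<lambda>k. a k + b k) \<le> weighted_norm s a + weighted_norm s b" by auto
qed

lemma weighted_uminus: "weighted_summable s (\<lambda>k. - a k) = weighted_summable s a" "weighted_norm s (\<lambda>k. - a k) = weighted_norm s a"
  by (simp_all add: weighted_summable_def weighted_norm_def)

lemma weighted_summable_diff: "weighted_summable s a \<Longrightarrow> weighted_summable s b \<Longrightarrow> weighted_summable s (\<lambda>k. a k - b k)"
  using weighted_norm_add(1)[of s a "\<lambda>k. - b k"] by (simp add: weighted_uminus)

lemma sobolev_dist_eq: "sobolev_dist s u v = weighted_norm s (\<lambda>k. fourier_coeff u k - fourier_coeff v k)"
  by (simp add: sobolev_dist_def sobolev_norm_def weighted_norm_def fourier_coeff_diff sobolev_weight_def)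

lemma sobolev_space_iff: "u \<in> sobolev_space s \<longleftrightarrow> u \<in> distributions \<and> weighted_summable s (fourier_coeff u)"
  by (simp add: sobolev_space_def weighted_summable_def sobolev_weight_def)

lemma sobolev_space0_iff: "u \<in> sobolev_space0 s \<longleftrightarrow> u \<in> distributions \<and> weighted_summable s (fourier_coeff u) \<and> fourier_coeff u 0 = 0"
proof (cases "u \<in> distributions")
  case True
  have "u (\<lambda>_. 0) = 0" using distribution_scale[OF True const_test_function, of 0 0] by simp
  thus ?thesis using True by (auto simp: sobolev_space0_def sobolev_space_iff fourier_coeff_def complex_eq_iff)
qed (auto simp: sobolev_space0_def sobolev_space_iff)

lemma fourier_coeff_eqI:
  assumes "u \<in> distributions" "v \<in> distributions" "\<And>k. fourier_coeff u k = fourier_coeff v k"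
  shows "u = v"
  using assms(3) by (intro distribution_eqI assms) (simp_all add: fourier_coeff_def complex_eq_iff)

text \<open>
  Distinct points have positive distance because a distribution is determined by its Fourier coefficients.
\<close>

lemma Metric_space_sobolev: "Metric_space (sobolev_space0 s) (sobolev_dist s)"
proof
  show "0 \<le> sobolev_dist s u v" for u v by (simp add: sobolev_dist_eq weighted_norm_nonneg)
  show "sobolev_dist s u v = sobolev_dist s v u" for u v
    using weighted_uminus(2)[of s "\<lambda>k. fourier_coeff u k - fourier_coeff v k"] by (simp add: sobolev_dist_eq)
  fix u v assume u: "u \<in> sobolev_space0 s" and v: "v \<in> sobolev_space0 s"
  show "sobolev_dist s u v = 0 \<longleftrightarrow> u = v"
  proof
    assume "sobolev_dist s u v = 0"
    moreover have "weighted_summable s (\<lambda>k. fourier_coeff u k - fourier_coeff v k)"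
      using u v by (auto simp: sobolev_space0_iff intro: weighted_summable_diff)
    ultimately have "sobolev_weight s k * (cmod (fourier_coeff u k - fourier_coeff v k))\<^sup>2 = 0" for k
      unfolding sobolev_dist_eq weighted_norm_def weighted_summable_def real_sqrt_eq_zero_cancel_iff
      by (intro nonneg_infsum_le_0D[where A = UNIV and f = "\<lambda>k. sobolev_weight s k * (cmod (fourier_coeff u k - fourier_coeff v k))\<^sup>2"])
         (auto simp: less_imp_le[OF sobolev_weight_pos])
    hence "fourier_coeff u k = fourier_coeff v k" for k using sobolev_weight_pos[of s k] by (metis eq_iff_diff_eq_0 less_irrefl mult_eq_0_iff norm_eq_zero power_eq_0_iff)
    thus "u = v" using u v by (intro fourier_coeff_eqI) (auto simp: sobolev_space0_iff)
  qed (simp add: sobolev_dist_eq weighted_norm_def)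
  fix w assume w: "w \<in> sobolev_space0 s"
  show "sobolev_dist s u w \<le> sobolev_dist s u v + sobolev_dist s v w"
    using weighted_norm_add(2)[of s "\<lambda>k. fourier_coeff u k - fourier_coeff v k" "\<lambda>k. fourier_coeff v k - fourier_coeff w k"] u v w
    by (simp add: sobolev_dist_eq sobolev_space0_iff weighted_summable_diff)
qed


section \<open>Fourier coefficients of the partial sums\<close>

lemma function_distribution_in_distributions:
  assumes g: "continuous_on UNIV g"
  shows "function_distribution g \<in> distributions"
proof -
  have cont: "continuous_on {0..2 * pi} (\<lambda>\<theta>. g \<theta> * f \<theta>)" if "f \<in> test_functions" for f
    by (intro continuous_intros continuous_on_subset[OF g] test_function_continuous that) auto
  hence int: "(\<lambda>\<theta>. g \<theta> * f \<theta>) integrable_on {0..2 * pi}" if "f \<in> test_functions" for f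
    using that by (intro integrable_continuous_interval)
  have "compact (g ` {0..2 * pi})" by (intro compact_continuous_image continuous_on_subset[OF g]) auto
  hence "bounded (g ` {0..2 * pi})" by (rule compact_imp_bounded)
  then obtain B where "\<forall>y\<in>g ` {0..2 * pi}. \<bar>y\<bar> \<le> B" unfolding bounded_iff real_norm_def by blast
  hence B: "\<And>\<theta>. \<theta> \<in> {0..2 * pi} \<Longrightarrow> \<bar>g \<theta>\<bar> \<le> B" by blast
  have B0: "B \<ge> 0" using B[of 0] by auto
  have bound: "\<bar>integral {0..2 * pi} (\<lambda>\<theta>. g \<theta> * f \<theta>)\<bar> \<le> 2 * pi * B * (\<Sum>j\<le>0. sup_deriv j f)" if f: "f \<in> test_functions" for f
  proof -
    have "norm (integral {0..2 * pi} (\<lambda>\<theta>. g \<theta> * f \<theta>)) \<le> (B * sup_deriv 0 f) * (2 * pi - 0)"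
    proof (rule integral_bound)
      show "norm (g \<theta> * f \<theta>) \<le> B * sup_deriv 0 f" if "\<theta> \<in> {0..2 * pi}" for \<theta>
        unfolding real_norm_def abs_mult using B[OF that] sup_deriv_upper[OF f, of 0 \<theta>] B0 by (intro mult_mono) auto
    qed (use cont f in auto)
    thus ?thesis by (simp add: mult_ac)
  qed
  have "function_distribution g (\<lambda>\<theta>. f \<theta> + h \<theta>) = function_distribution g f + function_distribution g h"
    if "f \<in> test_functions" "h \<in> test_functions" for f h
    using that int by (simp add: function_distribution_def test_function_add distrib_left Henstock_Kurzweil_Integration.integral_add)
  moreover have "function_distribution g (\<lambda>\<theta>. c * f \<theta>) = c * function_distribution g f" if "f \<in> test_functions" for c f
  proof -
    have "(\<lambda>\<theta>. g \<theta> * (c * f \<theta>)) = (\<lambda>\<theta>. c * (g \<theta> * f \<theta>))" by (simp add: mult_ac)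
    thus ?thesis using that by (simp add: function_distribution_def test_function_scale)
  qed
  moreover have "\<exists>C N. \<forall>f\<in>test_functions. \<bar>function_distribution g f\<bar> \<le> C * (\<Sum>j\<le>N. SUP \<theta>. \<bar>(deriv ^^ j) f \<theta>\<bar>)"
    by (intro exI[of _ "2 * pi * B"] exI[of _ 0] ballI, unfold sup_deriv_def[symmetric])
       (use bound in \<open>simp add: function_distribution_def\<close>)
  ultimately show ?thesis by (simp add: distributions_def function_distribution_def)
qed

lemma has_integral_cis:
  "((\<lambda>\<theta>. cis (of_int j * \<theta>)) has_integral (if j = 0 then 2 * of_real pi else 0)) {0..2 * pi}"
proof (cases "j = 0")
  case True
  have "((\<lambda>_. 1 :: complex) has_integral (2 * pi - 0) *\<^sub>R 1) {0..2 * pi}"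
    using has_integral_const_real[of "1 :: complex" 0 "2 * pi"] by simp
  thus ?thesis using True by (simp add: scaleR_conv_of_real)
next
  case False
  define F where "F \<theta> = exp (\<i> * of_real (of_int j * \<theta>)) / (\<i> * of_int j)" for \<theta> :: real
  have "(F has_vector_derivative cis (of_int j * \<theta>)) (at \<theta> within {0..2 * pi})" for \<theta>
  proof -
    have "((\<lambda>z. exp (\<i> * (of_int j * z)) / (\<i> * of_int j)) has_field_derivative exp (\<i> * (of_int j * of_real \<theta>))) (at (of_real \<theta>))"
      using False by (auto intro!: derivative_eq_intros simp: mult_ac)
    from has_vector_derivative_real_field[OF this, of "{0..2 * pi}"] show ?thesis
      by (simp add: F_def[abs_def] cis_conv_exp)
  qed
  hence "((\<lambda>\<theta>. cis (of_int j * \<theta>)) has_integral F (2 * pi) - F 0) {0..2 * pi}"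
    by (intro fundamental_theorem_of_calculus) auto
  moreover have "F (2 * pi) = F 0"
  proof -
    have "exp (\<i> * of_real (of_int j * (2 * pi))) = 1"
      using exp_integer_2pi[of "of_int j"] by (simp add: mult_ac)
    thus ?thesis by (simp add: F_def)
  qed
  ultimately show ?thesis using False by simp
qed

text \<open>
  The Fourier coefficients of the field \<open>2 Re (\<Sum> \<phi>\<^sub>m z\<^sup>m)\<close>.
\<close>

definition mode_coeff :: "(nat \<Rightarrow> complex) \<Rightarrow> int \<Rightarrow> complex" where
  "mode_coeff \<phi> k = (if k > 0 then \<phi> (nat k) else if k < 0 then cnj (\<phi> (nat (- k))) else 0)"

lemma fourier_coeff_partial_sum:
  "fourier_coeff (field_partial_sum \<phi> N) k = (if \<bar>k\<bar> \<le> int N then mode_coeff \<phi> k else 0)"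
proof -
  define g where "g \<theta> = 2 * Re (\<Sum>m=1..N. \<phi> m * cis \<theta> ^ m)" for \<theta>
  have g: "complex_of_real (g \<theta>) = (\<Sum>m=1..N. \<phi> m * cis (of_int (int m) * \<theta>) + cnj (\<phi> m) * cis (of_int (- int m) * \<theta>))" for \<theta>
  proof -
    have "complex_of_real (g \<theta>) = (\<Sum>m=1..N. \<phi> m * cis \<theta> ^ m) + cnj (\<Sum>m=1..N. \<phi> m * cis \<theta> ^ m)"
      by (simp only: g_def complex_add_cnj)
    also have "\<dots> = (\<Sum>m=1..N. \<phi> m * cis (of_int (int m) * \<theta>) + cnj (\<phi> m) * cis (of_int (- int m) * \<theta>))"
      by (simp add: sum.distrib Complex.DeMoivre cis_cnj)
    finally show ?thesis .
  qed
  define c where "c m = \<phi> m * (if int m - k = 0 then 2 * of_real pi else 0) + cnj (\<phi> m) * (if - int m - k = 0 then 2 * of_real pi else 0)" for m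
  have "((\<lambda>\<theta>. \<Sum>m=1..N. \<phi> m * cis (of_int (int m - k) * \<theta>) + cnj (\<phi> m) * cis (of_int (- int m - k) * \<theta>)) has_integral sum c {1..N}) {0..2 * pi}"
    unfolding c_def by (intro has_integral_sum has_integral_add has_integral_mult_right has_integral_cis) auto
  also have "(\<lambda>\<theta>. \<Sum>m=1..N. \<phi> m * cis (of_int (int m - k) * \<theta>) + cnj (\<phi> m) * cis (of_int (- int m - k) * \<theta>)) = (\<lambda>\<theta>. of_real (g \<theta>) * cis (- of_int k * \<theta>))"
    unfolding g sum_distrib_right
    by (intro ext sum.cong refl) (simp add: distrib_right mult.assoc cis_mult left_diff_distrib)
  finally have int: "((\<lambda>\<theta>. of_real (g \<theta>) * cis (- of_int k * \<theta>)) has_integral sum c {1..N}) {0..2 * pi}" .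
  have "((\<lambda>\<theta>. g \<theta> * cos (of_int k * \<theta>)) has_integral Re (sum c {1..N})) {0..2 * pi}"
    using has_integral_linear[OF int bounded_linear_Re] by (simp add: o_def)
  moreover have "((\<lambda>\<theta>. g \<theta> * sin (of_int k * \<theta>)) has_integral - Im (sum c {1..N})) {0..2 * pi}"
    using has_integral_neg[OF has_integral_linear[OF int bounded_linear_Im]] by (simp add: o_def)
  moreover have "field_partial_sum \<phi> N f = integral {0..2 * pi} (\<lambda>\<theta>. g \<theta> * f \<theta>)" if "f \<in> test_functions" for f
    using that by (simp only: field_partial_sum_def function_distribution_def g_def restrict_apply')
  ultimately have "field_partial_sum \<phi> N (\<lambda>\<theta>. cos (of_int k * \<theta>)) = Re (sum c {1..N})"
    "field_partial_sum \<phi> N (\<lambda>\<theta>. sin (of_int k * \<theta>)) = - Im (sum c {1..N})"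
    using cos_test_function sin_test_function integral_unique by metis+
  hence fc: "fourier_coeff (field_partial_sum \<phi> N) k = sum c {1..N} / (2 * pi)"
    by (simp only: fourier_coeff_def minus_minus complex_surj)
  have "sum c {1..N} = 2 * of_real pi * (if \<bar>k\<bar> \<le> int N then mode_coeff \<phi> k else 0)"
  proof -
    have "sum c {1..N} = (\<Sum>m=1..N. if m = nat k \<and> k > 0 then 2 * of_real pi * \<phi> m else 0) + (\<Sum>m=1..N. if m = nat (- k) \<and> k < 0 then 2 * of_real pi * cnj (\<phi> m) else 0)"
      unfolding c_def sum.distrib by (intro arg_cong2[where f = "(+)"] sum.cong refl) auto
    also have "\<dots> = 2 * of_real pi * (if \<bar>k\<bar> \<le> int N then mode_coeff \<phi> k else 0)"
    proof -
      consider "k > 0" | "k < 0" | "k = 0" by linarith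
      thus ?thesis
      proof cases
        case 1
        thus ?thesis by (auto simp: mode_coeff_def)
      next
        case 2
        thus ?thesis by (auto simp: mode_coeff_def)
      qed (simp add: mode_coeff_def)
    qed
    finally show ?thesis .
  qed
  thus ?thesis unfolding fc by simp
qed

lemma continuous_partial_sum: "continuous_on UNIV (\<lambda>\<theta>. 2 * Re (\<Sum>m=1..N. \<phi> m * cis \<theta> ^ m))"
  by (intro continuous_intros continuous_on_cis continuous_on_id)

lemma partial_sum_in_distributions: "field_partial_sum \<phi> N \<in> distributions"
  unfolding field_partial_sum_def by (intro function_distribution_in_distributions continuous_partial_sum)

lemma weighted_summable_finite_support:
  assumes "finite A" "\<And>k. k \<notin> A \<Longrightarrow> a k = 0"
  shows "weighted_summable s a"
proof -
  have "(\<lambda>k. sobolev_weight s k * (cmod (a k))\<^sup>2) summable_on A" using assms(1) by (rule summable_on_finite)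
  thus ?thesis unfolding weighted_summable_def
    by (rule summable_on_cong_neutral[THEN iffD1, rotated -1]) (use assms(2) in auto)
qed

lemma partial_sum_in_sobolev_space0: "field_partial_sum \<phi> N \<in> sobolev_space0 s"
  unfolding sobolev_space0_iff
proof (intro conjI partial_sum_in_distributions)
  show "weighted_summable s (fourier_coeff (field_partial_sum \<phi> N))"
    by (rule weighted_summable_finite_support[of "{- int N..int N}"]) (auto simp: fourier_coeff_partial_sum)
qed (simp add: fourier_coeff_partial_sum mode_coeff_def)

definition mode_integral :: "nat \<Rightarrow> (real \<Rightarrow> real) \<Rightarrow> complex" where
  "mode_integral m f = integral {0..2 * pi} (\<lambda>\<theta>. cis (real m * \<theta>) * of_real (f \<theta>))"

lemma mode_integral_has_integral:
  assumes "f \<in> test_functions"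
  shows "((\<lambda>\<theta>. cis (real m * \<theta>) * of_real (f \<theta>)) has_integral mode_integral m f) {0..2 * pi}"
  unfolding mode_integral_def
  by (intro integrable_integral integrable_continuous_interval continuous_intros continuous_on_cis continuous_on_of_real test_function_continuous assms)

text \<open>
  Integration by parts; the boundary terms cancel by periodicity.
\<close>

lemma mode_integral_deriv:
  assumes "f \<in> test_functions"
  shows "of_nat m * mode_integral m f = \<i> * mode_integral m (deriv f)"
proof -
  have "((\<lambda>\<theta>. cis (real m * \<theta>) * of_real (f \<theta>)) has_vector_derivative
        \<i> * of_nat m * (cis (real m * \<theta>) * of_real (f \<theta>)) + cis (real m * \<theta>) * of_real (deriv f \<theta>)) (at \<theta> within {0..2 * pi})" for \<theta>
  proof -
    have "((\<lambda>z. exp (\<i> * (of_nat m * z))) has_field_derivative \<i> * of_nat m * exp (\<i> * (of_nat m * of_real \<theta>))) (at (of_real \<theta>))"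
      by (auto intro!: derivative_eq_intros)
    from has_vector_derivative_real_field[OF this, of "{0..2 * pi}"]
    have 1: "((\<lambda>\<theta>. cis (real m * \<theta>)) has_vector_derivative \<i> * of_nat m * cis (real m * \<theta>)) (at \<theta> within {0..2 * pi})"
      by (simp add: cis_conv_exp)
    have 2: "((\<lambda>\<theta>. complex_of_real (f \<theta>)) has_vector_derivative of_real (deriv f \<theta>)) (at \<theta> within {0..2 * pi})"
      by (rule has_vector_derivative_of_real, rule has_field_derivative_at_within, rule test_function_DERIV, rule assms)
    from has_vector_derivative_mult[OF 1 2] show ?thesis by (simp add: mult_ac add_ac)
  qed
  hence 1: "((\<lambda>\<theta>. \<i> * of_nat m * (cis (real m * \<theta>) * of_real (f \<theta>)) + cis (real m * \<theta>) * of_real (deriv f \<theta>)) has_integral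
      cis (real m * (2 * pi)) * of_real (f (2 * pi)) - cis (real m * 0) * of_real (f 0)) {0..2 * pi}"
    by (intro fundamental_theorem_of_calculus) auto
  have 2: "((\<lambda>\<theta>. \<i> * of_nat m * (cis (real m * \<theta>) * of_real (f \<theta>)) + cis (real m * \<theta>) * of_real (deriv f \<theta>)) has_integral
      \<i> * of_nat m * mode_integral m f + mode_integral m (deriv f)) {0..2 * pi}"
    by (intro has_integral_add has_integral_mult_right mode_integral_has_integral assms test_function_deriv)
  have "cis (real m * (2 * pi)) = 1"
    using cis_multiple_2pi[of "real m"] by (simp add: mult_ac)
  moreover have "f (2 * pi) = f 0" using test_function_periodic[OF assms, of 0] by simp
  ultimately have "\<i> * of_nat m * mode_integral m f + mode_integral m (deriv f) = 0"
    using has_integral_unique[OF 2 1] by simp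
  hence "\<i> * (\<i> * of_nat m * mode_integral m f + mode_integral m (deriv f)) = 0" by simp
  thus ?thesis by (simp add: distrib_left mult.assoc[symmetric])
qed

lemma mode_integral_bound:
  assumes "f \<in> test_functions" "m \<ge> 1"
  shows "cmod (mode_integral m f) \<le> 2 * pi * sup_deriv j f / real m ^ j"
proof -
  have base: "cmod (mode_integral m h) \<le> 2 * pi * B" if h: "h \<in> test_functions" "\<And>\<theta>. \<bar>h \<theta>\<bar> \<le> B" for h B
  proof -
    have "continuous_on {0..2 * pi} (\<lambda>\<theta>. cis (real m * \<theta>) * complex_of_real (h \<theta>))"
      by (intro continuous_intros continuous_on_cis continuous_on_of_real test_function_continuous h)
    hence "norm (mode_integral m h) \<le> B * (2 * pi - 0)"
      unfolding mode_integral_def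
      by (intro integral_bound) (auto simp: norm_mult h)
    thus ?thesis by (simp add: mult_ac)
  qed
  have iter: "real m ^ j * cmod (mode_integral m f) = cmod (mode_integral m ((deriv ^^ j) f))" for j
  proof (induction j)
    case (Suc j)
    have "real m ^ Suc j * cmod (mode_integral m f) = cmod (of_nat m * mode_integral m ((deriv ^^ j) f))"
      using Suc by (simp add: norm_mult mult.assoc)
    also have "\<dots> = cmod (mode_integral m ((deriv ^^ Suc j) f))"
      by (simp add: mode_integral_deriv test_function_deriv_iter assms norm_mult)
    finally show ?case .
  qed simp
  have "real m ^ j * cmod (mode_integral m f) \<le> 2 * pi * sup_deriv j f"
    unfolding iter by (intro base test_function_deriv_iter assms sup_deriv_upper)
  thus ?thesis using assms(2) by (simp add: field_simps)
qed

lemma partial_sum_apply: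
  assumes "f \<in> test_functions"
  shows "field_partial_sum \<phi> N f = (\<Sum>m=1..N. 2 * Re (\<phi> m * mode_integral m f))"
proof -
  have "((\<lambda>\<theta>. \<Sum>m=1..N. 2 * Re (\<phi> m * (cis (real m * \<theta>) * of_real (f \<theta>)))) has_integral (\<Sum>m=1..N. 2 * Re (\<phi> m * mode_integral m f))) {0..2 * pi}"
  proof (intro has_integral_sum has_integral_mult_right)
    fix m
    show "((\<lambda>\<theta>. Re (\<phi> m * (cis (real m * \<theta>) * of_real (f \<theta>)))) has_integral Re (\<phi> m * mode_integral m f)) {0..2 * pi}"
      using has_integral_linear[OF has_integral_mult_right[OF mode_integral_has_integral[OF assms]] bounded_linear_Re, of "\<phi> m" m]
      by (simp only: o_def)
  qed auto
  also have "(\<lambda>\<theta>. \<Sum>m=1..N. 2 * Re (\<phi> m * (cis (real m * \<theta>) * of_real (f \<theta>)))) = (\<lambda>\<theta>. 2 * Re (\<Sum>m=1..N. \<phi> m * cis \<theta> ^ m) * f \<theta>)"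
  proof
    fix \<theta>
    have "Re (\<phi> m * (cis (real m * \<theta>) * of_real (f \<theta>))) = Re (\<phi> m * cis \<theta> ^ m) * f \<theta>" for m
      by (simp add: Complex.DeMoivre algebra_simps)
    thus "(\<Sum>m=1..N. 2 * Re (\<phi> m * (cis (real m * \<theta>) * of_real (f \<theta>)))) = 2 * Re (\<Sum>m=1..N. \<phi> m * cis \<theta> ^ m) * f \<theta>"
      by (simp only: Re_sum sum_distrib_left sum_distrib_right mult.assoc)
  qed
  finally show ?thesis using assms by (simp add: field_partial_sum_def function_distribution_def integral_unique)
qed


section \<open>Convergence of the field\<close>

text \<open>
  The coefficients of index \<open>k\<close> and \<open>- k\<close> have the same modulus, and that of index \<open>0\<close> is zero.
\<close>

lemma weighted_summable_mode_coeff_iff: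
  "weighted_summable s (mode_coeff \<phi>) \<longleftrightarrow> summable (\<lambda>m. sobolev_weight s (int (Suc m)) * (cmod (\<phi> (Suc m)))\<^sup>2)"
proof -
  define W where "W k = sobolev_weight s k * (cmod (mode_coeff \<phi> k))\<^sup>2" for k
  define h where "h m = sobolev_weight s (int (Suc m)) * (cmod (\<phi> (Suc m)))\<^sup>2" for m
  have U: "(UNIV :: int set) = {0} \<union> (range (\<lambda>m. int (Suc m)) \<union> range (\<lambda>m. - int (Suc m)))"
  proof -
    have "k \<in> {0} \<union> (range (\<lambda>m. int (Suc m)) \<union> range (\<lambda>m. - int (Suc m)))" for k :: int
    proof -
      consider "k = 0" | "k > 0" | "k < 0" by linarith
      thus ?thesis
      proof cases
        case 2
        hence "k = int (Suc (nat (k - 1)))" by simp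
        thus ?thesis by blast
      next
        case 3
        hence "k = - int (Suc (nat (- k - 1)))" by simp
        thus ?thesis by blast
      qed auto
    qed
    thus ?thesis by blast
  qed
  have p: "W summable_on range (\<lambda>m. int (Suc m)) \<longleftrightarrow> h summable_on UNIV"
    by (subst summable_on_reindex) (auto simp: inj_on_def o_def W_def h_def[abs_def] mode_coeff_def simp del: of_nat_Suc)
  have wneg: "sobolev_weight s (- k) = sobolev_weight s k" for k by (simp add: sobolev_weight_def)
  have n: "W summable_on range (\<lambda>m. - int (Suc m)) \<longleftrightarrow> h summable_on UNIV"
    by (subst summable_on_reindex) (auto simp: inj_on_def o_def W_def h_def[abs_def] mode_coeff_def wneg simp del: of_nat_Suc)
  have h: "h summable_on UNIV \<longleftrightarrow> summable h"
    by (rule summable_on_UNIV_nonneg_real_iff) (simp add: h_def less_imp_le[OF sobolev_weight_pos])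
  have "W summable_on UNIV \<longleftrightarrow> summable h"
  proof
    assume "W summable_on UNIV"
    hence "W summable_on range (\<lambda>m. int (Suc m))" by (rule summable_on_subset_banach) auto
    thus "summable h" using p h by simp
  next
    assume "summable h"
    hence "W summable_on range (\<lambda>m. int (Suc m))" "W summable_on range (\<lambda>m. - int (Suc m))" using p n h by auto
    hence "W summable_on {0} \<union> (range (\<lambda>m. int (Suc m)) \<union> range (\<lambda>m. - int (Suc m)))"
      by (intro summable_on_Un_disjoint) auto
    thus "W summable_on UNIV" unfolding U[symmetric] .
  qed
  thus ?thesis by (simp only: weighted_summable_def W_def[abs_def] h_def[abs_def])
qed

lemma weighted_tail_tendsto_0:
  assumes "weighted_summable s a"
  shows "(\<lambda>N. weighted_norm s (\<lambda>k. if \<bar>k\<bar> \<le> int N then 0 else a k)) \<longlonglongrightarrow> 0"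
proof -
  define W where "W k = sobolev_weight s k * (cmod (a k))\<^sup>2" for k
  have W: "W summable_on UNIV" using assms by (simp add: weighted_summable_def W_def[abs_def])
  have "(sum W \<longlongrightarrow> infsum W UNIV) (finite_subsets_at_top UNIV)"
    using has_sum_infsum[OF W] by (simp add: has_sum_def)
  moreover have "filterlim (\<lambda>N. {- int N..int N}) (finite_subsets_at_top UNIV) sequentially"
    unfolding filterlim_finite_subsets_at_top
  proof (intro allI impI)
    fix X :: "int set" assume X: "finite X \<and> X \<subseteq> UNIV"
    define R where "R = (\<Sum>k\<in>X. nat \<bar>k\<bar>)"
    have R: "nat \<bar>k\<bar> \<le> R" if "k \<in> X" for k
      unfolding R_def by (rule member_le_sum) (use X that in auto)
    have "X \<subseteq> {- int N..int N}" if "N \<ge> R" for N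
    proof
      fix k assume "k \<in> X"
      hence "nat \<bar>k\<bar> \<le> N" using R that by (meson order_trans)
      thus "k \<in> {- int N..int N}" by auto
    qed
    thus "\<forall>\<^sub>F N in sequentially. finite {- int N..int N} \<and> X \<subseteq> {- int N..int N} \<and> {- int N..int N} \<subseteq> UNIV"
      by (intro eventually_sequentiallyI[of R]) auto
  qed
  ultimately have "(\<lambda>N. sum W {- int N..int N}) \<longlonglongrightarrow> infsum W UNIV"
    by (rule filterlim_compose)
  hence "(\<lambda>N. sqrt (infsum W UNIV - sum W {- int N..int N})) \<longlonglongrightarrow> sqrt (infsum W UNIV - infsum W UNIV)"
    by (intro tendsto_intros)
  moreover have "weighted_norm s (\<lambda>k. if \<bar>k\<bar> \<le> int N then 0 else a k) = sqrt (infsum W UNIV - sum W {- int N..int N})" for N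
  proof -
    have "(\<Sum>\<^sub>\<infinity>k. sobolev_weight s k * (cmod (if \<bar>k\<bar> \<le> int N then 0 else a k))\<^sup>2) = infsum W (UNIV - {- int N..int N})"
      by (rule infsum_cong_neutral) (auto simp: W_def)
    also have "\<dots> = infsum W UNIV - infsum W {- int N..int N}"
      by (rule infsum_Diff) (use W in auto)
    finally show ?thesis by (simp add: weighted_norm_def)
  qed
  ultimately show ?thesis by simp
qed

text \<open>
  A summable family has bounded terms, and the reciprocal of the weight grows at most polynomially.
\<close>

lemma mode_growth:
  assumes "weighted_summable s (mode_coeff \<phi>)"
  obtains K p where "K \<ge> 0" "\<And>m. m \<ge> 1 \<Longrightarrow> cmod (\<phi> m) \<le> K * real m ^ p"
proof -
  define B where "B = weighted_norm s (mode_coeff \<phi>)"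
  have B0: "B \<ge> 0" by (simp add: B_def weighted_norm_nonneg)
  define p where "p = nat \<lceil>\<bar>s\<bar>\<rceil>"
  have p: "\<bar>s\<bar> \<le> real p" unfolding p_def by (rule real_nat_ceiling_ge)
  have "cmod (\<phi> m) \<le> B * 2 ^ p * real m ^ (2 * p)" if m: "m \<ge> 1" for m
  proof -
    have "L2_set (\<lambda>k. sqrt (sobolev_weight s k) * cmod (mode_coeff \<phi> k)) {int m} \<le> B"
      unfolding B_def by (rule weighted_norm_finite_sum[OF assms]) auto
    hence 1: "sqrt (sobolev_weight s (int m)) * cmod (\<phi> m) \<le> B"
      using m by (simp add: mode_coeff_def less_imp_le[OF sobolev_weight_pos])
    define x where "x = 1 + (real m)\<^sup>2"
    have x1: "x \<ge> 1" by (simp add: x_def)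
    have "1 / sqrt (sobolev_weight s (int m)) = x powr (- s / 2)"
    proof -
      have "sqrt (sobolev_weight s (int m)) = x powr (s / 2)"
        using x1 by (simp add: sobolev_weight_def x_def[symmetric] powr_half_sqrt[symmetric] powr_powr)
      thus ?thesis by (simp only: powr_minus_divide minus_divide_left[symmetric])
    qed
    also have "\<dots> \<le> x powr real p"
      by (rule powr_mono) (use x1 p in linarith)+
    also have "\<dots> = x ^ p" using x1 by (simp add: powr_realpow)
    also have "\<dots> \<le> (2 * (real m)\<^sup>2) ^ p"
      using m by (intro power_mono) (auto simp: x_def one_le_power)
    also have "\<dots> = 2 ^ p * real m ^ (2 * p)" by (simp add: power_mult_distrib power_mult)
    finally have 2: "1 / sqrt (sobolev_weight s (int m)) \<le> 2 ^ p * real m ^ (2 * p)" .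
    have sp: "sqrt (sobolev_weight s (int m)) > 0" by (simp add: sobolev_weight_pos)
    have "cmod (\<phi> m) \<le> B * (1 / sqrt (sobolev_weight s (int m)))"
      using 1 sp by (simp add: field_simps)
    also have "\<dots> \<le> B * (2 ^ p * real m ^ (2 * p))" by (rule mult_left_mono[OF 2 B0])
    finally show ?thesis by (simp add: mult_ac)
  qed
  thus ?thesis using that[of "B * 2 ^ p" "2 * p"] B0 by simp
qed

text \<open>
  The modes grow at most like \<open>m ^ p\<close>, and \<open>p + 2\<close> derivatives of the test function gain a factor
  \<open>m ^ (p + 2)\<close>. Hence the partial sums, tested against a fixed function, converge like \<open>\<Sum> 1 / m\<^sup>2\<close>, with a bound that makes the
  limit a distribution of order \<open>p + 2\<close>.
\<close>

lemma field_limit_exists: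
  assumes sum: "weighted_summable s (mode_coeff \<phi>)"
  obtains u where "u \<in> sobolev_space0 s" "fourier_coeff u = mode_coeff \<phi>"
proof -
  obtain K p where K: "K \<ge> 0" "\<And>m. m \<ge> 1 \<Longrightarrow> cmod (\<phi> m) \<le> K * real m ^ p" using mode_growth[OF sum] by blast
  define t where "t f m = 2 * Re (\<phi> m * mode_integral m f)" for f m
  define L where "L = 2 * (K * (2 * pi))"
  have bound: "\<bar>t f (Suc n)\<bar> \<le> L * sup_deriv (p + 2) f * (1 / real (Suc n) ^ 2)" if f: "f \<in> test_functions" for f n
  proof -
    have S: "sup_deriv (p + 2) f \<ge> 0" by (rule sup_deriv_nonneg[OF f])
    have "\<bar>t f (Suc n)\<bar> \<le> 2 * (cmod (\<phi> (Suc n)) * cmod (mode_integral (Suc n) f))"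
      using abs_Re_le_cmod[of "\<phi> (Suc n) * mode_integral (Suc n) f"] by (simp add: t_def norm_mult)
    also have "\<dots> \<le> 2 * ((K * real (Suc n) ^ p) * (2 * pi * sup_deriv (p + 2) f / real (Suc n) ^ (p + 2)))"
      using K(1) K(2)[of "Suc n"] S by (intro mult_left_mono mult_mono mode_integral_bound f mult_nonneg_nonneg) (auto simp del: of_nat_Suc)
    also have "\<dots> = L * sup_deriv (p + 2) f * (1 / real (Suc n) ^ 2)"
    proof -
      have "2 * ((K * q) * (2 * pi * S / (q * r))) = 2 * (K * (2 * pi)) * S * (1 / r)" if "q \<noteq> 0" for q r S :: real
        using that by simp
      from this[of "real (Suc n) ^ p" "sup_deriv (p + 2) f" "real (Suc n) ^ 2"] show ?thesis
        by (simp only: L_def power_add) simp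
    qed
    finally show ?thesis .
  qed
  have sq: "summable (\<lambda>n. 1 / real (Suc n) ^ 2)"
    using inverse_power_summable[of 2, where 'a = real] by (subst summable_Suc_iff) (simp add: inverse_eq_divide)
  define Z where "Z = suminf (\<lambda>n. 1 / real (Suc n) ^ 2)"
  have tsum: "summable (\<lambda>n. t f (Suc n))" and tabs: "\<bar>suminf (\<lambda>n. t f (Suc n))\<bar> \<le> L * Z * sup_deriv (p + 2) f" if f: "f \<in> test_functions" for f
  proof -
    have s: "summable (\<lambda>n. L * sup_deriv (p + 2) f * (1 / real (Suc n) ^ 2))" by (intro summable_mult sq)
    have sa: "summable (\<lambda>n. \<bar>t f (Suc n)\<bar>)"
      by (rule summable_comparison_test'[OF s, of 0]) (use bound[OF f] in auto)
    thus "summable (\<lambda>n. t f (Suc n))" by (rule summable_rabs_cancel)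
    have "\<bar>suminf (\<lambda>n. t f (Suc n))\<bar> \<le> suminf (\<lambda>n. \<bar>t f (Suc n)\<bar>)" by (rule summable_rabs[OF sa])
    also have "\<dots> \<le> suminf (\<lambda>n. L * sup_deriv (p + 2) f * (1 / real (Suc n) ^ 2))"
      by (rule suminf_le[OF bound[OF f] sa s])
    also have "\<dots> = L * sup_deriv (p + 2) f * Z" unfolding Z_def by (rule suminf_mult[OF sq])
    finally show "\<bar>suminf (\<lambda>n. t f (Suc n))\<bar> \<le> L * Z * sup_deriv (p + 2) f" by (simp add: mult_ac)
  qed
  define u where "u = (\<lambda>f\<in>test_functions. suminf (\<lambda>n. t f (Suc n)))"
  have lim: "(\<lambda>N. field_partial_sum \<phi> N f) \<longlonglongrightarrow> u f" if f: "f \<in> test_functions" for f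
  proof -
    have "field_partial_sum \<phi> N f = (\<Sum>n<N. t f (Suc n))" for N
      unfolding partial_sum_apply[OF f] t_def
      by (rule sum.reindex_bij_witness[of _ Suc "\<lambda>m. m - 1"]) auto
    thus ?thesis using summable_LIMSEQ[OF tsum[OF f]] f by (simp add: u_def)
  qed
  have uniq: "x = u f" if "(\<lambda>N. field_partial_sum \<phi> N f) \<longlonglongrightarrow> x" "f \<in> test_functions" for x f
    using LIMSEQ_unique[OF that(1) lim[OF that(2)]] .
  have Z0: "Z \<ge> 0" unfolding Z_def by (intro suminf_nonneg sq) auto
  have LZ: "L * Z \<ge> 0" using K(1) Z0 by (simp add: L_def)
  have dist: "u \<in> distributions"
    unfolding distributions_def mem_Collect_eq
  proof (intro conjI ballI allI)
    show "u \<in> extensional test_functions" by (simp add: u_def)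
    fix f g assume f: "f \<in> test_functions" and g: "g \<in> test_functions"
    show "u (\<lambda>\<theta>. f \<theta> + g \<theta>) = u f + u g"
      using tendsto_add[OF lim[OF f] lim[OF g]] distribution_add[OF partial_sum_in_distributions f g]
      by (intro uniq[symmetric] test_function_add f g) simp
  next
    fix c f assume f: "f \<in> test_functions"
    show "u (\<lambda>\<theta>. c * f \<theta>) = c * u f"
      using tendsto_mult_left[OF lim[OF f], of c] distribution_scale[OF partial_sum_in_distributions f]
      by (intro uniq[symmetric] test_function_scale f) simp
  next
    have "\<bar>u f\<bar> \<le> L * Z * (\<Sum>j\<le>p + 2. sup_deriv j f)" if f: "f \<in> test_functions" for f
    proof -
      have "sup_deriv (p + 2) f \<le> (\<Sum>j\<le>p + 2. sup_deriv j f)"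
        by (rule member_le_sum) (auto intro: sup_deriv_nonneg f)
      from mult_left_mono[OF this LZ] tabs[OF f] show ?thesis using f by (simp add: u_def)
    qed
    thus "\<exists>C N. \<forall>f\<in>test_functions. \<bar>u f\<bar> \<le> C * (\<Sum>j\<le>N. SUP \<theta>. \<bar>(deriv ^^ j) f \<theta>\<bar>)"
      unfolding sup_deriv_def[symmetric] by blast
  qed
  have fc: "fourier_coeff u k = mode_coeff \<phi> k" for k
  proof -
    have "(\<lambda>N. fourier_coeff (field_partial_sum \<phi> N) k) \<longlonglongrightarrow> fourier_coeff u k"
      unfolding fourier_coeff_def Complex_eq
      by (intro tendsto_intros lim cos_test_function sin_test_function) auto
    moreover have "(\<lambda>N. fourier_coeff (field_partial_sum \<phi> N) k) \<longlonglongrightarrow> mode_coeff \<phi> k"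
      by (rule tendsto_eventually, rule eventually_sequentiallyI[of "nat \<bar>k\<bar>"]) (auto simp: fourier_coeff_partial_sum)
    ultimately show ?thesis by (rule LIMSEQ_unique)
  qed
  hence fc': "fourier_coeff u = mode_coeff \<phi>" by (rule ext)
  have "u \<in> sobolev_space0 s"
    unfolding sobolev_space0_iff fc' using dist sum by (simp add: mode_coeff_def)
  thus ?thesis using that fc' by blast
qed

lemma field_converges_iff_dist:
  "field_converges_to s \<phi> u \<longleftrightarrow> u \<in> sobolev_space0 s \<and> (\<lambda>N. sobolev_dist s (field_partial_sum \<phi> N) u) \<longlonglongrightarrow> 0"
proof -
  interpret Metric_space "sobolev_space0 s" "sobolev_dist s" by (rule Metric_space_sobolev)
  show ?thesis unfolding field_converges_to_def sobolev_topology0_def limitin_metric_dist_null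
    by (simp add: partial_sum_in_sobolev_space0)
qed

text \<open>
  The distance to the \<open>N\<close>-th partial sum is the tail of the weighted \<open>\<ell>\<^sup>2\<close> norm, and it dominates each single
  coefficient.
\<close>

lemma field_converges_iff:
  "field_converges_to s \<phi> u \<longleftrightarrow> u \<in> sobolev_space0 s \<and> fourier_coeff u = mode_coeff \<phi>"
proof
  assume "field_converges_to s \<phi> u"
  hence u: "u \<in> sobolev_space0 s" and lim: "(\<lambda>N. sobolev_dist s (field_partial_sum \<phi> N) u) \<longlonglongrightarrow> 0"
    by (auto simp: field_converges_iff_dist)
  have "fourier_coeff u k = mode_coeff \<phi> k" for k
  proof -
    have "sqrt (sobolev_weight s k) * cmod (mode_coeff \<phi> k - fourier_coeff u k) \<le> sobolev_dist s (field_partial_sum \<phi> N) u" if N: "N \<ge> nat \<bar>k\<bar>" for N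
    proof -
      have N': "\<bar>k\<bar> \<le> int N" using N by linarith
      have "weighted_summable s (\<lambda>k. fourier_coeff (field_partial_sum \<phi> N) k - fourier_coeff u k)"
        using u partial_sum_in_sobolev_space0[of \<phi> N s] by (intro weighted_summable_diff) (auto simp: sobolev_space0_iff)
      from weighted_norm_finite_sum[OF this, of "{k}"] show ?thesis
        using N N' by (simp add: sobolev_dist_eq fourier_coeff_partial_sum less_imp_le[OF sobolev_weight_pos])
    qed
    hence "sqrt (sobolev_weight s k) * cmod (mode_coeff \<phi> k - fourier_coeff u k) \<le> 0"
      by (intro LIMSEQ_le_const[OF lim]) blast
    hence "cmod (mode_coeff \<phi> k - fourier_coeff u k) \<le> 0"
      using sobolev_weight_pos[of s k] by (simp add: mult_le_0_iff)
    thus ?thesis by simp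
  qed
  thus "u \<in> sobolev_space0 s \<and> fourier_coeff u = mode_coeff \<phi>" using u by auto
next
  assume u: "u \<in> sobolev_space0 s \<and> fourier_coeff u = mode_coeff \<phi>"
  hence "weighted_summable s (mode_coeff \<phi>)" by (auto simp: sobolev_space0_iff)
  from weighted_tail_tendsto_0[OF this]
  have "(\<lambda>N. weighted_norm s (\<lambda>k. - (if \<bar>k\<bar> \<le> int N then 0 else mode_coeff \<phi> k))) \<longlonglongrightarrow> 0"
    by (simp add: weighted_uminus)
  moreover have "(\<lambda>k. - (if \<bar>k\<bar> \<le> int N then 0 else mode_coeff \<phi> k)) = (\<lambda>k. fourier_coeff (field_partial_sum \<phi> N) k - fourier_coeff u k)" for N
    using u by (auto simp: fourier_coeff_partial_sum)
  ultimately show "field_converges_to s \<phi> u" using u by (simp add: field_converges_iff_dist sobolev_dist_eq)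
qed

lemma field_converges_ex_iff: "(\<exists>u. field_converges_to s \<phi> u) \<longleftrightarrow> weighted_summable s (mode_coeff \<phi>)"
proof
  assume "\<exists>u. field_converges_to s \<phi> u"
  thus "weighted_summable s (mode_coeff \<phi>)" by (auto simp: field_converges_iff sobolev_space0_iff)
next
  assume "weighted_summable s (mode_coeff \<phi>)"
  then obtain u where "u \<in> sobolev_space0 s" "fourier_coeff u = mode_coeff \<phi>" by (rule field_limit_exists)
  thus "\<exists>u. field_converges_to s \<phi> u" by (auto simp: field_converges_iff)
qed


section \<open>Measurability and almost sure convergence\<close>

lemma continuous_map_mode_coeff: "continuous_map mode_space euclidean (\<lambda>\<phi>. mode_coeff \<phi> k)"
proof -
  have proj: "continuous_map mode_space euclidean (\<lambda>\<phi>. \<phi> m)" if "m \<ge> 1" for m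
    unfolding mode_space_def using that by (intro continuous_map_product_projection) auto
  have cnj: "continuous_map mode_space euclidean (\<lambda>\<phi>. cnj (\<phi> m))" if "m \<ge> 1" for m
  proof -
    have "continuous_map euclidean euclidean cnj"
      unfolding continuous_map_iff_continuous2 by (intro continuous_intros)
    from continuous_map_compose[OF proj[OF that] this] show ?thesis by (simp add: o_def)
  qed
  consider "k > 0" | "k < 0" | "k = 0" by linarith
  thus ?thesis
  proof cases
    case 1
    thus ?thesis using proj[of "nat k"] by (simp add: mode_coeff_def)
  next
    case 2
    thus ?thesis using cnj[of "nat (- k)"] by (simp add: mode_coeff_def)
  qed (simp add: mode_coeff_def)
qed

text \<open>
  The distance of two partial sums is a continuous function of finitely many modes.
\<close>

lemma continuous_map_partial_sum:
  "continuous_map mode_space (sobolev_topology0 s) (\<lambda>\<phi>. field_partial_sum \<phi> N)"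
proof -
  interpret Metric_space "sobolev_space0 s" "sobolev_dist s" by (rule Metric_space_sobolev)
  show ?thesis unfolding sobolev_topology0_def continuous_map_to_metric
  proof (intro ballI allI impI)
    fix \<phi> and e :: real assume \<phi>: "\<phi> \<in> topspace mode_space" and e: "e > 0"
    define h where "h \<psi> = (\<Sum>k\<in>{- int N..int N}. sobolev_weight s k * (cmod (mode_coeff \<phi> k - mode_coeff \<psi> k))\<^sup>2)" for \<psi>
    have dist: "sobolev_dist s (field_partial_sum \<phi> N) (field_partial_sum \<psi> N) = sqrt (h \<psi>)" for \<psi>
    proof -
      have "(\<Sum>\<^sub>\<infinity>k. sobolev_weight s k * (cmod (fourier_coeff (field_partial_sum \<phi> N) k - fourier_coeff (field_partial_sum \<psi> N) k))\<^sup>2)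
         = (\<Sum>\<^sub>\<infinity>k\<in>{- int N..int N}. sobolev_weight s k * (cmod (mode_coeff \<phi> k - mode_coeff \<psi> k))\<^sup>2)"
        by (rule infsum_cong_neutral) (auto simp: fourier_coeff_partial_sum)
      thus ?thesis by (simp add: sobolev_dist_eq weighted_norm_def h_def)
    qed
    have "continuous_map mode_space euclidean (\<lambda>\<psi>. sobolev_weight s k * (cmod (mode_coeff \<phi> k - mode_coeff \<psi> k))\<^sup>2)" for k
    proof -
      have "continuous_map euclidean euclidean (\<lambda>z. sobolev_weight s k * (cmod (mode_coeff \<phi> k - z))\<^sup>2)"
        unfolding continuous_map_iff_continuous2 by (intro continuous_intros)
      from continuous_map_compose[OF continuous_map_mode_coeff this] show ?thesis by (simp add: o_def)
    qed
    hence "continuous_map mode_space euclidean h"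
      unfolding h_def[abs_def] by (intro continuous_map_sum) auto
    hence U: "openin mode_space {\<psi> \<in> topspace mode_space. h \<psi> \<in> {..<e\<^sup>2}}"
      by (rule openin_continuous_map_preimage) auto
    show "\<exists>U. openin mode_space U \<and> \<phi> \<in> U \<and> (\<forall>\<psi>\<in>U. field_partial_sum \<psi> N \<in> mball (field_partial_sum \<phi> N) e)"
    proof (intro exI conjI ballI)
      show "openin mode_space {\<psi> \<in> topspace mode_space. h \<psi> \<in> {..<e\<^sup>2}}" by (rule U)
      show "\<phi> \<in> {\<psi> \<in> topspace mode_space. h \<psi> \<in> {..<e\<^sup>2}}" using \<phi> e by (simp add: h_def)
      fix \<psi> assume "\<psi> \<in> {\<psi> \<in> topspace mode_space. h \<psi> \<in> {..<e\<^sup>2}}"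
      hence "sqrt (h \<psi>) < e" using e by (intro real_less_lsqrt) (auto simp: h_def intro!: sum_nonneg simp: less_imp_le[OF sobolev_weight_pos])
      thus "field_partial_sum \<psi> N \<in> mball (field_partial_sum \<phi> N) e"
        by (simp add: partial_sum_in_sobolev_space0 dist)
    qed
  qed
qed

lemma openin_partial_sum_measurable:
  assumes "openin (sobolev_topology0 s) U"
  shows "{\<phi> \<in> topspace mode_space. field_partial_sum \<phi> N \<in> U} \<in> sets (borel_on mode_space)"
proof -
  have "openin mode_space {\<phi> \<in> topspace mode_space. field_partial_sum \<phi> N \<in> U}"
    by (rule openin_continuous_map_preimage[OF continuous_map_partial_sum assms])
  thus ?thesis unfolding sets_borel_on by (intro sigma_sets.Basic) simp
qed

lemma measurable_mode: "m \<ge> 1 \<Longrightarrow> (\<lambda>\<phi>. \<phi> m) \<in> borel_measurable (borel_on mode_space)"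
  using measurable_component_singleton[of m "{1..}" "\<lambda>_. borel :: complex measure"]
  by (simp cong: measurable_cong_sets add: sets_borel_mode_space)

lemma weighted_summable_measurable:
  "{\<phi> \<in> topspace mode_space. weighted_summable s (mode_coeff \<phi>)} \<in> sets (borel_on mode_space)"
proof -
  let ?h = "\<lambda>\<phi> m. sobolev_weight s (int (Suc m)) * (cmod (\<phi> (Suc m)))\<^sup>2"
  have nn: "0 \<le> ?h \<phi> m" for \<phi> :: "nat \<Rightarrow> complex" and m by (simp add: less_imp_le[OF sobolev_weight_pos])
  have "weighted_summable s (mode_coeff \<phi>) \<longleftrightarrow> (suminf (\<lambda>m. ennreal (?h \<phi> m))) \<noteq> top" for \<phi>
    unfolding weighted_summable_mode_coeff_iff
    by (rule iffI) (erule ennreal_suminf_neq_top, rule nn, rule summable_suminf_not_top, rule nn)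
  moreover have "(\<lambda>\<phi>. suminf (\<lambda>m. ennreal (?h \<phi> m))) \<in> borel_measurable (borel_on mode_space)"
  proof (rule borel_measurable_suminf_order)
    fix m
    note measurable_mode[of "Suc m", measurable]
    show "(\<lambda>\<phi>. ennreal (?h \<phi> m)) \<in> borel_measurable (borel_on mode_space)" by simp
  qed
  hence "{\<phi> \<in> space (borel_on mode_space). suminf (\<lambda>m. ennreal (?h \<phi> m)) \<noteq> top} \<in> sets (borel_on mode_space)"
    by measurable
  ultimately show ?thesis by simp
qed

lemma field_sum_converges: "weighted_summable s (mode_coeff \<phi>) \<Longrightarrow> field_converges_to s \<phi> (field_sum s \<phi>)"
  using field_converges_ex_iff[of s \<phi>] someI_ex[of "field_converges_to s \<phi>"] by (simp add: field_sum_def)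

lemma field_sum_zero: "\<not> weighted_summable s (mode_coeff \<phi>) \<Longrightarrow> field_sum s \<phi> = function_distribution (\<lambda>_. 0)"
  using field_converges_ex_iff[of s \<phi>] by (simp add: field_sum_def)

lemma zero_distribution_in_sobolev_space0: "function_distribution (\<lambda>_. 0) \<in> sobolev_space0 s"
  using partial_sum_in_sobolev_space0[of _ 0] by (simp add: field_partial_sum_def)

lemma field_sum_in_sobolev_space0: "field_sum s \<phi> \<in> sobolev_space0 s"
  using field_sum_converges[of s \<phi>] field_sum_zero[of s \<phi>] zero_distribution_in_sobolev_space0[of s]
  by (cases "weighted_summable s (mode_coeff \<phi>)") (auto simp: field_converges_iff)

text \<open>
  The limit of the continuous maps \<open>field_partial_sum\<close> on the measurable set where it exists. Given an open \<open>U\<close>, let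
  \<open>V k\<close> be the open set of points at distance less than \<open>1 / (k + 1)\<close> from the complement of \<open>U\<close>. A limit lies in
  \<open>U\<close> if and only if, for some \<open>k\<close>, the sequence eventually avoids \<open>V k\<close>.
\<close>

lemma field_sum_measurable: "field_sum s \<in> measurable (borel_on mode_space) (borel_on (sobolev_topology0 s))"
proof -
  interpret Metric_space "sobolev_space0 s" "sobolev_dist s" by (rule Metric_space_sobolev)
  have top: "topspace (sobolev_topology0 s) = sobolev_space0 s" by (simp add: sobolev_topology0_def)
  let ?B = "borel_on mode_space" and ?T = "topspace mode_space"
  let ?C = "{\<phi> \<in> ?T. weighted_summable s (mode_coeff \<phi>)}"
  show ?thesis
  proof (rule measurable_sigma_sets[OF sets_borel_on])
    show "{U. openin (sobolev_topology0 s) U} \<subseteq> Pow (topspace (sobolev_topology0 s))"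
      by (auto dest: openin_subset)
    show "field_sum s \<in> space ?B \<rightarrow> topspace (sobolev_topology0 s)"
      by (auto simp: top field_sum_in_sobolev_space0)
    fix U assume "U \<in> {U. openin (sobolev_topology0 s) U}"
    hence U: "openin (sobolev_topology0 s) U" by simp
    have UM: "U \<subseteq> sobolev_space0 s" using openin_subset[OF U] by (simp add: top)
    define V where "V k = (\<Union>y\<in>sobolev_space0 s - U. mball y (1 / real (Suc k)))" for k
    have V: "openin (sobolev_topology0 s) (V k)" for k
      unfolding V_def sobolev_topology0_def by (intro openin_Union) auto
    have V_iff: "p \<in> V k \<longleftrightarrow> (\<exists>y\<in>sobolev_space0 s. y \<notin> U \<and> sobolev_dist s p y < 1 / real (Suc k))" if "p \<in> sobolev_space0 s" for p k
      using that by (auto simp: V_def commute)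
    have main: "field_sum s \<phi> \<in> U \<longleftrightarrow> (\<exists>k n0. \<forall>n\<ge>n0. field_partial_sum \<phi> n \<notin> V k)" if C: "weighted_summable s (mode_coeff \<phi>)" for \<phi>
    proof -
      define u where "u = field_sum s \<phi>"
      have u: "u \<in> sobolev_space0 s" "(\<lambda>N. sobolev_dist s (field_partial_sum \<phi> N) u) \<longlonglongrightarrow> 0"
        using field_sum_converges[OF C] by (auto simp: field_converges_iff_dist u_def)
      have close: "\<exists>n0. \<forall>n\<ge>n0. sobolev_dist s (field_partial_sum \<phi> n) u < e" if "e > 0" for e
        using order_tendstoD(2)[OF u(2) that] by (simp add: eventually_sequentially)
      show ?thesis
      proof
        assume "field_sum s \<phi> \<in> U"
        then obtain r where r: "r > 0" "mball u r \<subseteq> U"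
          using U by (auto simp: sobolev_topology0_def openin_mtopology u_def)
        obtain k where k: "1 / real (Suc k) < r / 2" using reals_Archimedean[of "r / 2"] r by (auto simp: inverse_eq_divide)
        obtain n0 where n0: "\<And>n. n \<ge> n0 \<Longrightarrow> sobolev_dist s (field_partial_sum \<phi> n) u < r / 2"
          using close[of "r / 2"] r by auto
        have "field_partial_sum \<phi> n \<notin> V k" if n: "n \<ge> n0" for n
        proof
          assume "field_partial_sum \<phi> n \<in> V k"
          then obtain y where y: "y \<in> sobolev_space0 s" "y \<notin> U" "sobolev_dist s (field_partial_sum \<phi> n) y < 1 / real (Suc k)"
            using V_iff[OF partial_sum_in_sobolev_space0] by blast
          have "sobolev_dist s u y \<le> sobolev_dist s u (field_partial_sum \<phi> n) + sobolev_dist s (field_partial_sum \<phi> n) y"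
            by (rule triangle) (auto simp: u y partial_sum_in_sobolev_space0)
          also have "\<dots> < r" using n0[OF n] y(3) k commute[of u "field_partial_sum \<phi> n"] by linarith
          finally show False using r(2) y(1,2) u(1) by (auto simp: subset_iff)
        qed
        thus "\<exists>k n0. \<forall>n\<ge>n0. field_partial_sum \<phi> n \<notin> V k" by blast
      next
        assume "\<exists>k n0. \<forall>n\<ge>n0. field_partial_sum \<phi> n \<notin> V k"
        then obtain k n0 where n0: "\<And>n. n \<ge> n0 \<Longrightarrow> field_partial_sum \<phi> n \<notin> V k" by blast
        obtain n1 where n1: "\<And>n. n \<ge> n1 \<Longrightarrow> sobolev_dist s (field_partial_sum \<phi> n) u < 1 / real (Suc k)"
          using close[of "1 / real (Suc k)"] by auto
        have "sobolev_dist s (field_partial_sum \<phi> (max n0 n1)) u < 1 / real (Suc k)" by (rule n1) simp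
        moreover have "field_partial_sum \<phi> (max n0 n1) \<notin> V k" by (rule n0) simp
        ultimately have "u \<in> U" using V_iff[OF partial_sum_in_sobolev_space0, of \<phi> "max n0 n1" k] u(1) by blast
        thus "field_sum s \<phi> \<in> U" by (simp add: u_def)
      qed
    qed
    have Vm: "{\<phi> \<in> ?T. field_partial_sum \<phi> n \<notin> V k} \<in> sets ?B" for n k
    proof -
      have "space ?B - {\<phi> \<in> ?T. field_partial_sum \<phi> n \<in> V k} \<in> sets ?B"
        by (rule sets.compl_sets[OF openin_partial_sum_measurable[OF V]])
      also have "space ?B - {\<phi> \<in> ?T. field_partial_sum \<phi> n \<in> V k} = {\<phi> \<in> ?T. field_partial_sum \<phi> n \<notin> V k}" by auto
      finally show ?thesis .
    qed
    define E where "E = {\<phi> \<in> ?T. \<exists>k n0. \<forall>n\<ge>n0. field_partial_sum \<phi> n \<notin> V k}"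
    have "(\<Inter>n\<in>{n0..}. {\<phi> \<in> ?T. field_partial_sum \<phi> n \<notin> V k}) \<in> sets ?B" for n0 k
      by (rule sets.countable_INT') (auto intro: Vm)
    hence inner: "(\<Union>k. \<Union>n0. \<Inter>n\<in>{n0..}. {\<phi> \<in> ?T. field_partial_sum \<phi> n \<notin> V k}) \<in> sets ?B"
      by (intro sets.countable_UN image_subsetI)
    have "E = (\<Union>k. \<Union>n0. \<Inter>n\<in>{n0..}. {\<phi> \<in> ?T. field_partial_sum \<phi> n \<notin> V k})"
      by (auto simp: E_def)
    also have "\<dots> \<in> sets ?B"
      by (rule inner)
    finally have E: "E \<in> sets ?B" .
    define Z where "Z = (if function_distribution (\<lambda>_. 0) \<in> U then space ?B else {})"
    have "field_sum s -` U \<inter> space ?B = (?C \<inter> E) \<union> ((space ?B - ?C) \<inter> Z)"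
    proof (rule set_eqI)
      fix \<phi>
      show "\<phi> \<in> field_sum s -` U \<inter> space ?B \<longleftrightarrow> \<phi> \<in> (?C \<inter> E) \<union> ((space ?B - ?C) \<inter> Z)"
        using main[of \<phi>] field_sum_zero[of s \<phi>]
        by (cases "weighted_summable s (mode_coeff \<phi>)") (auto simp: E_def Z_def)
    qed
    also have "\<dots> \<in> sets ?B"
      using E weighted_summable_measurable[of s] by (intro sets.Un sets.Int sets.Diff) (auto simp: Z_def simp del: space_borel_on)
    finally show "field_sum s -` U \<inter> space ?B \<in> sets ?B" .
  qed
qed

lemma weighted_summable_mono:
  assumes "weighted_summable s a" "s' \<le> s"
  shows "weighted_summable s' a"
  unfolding weighted_summable_def
proof (rule summable_on_comparison_test)
  show "(\<lambda>k. sobolev_weight s k * (cmod (a k))\<^sup>2) summable_on UNIV" using assms(1) by (simp add: weighted_summable_def)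
  fix k
  have "sobolev_weight s' k \<le> sobolev_weight s k"
    unfolding sobolev_weight_def by (rule powr_mono) (use assms(2) in auto)
  thus "sobolev_weight s' k * (cmod (a k))\<^sup>2 \<le> sobolev_weight s k * (cmod (a k))\<^sup>2" by (rule mult_right_mono) simp
  show "0 \<le> sobolev_weight s' k * (cmod (a k))\<^sup>2" by (simp add: less_imp_le[OF sobolev_weight_pos])
qed

text \<open>
  The expectation of \<open>\<Sum> (1 + m\<^sup>2)\<^sup>s \<bar>\<phi>\<^sub>m\<bar>\<^sup>2\<close> is at most \<open>\<Sum> m powr (2 * s - 1)\<close>, which is finite exactly because
  \<open>s < 0\<close>. Since the Sobolev spaces decrease in \<open>s\<close>, the orders \<open>- 1 / (j + 1)\<close> suffice for a common null set.
\<close>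

lemma AE_field_converges:
  fixes \<nu> :: "(nat \<Rightarrow> complex) measure"
  assumes sets: "sets \<nu> = sets (borel_on mode_space)"
    and int: "\<And>m. m \<ge> 1 \<Longrightarrow> integrable \<nu> (\<lambda>\<phi>. (cmod (\<phi> m))\<^sup>2)"
    and var: "\<And>m. m \<ge> 1 \<Longrightarrow> (\<integral>\<phi>. (cmod (\<phi> m))\<^sup>2 \<partial>\<nu>) = 1 / real m"
  shows "AE \<phi> in \<nu>. \<forall>s<0. \<exists>u. field_converges_to s \<phi> u"
proof -
  have one: "AE \<phi> in \<nu>. weighted_summable s (mode_coeff \<phi>)" if s: "s < 0" for s
  proof -
    let ?h = "\<lambda>\<phi> m. sobolev_weight s (int (Suc m)) * (cmod (\<phi> (Suc m)))\<^sup>2"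
    have nn: "0 \<le> ?h \<phi> m" for \<phi> :: "nat \<Rightarrow> complex" and m by (simp add: less_imp_le[OF sobolev_weight_pos])
    have meas: "(\<lambda>\<phi>. ?h \<phi> m) \<in> borel_measurable \<nu>" for m
      using borel_measurable_integrable[OF int[of "Suc m"]] by simp
    have E: "(\<integral>\<^sup>+\<phi>. ennreal (?h \<phi> m) \<partial>\<nu>) = ennreal (sobolev_weight s (int (Suc m)) / real (Suc m))" for m
    proof -
      have "(\<integral>\<^sup>+\<phi>. ennreal (?h \<phi> m) \<partial>\<nu>) = ennreal (\<integral>\<phi>. ?h \<phi> m \<partial>\<nu>)"
        by (rule nn_integral_eq_integral) (use int[of "Suc m"] nn in auto)
      thus ?thesis using var[of "Suc m"] by (simp del: of_nat_Suc)
    qed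
    have bound: "sobolev_weight s (int (Suc m)) / real (Suc m) \<le> real (Suc m) powr (2 * s - 1)" for m
    proof -
      have "sobolev_weight s (int (Suc m)) \<le> (real (Suc m) ^ 2) powr s"
        unfolding sobolev_weight_def using s by (intro powr_mono2') auto
      also have "\<dots> = real (Suc m) powr (2 * s)"
        by (simp add: powr_powr flip: powr_numeral)
      finally have "sobolev_weight s (int (Suc m)) / real (Suc m) \<le> real (Suc m) powr (2 * s) / real (Suc m) powr 1"
        by (simp add: divide_right_mono)
      thus ?thesis by (simp add: powr_diff)
    qed
    have "summable (\<lambda>m. real (Suc m) powr (2 * s - 1))"
      using s by (subst summable_Suc_iff) (simp add: summable_real_powr_iff)
    hence sm: "summable (\<lambda>m. sobolev_weight s (int (Suc m)) / real (Suc m))"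
      by (rule summable_comparison_test'[where N = 0]) (use bound in \<open>auto simp: less_imp_le[OF sobolev_weight_pos] abs_of_pos[OF sobolev_weight_pos]\<close>)
    have "(\<integral>\<^sup>+\<phi>. suminf (\<lambda>m. ennreal (?h \<phi> m)) \<partial>\<nu>) = suminf (\<lambda>m. ennreal (sobolev_weight s (int (Suc m)) / real (Suc m)))"
    proof (subst nn_integral_suminf)
      show "(\<lambda>\<phi>. ennreal (?h \<phi> m)) \<in> borel_measurable \<nu>" for m
        by (rule measurable_compose[OF meas measurable_ennreal])
    qed (simp only: E)
    also have "\<dots> \<noteq> top"
      by (rule ennreal_suminf_neq_top[OF sm]) (simp add: less_imp_le[OF sobolev_weight_pos])
    finally have "AE \<phi> in \<nu>. suminf (\<lambda>m. ennreal (?h \<phi> m)) \<noteq> \<infinity>"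
      by (intro nn_integral_PInf_AE borel_measurable_suminf_order measurable_compose[OF meas measurable_ennreal]) auto
    thus ?thesis
    proof (rule AE_mp, intro AE_I2 impI)
      fix \<phi> assume "suminf (\<lambda>m. ennreal (?h \<phi> m)) \<noteq> \<infinity>"
      thus "weighted_summable s (mode_coeff \<phi>)"
        unfolding weighted_summable_mode_coeff_iff by (intro summable_suminf_not_top nn) (auto simp: infinity_ennreal_def)
    qed
  qed
  hence "AE \<phi> in \<nu>. \<forall>j::nat. weighted_summable (- 1 / real (Suc j)) (mode_coeff \<phi>)"
    by (subst AE_all_countable) auto
  thus ?thesis
  proof (rule AE_mp, intro AE_I2 impI allI)
    fix \<phi> and s :: real
    assume all: "\<forall>j::nat. weighted_summable (- 1 / real (Suc j)) (mode_coeff \<phi>)" and s: "s < 0"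
    obtain j where "1 / real (Suc j) < - s" using reals_Archimedean[of "- s"] s by (auto simp: inverse_eq_divide)
    hence "s \<le> - 1 / real (Suc j)" by simp
    thus "\<exists>u. field_converges_to s \<phi> u"
      unfolding field_converges_ex_iff using all weighted_summable_mono by blast
  qed
qed

section \<open>The law of the field\<close>

theorem theorem1p5:
  fixes \<gamma> Q :: real and \<nu> :: "(nat \<Rightarrow> complex) measure" and \<alpha> :: complex
  assumes "0 < \<gamma>" and "\<gamma> \<le> 2" and "Q = \<gamma> / 2 + 2 / \<gamma>"
    and "prob_space \<nu>" and "sets \<nu> = sets (borel_on mode_space)"
    and "\<alpha> \<notin> kac_plus \<gamma> \<union> kac_minus \<gamma>"
    and "adjoint_relations Q \<alpha> \<nu>"
  shows "(AE \<phi> in \<nu>. \<forall>s<0. \<exists>u. field_converges_to s \<phi> u) \<and>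
         (\<forall>s<0. field_sum s \<in> measurable \<nu> (borel_on (sobolev_topology0 s)) \<and>
                field_law s \<nu> = log_correlated_law s)"
proof (intro conjI allI impI)
  have "Q > 0" using assms(1,3) by (simp add: add_pos_pos)
  hence \<nu>: "\<nu> = gaussian_modes"
    by (rule adjoint_relations_imp_gaussian[OF assms(4,5,7)])
  show "AE \<phi> in \<nu>. \<forall>s<0. \<exists>u. field_converges_to s \<phi> u"
    using gaussian_mode_variance by (intro AE_field_converges assms(5)) (simp_all add: \<nu>)
  fix s :: real
  show "field_sum s \<in> measurable \<nu> (borel_on (sobolev_topology0 s))"
    using field_sum_measurable assms(5) by (simp cong: measurable_cong_sets)
  show "field_law s \<nu> = log_correlated_law s"
    by (simp add: \<nu> log_correlated_law_def)
qed

end
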